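(* Let $u\in C^\infty(\mathbb R^3;\mathbb R^3)$ and $p\in C^\infty(\mathbb R^3)$ satisfy the stationary Navier–Stokes system $$u\cdot\nabla u-\Delta u=\nabla p,\qquad \operatorname{div}u=0\quad\text{in }\mathbb R^3.$$ Assume that $u\in BMO^{-1}(\mathbb R^3)$ and that $u\in L_6(\mathbb R^3)$. Then $u\equiv 0$ in $\mathbb R^3$.
   Context: A divergence-free vector field $u$ on $\mathbb R^3$ is said to belong to $BMO^{-1}(\mathbb R^3)$ if there exists a skew-symmetric matrix-valued function $d=(d_{ij})_{i,j=1}^3$ (i.e. $d_{ij}=-d_{ji}$) with all entries in $BMO(\mathbb R^3)$ such that $u=\operatorname{div} d$, i.e. $u_i=\sum_{j}\partial_j d_{ij}$ (in the sense of distributions). Here $(u\cdot\nabla u)_i=\sum_j u_j\partial_j u_i$. *)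

theory Defs
  imports "HOL-Analysis.Analysis"
begin

definition pd :: "'n::finite \<Rightarrow> (real^'n \<Rightarrow> 'b::real_normed_vector) \<Rightarrow> real^'n \<Rightarrow> 'b" where
  "pd j f x = frechet_derivative f (at x) (axis j 1)"

fun Ck :: "nat \<Rightarrow> (real^'n::finite \<Rightarrow> 'b::real_normed_vector) \<Rightarrow> bool" where
  "Ck 0 f = continuous_on UNIV f"
| "Ck (Suc k) f = (f differentiable_on UNIV \<and> continuous_on UNIV f \<and> (\<forall>j. Ck k (pd j f)))"

definition smooth :: "(real^'n::finite \<Rightarrow> 'b::real_normed_vector) \<Rightarrow> bool" where
  "smooth f \<longleftrightarrow> (\<forall>k. Ck k f)"

definition test_fun :: "(real^'n::finite \<Rightarrow> real) \<Rightarrow> bool" where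
  "test_fun \<phi> \<longleftrightarrow> smooth \<phi> \<and> compact (closure {x. \<phi> x \<noteq> 0})"

definition ball_avg :: "(real^'n::finite \<Rightarrow> real) \<Rightarrow> real^'n \<Rightarrow> real \<Rightarrow> real" where
  "ball_avg f x r = (set_lebesgue_integral lborel (ball x r) f) / measure lborel (ball x r)"

definition BMO :: "(real^'n::finite \<Rightarrow> real) \<Rightarrow> bool" where
  "BMO f \<longleftrightarrow> f \<in> borel_measurable lborel
     \<and> (\<forall>x r. r > 0 \<longrightarrow> set_integrable lborel (ball x r) f)
     \<and> (\<exists>M. \<forall>x r. r > 0 \<longrightarrow>
           (set_lebesgue_integral lborel (ball x r) (\<lambda>y. \<bar>f y - ball_avg f x r\<bar>))
             / measure lborel (ball x r) \<le> M)"

text \<open>u in BMO^{-1}: u = div d with d skew-symmetric with BMO entries, in the sense of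
  distributions: for every test function phi, int u_i phi = - sum_j int d_ij (d_j phi).\<close>
definition BMO_minus1 :: "(real^3 \<Rightarrow> real^3) \<Rightarrow> bool" where
  "BMO_minus1 u \<longleftrightarrow> (\<exists>d :: 3 \<Rightarrow> 3 \<Rightarrow> real^3 \<Rightarrow> real.
      (\<forall>i j x. d i j x = - d j i x)
    \<and> (\<forall>i j. BMO (d i j))
    \<and> (\<forall>\<phi>. test_fun \<phi> \<longrightarrow> (\<forall>i.
          integral\<^sup>L lborel (\<lambda>x. u x $ i * \<phi> x)
            = - (\<Sum>j\<in>UNIV. integral\<^sup>L lborel (\<lambda>x. d i j x * pd j \<phi> x)))))"

definition L6 :: "(real^'n::finite \<Rightarrow> real^'m::finite) \<Rightarrow> bool" where
  "L6 u \<longleftrightarrow> u \<in> borel_measurable lborel \<and> integrable lborel (\<lambda>x. norm (u x) ^ 6)"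

end

theory Submission
  imports Defs
begin

text \<open>The head pressure \<open>\<Phi> = |u|^2 / 2 - p\<close> satisfies \<open>\<Delta>\<Phi> - u \<cdot> \<nabla>\<Phi> = |curl u|^2\<close>. On a ball of radius L, with
  a cutoff \<open>\<eta>\<close>, this is tested with \<open>\<eta>^2 H(\<Phi>/\<delta>)\<close>, where \<open>H \<ge> 1\<close> is increasing. Writing \<open>u = div d\<close> with d
  skew, the drift term loses its second derivatives and becomes the integral of
  \<open>(d - mean d) : (\<nabla>\<eta>^2 \<otimes> \<nabla>\<Phi>) H(\<Phi>/\<delta>)\<close>; by the John-Nirenberg inequality it is absorbed in
  \<open>\<eta>^2 H' |\<nabla>\<Phi>|^2 / \<delta>\<close>, up to \<open>C \<delta>\<close> (at unit scale), because \<open>H^2 / H'\<close> grows less than quadratically. Here \<open>\<delta>\<close> is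
  the mean-square size of \<open>\<Phi>\<close> modulo constants. An interior \<open>L^2\<close> estimate for the pressure bounds \<open>\<delta>\<close> by
  the \<open>L^4\<close> norm of u, using a truncated Newton potential and nothing but integration by parts for its
  second derivatives. As u is in \<open>L^6\<close>, the bound is o(1) after scaling back, so \<open>curl u = 0\<close>; the gradient
  energy differs from the vorticity energy by the integral of \<open>\<nabla>^2(\<eta>^2) : u \<otimes> u\<close>, which also tends to 0.\<close>

section \<open>Smooth functions\<close>

text \<open>Testing the system with a cut-off u leaves a flux of cubic size over a shell of radius
  R, divided by R; for u in L^6 this is only bounded by R^(1/2). The BMO potential has to do better,
  and the equation of \<Phi> is where it can act. Its source is |curl u|^2, so with a constant H
  nothing would control the gradient of \<Phi> in the drift term; an increasing H creates the term
  \<eta>^2 H' |\<nabla>\<Phi>|^2. Since H must also stay above 1, H' decays at minus infinity, and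
  H^2 / H' has to fit the only control of \<Phi> at hand, its L^2 size. The decisive feature is that
  the vorticity bound is linear in \<delta>. For u_L(x) = L u(L x), the gradient energy on a unit
  ball is L times that of u on the ball of radius L, while the L^2 norm of |u_L|^2 is the square
  root of L times a local integral of |u|^4, hence o(L). Any power of \<delta> above the first would
  lose. The viscosity contributes terms of lower degree to the pressure estimate; they amount to an
  additive constant, which division by L removes.\<close>

lemma pd_eq: "(f has_derivative f') (at x) \<Longrightarrow> pd j f x = f' (axis j 1)"
  by (simp add: pd_def frechet_derivative_at[symmetric])

lemma pd_add:
  assumes "f differentiable at x" "g differentiable at x"
  shows "pd j (\<lambda>x. f x + g x) x = pd j f x + pd j g x"
  using pd_eq[OF has_derivative_add[OF assms[THEN frechet_derivative_works[THEN iffD1]]]]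
  by (simp add: pd_def)

lemma pd_mult:
  fixes f g :: "real^'n::finite \<Rightarrow> real"
  assumes "f differentiable at x" "g differentiable at x"
  shows "pd j (\<lambda>x. f x * g x) x = pd j f x * g x + f x * pd j g x"
  using pd_eq[OF has_derivative_mult[OF assms[THEN frechet_derivative_works[THEN iffD1]]]]
  by (simp add: pd_def)

lemma pd_linear:
  assumes "bounded_linear L" "f differentiable at x"
  shows "pd j (\<lambda>x. L (f x)) x = L (pd j f x)"
  using pd_eq[OF bounded_linear.has_derivative[OF assms(1) iffD1[OF frechet_derivative_works assms(2)]]]
  by (simp add: pd_def)

lemma pd_compose_real:
  fixes f :: "real^'n::finite \<Rightarrow> real"
  assumes "(h has_real_derivative h') (at (f x))" "f differentiable at x"
  shows "pd j (\<lambda>x. h (f x)) x = h' * pd j f x"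
proof -
  have "((\<lambda>x. h (f x)) has_derivative (\<lambda>y. h' * frechet_derivative f (at x) y)) (at x)"
    using has_derivative_compose[OF iffD1[OF frechet_derivative_works assms(2)]
        assms(1)[unfolded has_field_derivative_def]] .
  from pd_eq[OF this] show ?thesis by (simp add: pd_def)
qed

lemma pd_affine:
  assumes "f differentiable at (a *\<^sub>R x + b)"
  shows "pd j (\<lambda>x. f (a *\<^sub>R x + b)) x = a *\<^sub>R pd j f (a *\<^sub>R x + b)"
proof -
  have "((\<lambda>x. a *\<^sub>R x + b) has_derivative (\<lambda>x. a *\<^sub>R x)) (at x)"
    by (auto intro!: derivative_eq_intros)
  from pd_eq[OF has_derivative_compose[OF this iffD1[OF frechet_derivative_works assms]]]
  show ?thesis
    using linear_scale[OF linear_frechet_derivative[OF assms]]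
    by (simp add: pd_def)
qed

lemma Ck_differentiable: "Ck (Suc k) f \<Longrightarrow> f differentiable at x"
  by (simp add: differentiable_on_eq_differentiable_at)

lemma Ck_SucI:
  assumes "\<And>x. f differentiable at x" "\<And>j. Ck k (pd j f)"
  shows "Ck (Suc k) f"
  using assms by (auto simp: differentiable_on_eq_differentiable_at differentiable_imp_continuous_on)

lemma Ck_pd: "Ck (Suc k) f \<Longrightarrow> Ck k (pd j f)"
  by simp

lemma Ck_continuous: "Ck k f \<Longrightarrow> continuous_on S f"
  by (cases k) (auto intro: continuous_on_subset)

lemma Ck_SucD: "Ck (Suc k) f \<Longrightarrow> Ck k f"
  by (induction k arbitrary: f) auto

lemma Ck_le: "Ck k f \<Longrightarrow> j \<le> k \<Longrightarrow> Ck j f"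
  by (induction k) (auto simp del: Ck.simps dest: Ck_SucD simp: le_Suc_eq)

lemma Ck_const: "Ck k (\<lambda>x::real^'a::finite. c)"
proof (induction k arbitrary: c)
  case (Suc k)
  have "pd j (\<lambda>x::real^'a. c) = (\<lambda>x. 0)" for j
    by (rule ext) (simp add: pd_eq[OF has_derivative_const])
  then show ?case using Suc[of 0] by (intro Ck_SucI) auto
qed auto

lemma Ck_linear: "bounded_linear L \<Longrightarrow> Ck k f \<Longrightarrow> Ck k (\<lambda>x. L (f x))"
proof (induction k arbitrary: f)
  case 0
  then show ?case by (auto intro: bounded_linear.continuous_on)
next
  case (Suc k)
  have "pd j (\<lambda>x. L (f x)) = (\<lambda>x. L (pd j f x))" for j
    using pd_linear[OF Suc.prems(1) Ck_differentiable[OF Suc.prems(2)]] by auto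
  moreover have "(\<lambda>x. L (f x)) differentiable at x" for x
    using bounded_linear.has_derivative[OF Suc.prems(1)] Ck_differentiable[OF Suc.prems(2)]
    unfolding differentiable_def by blast
  ultimately show ?case using Suc by (intro Ck_SucI) auto
qed

lemma Ck_add: "Ck k f \<Longrightarrow> Ck k g \<Longrightarrow> Ck k (\<lambda>x. f x + g x)"
proof (induction k arbitrary: f g)
  case 0
  then show ?case by (auto intro: continuous_intros)
next
  case (Suc k)
  have "pd j (\<lambda>x. f x + g x) = (\<lambda>x. pd j f x + pd j g x)" for j
    using pd_add Ck_differentiable Suc.prems by blast
  then show ?case using Suc Ck_differentiable[OF Suc.prems(1)] Ck_differentiable[OF Suc.prems(2)]
    by (intro Ck_SucI) auto
qed

lemma Ck_mult:
  fixes f g :: "real^'n::finite \<Rightarrow> real"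
  shows "Ck k f \<Longrightarrow> Ck k g \<Longrightarrow> Ck k (\<lambda>x. f x * g x)"
proof (induction k arbitrary: f g)
  case 0
  then show ?case by (auto intro: continuous_intros)
next
  case (Suc k)
  have "pd j (\<lambda>x. f x * g x) = (\<lambda>x. pd j f x * g x + f x * pd j g x)" for j
    using pd_mult Ck_differentiable Suc.prems by blast
  moreover have "Ck k f" "Ck k g" using Suc.prems by (auto intro: Ck_SucD)
  ultimately show ?case
    using Suc Ck_differentiable[OF Suc.prems(1)] Ck_differentiable[OF Suc.prems(2)]
    by (intro Ck_SucI) (auto intro!: Ck_add)
qed

lemma Ck_minus: "Ck k f \<Longrightarrow> Ck k (\<lambda>x. - f x)"
  by (rule Ck_linear[OF bounded_linear_minus[OF bounded_linear_ident]])

lemma Ck_diff: "Ck k f \<Longrightarrow> Ck k g \<Longrightarrow> Ck k (\<lambda>x. f x - g x)"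
  using Ck_add[OF _ Ck_minus] by fastforce

lemma Ck_cmult: "Ck k f \<Longrightarrow> Ck k (\<lambda>x. c * f x)" for f :: "real^'n::finite \<Rightarrow> real"
  by (rule Ck_linear[OF bounded_linear_mult_right])

lemma Ck_sum: "(\<And>i. i \<in> A \<Longrightarrow> Ck k (f i)) \<Longrightarrow> Ck k (\<lambda>x. \<Sum>i\<in>A. f i x)"
  by (induction A rule: infinite_finite_induct) (auto intro: Ck_const Ck_add)

lemma Ck_nth: "Ck k f \<Longrightarrow> Ck k (\<lambda>x. f x $ i)"
  by (rule Ck_linear[OF bounded_linear_vec_nth])

lemma Ck_power: "Ck k f \<Longrightarrow> Ck k (\<lambda>x. f x ^ n)" for f :: "real^'n::finite \<Rightarrow> real"
  by (induction n) (auto intro: Ck_const Ck_mult)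

lemma Ck_coord: "Ck k (\<lambda>x. x $ i)"
proof (cases k)
  case (Suc m)
  have d: "((\<lambda>x. x $ i) has_derivative (\<lambda>x. x $ i)) (at x)" for x
    by (rule bounded_linear.has_derivative[OF bounded_linear_vec_nth has_derivative_ident])
  have "pd j (\<lambda>x. x $ i) = (\<lambda>x. axis j 1 $ i)" for j
    using pd_eq[OF d] by auto
  with d show ?thesis unfolding Suc
    by (intro Ck_SucI) (auto simp: differentiable_def intro: Ck_const)
qed (auto intro: continuous_intros)

lemma pd_coord: "pd j (\<lambda>x::real^'n::finite. x $ i :: real) x = (if i = j then 1 else 0)"
  by (simp add: pd_eq[OF bounded_linear.has_derivative[OF bounded_linear_vec_nth has_derivative_ident]] axis_def)

lemma Ck_affine: "Ck k f \<Longrightarrow> Ck k (\<lambda>x. f (a *\<^sub>R x + b))"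
proof (induction k arbitrary: f)
  case 0
  then show ?case by (auto intro!: continuous_intros continuous_on_compose2[of UNIV f])
next
  case (Suc k)
  have "pd j (\<lambda>x. f (a *\<^sub>R x + b)) = (\<lambda>x. a *\<^sub>R pd j f (a *\<^sub>R x + b))" for j
    using pd_affine Ck_differentiable Suc.prems by blast
  moreover have "(\<lambda>x. f (a *\<^sub>R x + b)) differentiable at x" for x
    by (rule differentiable_compose[of f, OF Ck_differentiable[OF Suc.prems]])
      (intro derivative_intros)
  ultimately show ?case using Suc
    by (intro Ck_SucI) (auto intro!: Ck_linear[OF bounded_linear_scaleR_right])
qed

text \<open>The outer function comes as the sequence \<open>h\<close> of its successive derivatives,
  so the induction can raise \<open>n\<close> while \<open>k\<close> goes down. The cap
  \<open>K\<close> admits profiles with finitely many derivatives, such as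
  \<open>newton_profile\<close>.\<close>

lemma Ck_compose_real:
  fixes f :: "real^'n::finite \<Rightarrow> real"
  assumes h: "\<And>i t. i < K \<Longrightarrow> t \<in> U \<Longrightarrow> (h i has_real_derivative h (Suc i) t) (at t)"
    and c: "\<And>i. i \<le> K \<Longrightarrow> continuous_on U (h i)"
    and U: "\<And>x. f x \<in> U" and f: "Ck K f"
  shows "n + k \<le> K \<Longrightarrow> Ck k (\<lambda>x. h n (f x))"
proof (induction k arbitrary: n)
  case 0
  then show ?case
    using U by (auto intro!: continuous_on_compose2[OF c Ck_continuous[OF f]])
next
  case (Suc k)
  have d: "f differentiable at x" for x
    using Ck_le[OF f, of "Suc k"] Suc.prems by (auto intro: Ck_differentiable simp del: Ck.simps)
  have h': "(h n has_real_derivative h (Suc n) (f x)) (at (f x))" for x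
    using h U Suc.prems by auto
  have "pd j (\<lambda>x. h n (f x)) = (\<lambda>x. h (Suc n) (f x) * pd j f x)" for j
    using pd_compose_real[OF h' d] by auto
  moreover have "Ck k (pd j f)" for j
    using Ck_le[OF f, of "Suc k"] Suc.prems by auto
  moreover have "(\<lambda>x. h n (f x)) differentiable at x" for x
    by (rule differentiable_compose[OF _ d])
      (use h'[of x] in \<open>auto simp: differentiable_def has_field_derivative_def\<close>)
  ultimately show ?case using Suc by (intro Ck_SucI) (auto intro!: Ck_mult)
qed

lemma smooth_compose_real:
  fixes f :: "real^'n::finite \<Rightarrow> real"
  assumes h: "\<And>i t. t \<in> U \<Longrightarrow> (h i has_real_derivative h (Suc i) t) (at t)"
    and U: "\<And>x. f x \<in> U" and f: "smooth f"
  shows "smooth (\<lambda>x. h 0 (f x))"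
  unfolding smooth_def
proof
  fix k
  have "continuous_on U (h i)" for i
    using h by (meson DERIV_continuous_on DERIV_subset top_greatest)
  then show "Ck k (\<lambda>x. h 0 (f x))"
    using Ck_compose_real[of k U h f 0 k] assms by (auto simp: smooth_def)
qed

lemma smooth_powr:
  fixes f :: "real^'n::finite \<Rightarrow> real"
  assumes "smooth f" "\<And>x. f x > 0"
  shows "smooth (\<lambda>x. f x powr a)"
proof -
  define h where "h = (\<lambda>(n::nat) t. (\<Prod>i<n. a - real i) * t powr (a - real n))"
  have "(h i has_real_derivative h (Suc i) t) (at t)" if "t \<in> {0<..}" for i t
    using that unfolding h_def
    by (auto intro!: derivative_eq_intros simp: algebra_simps)
  from smooth_compose_real[where h=h and U="{0<..}" and f=f, OF this] show ?thesis
    using assms by (simp add: h_def)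
qed

lemma smooth_sqrt:
  fixes f :: "real^'n::finite \<Rightarrow> real"
  assumes "smooth f" "\<And>x. f x > 0"
  shows "smooth (\<lambda>x. sqrt (f x))"
  using smooth_powr[OF assms, of "1/2"] assms(2) by (simp add: powr_half_sqrt less_imp_le)

text \<open>Every function t \<mapsto> q(1/t) exp(-1/t) extended by 0 to t \<le> 0 has a derivative of the same form.\<close>

definition bump_fun :: "real poly \<Rightarrow> real \<Rightarrow> real" where
  "bump_fun q t = (if t > 0 then poly q (1 / t) * exp (- 1 / t) else 0)"

lemma poly_exp_tendsto: "((\<lambda>s. poly q s * exp (- s)) \<longlongrightarrow> 0) at_top" for q :: "real poly"
proof -
  have "((\<lambda>s. \<Sum>i\<le>degree q. coeff q i * (s ^ i / exp s)) \<longlongrightarrow> (\<Sum>i\<le>degree q. coeff q i * 0)) at_top"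
    by (intro tendsto_sum tendsto_mult tendsto_const tendsto_power_div_exp_0)
  then show ?thesis
    by (simp add: poly_altdef sum_distrib_right exp_minus divide_inverse mult.assoc)
qed

lemma bump_fun_tendsto_0: "(bump_fun q \<longlongrightarrow> 0) (at 0)"
proof -
  have "((\<lambda>t. poly q (inverse t) * exp (- inverse t)) \<longlongrightarrow> 0) (at_right 0)"
    by (rule filterlim_compose[OF poly_exp_tendsto filterlim_inverse_at_top_right])
  then have "(bump_fun q \<longlongrightarrow> 0) (at_right 0)"
    by (rule Lim_transform_eventually)
      (auto simp: eventually_at_right_field bump_fun_def divide_inverse intro!: exI[of _ 1])
  moreover have "(bump_fun q \<longlongrightarrow> 0) (at_left 0)"
    by (rule Lim_transform_eventually[OF tendsto_const])
      (auto simp: eventually_at_left_field bump_fun_def intro!: exI[of _ "-1"])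
  ultimately show ?thesis by (simp add: filterlim_at_split)
qed

lemma bump_fun_deriv:
  "(bump_fun q has_real_derivative bump_fun (pCons 0 (pCons 0 (q - pderiv q))) t) (at t)"
proof -
  consider "t > 0" | "t = 0" | "t < 0" by linarith
  then show ?thesis
  proof cases
    case 1
    have "((\<lambda>t. poly q (1 / t) * exp (- 1 / t)) has_real_derivative
        bump_fun (pCons 0 (pCons 0 (q - pderiv q))) t) (at t)"
      using 1 by (auto intro!: derivative_eq_intros poly_DERIV[THEN DERIV_chain2]
          simp: bump_fun_def field_simps power2_eq_square)
    then show ?thesis
      by (rule has_field_derivative_transform_within_open[of _ _ _ "{0<..}"])
        (use 1 in \<open>auto simp: bump_fun_def\<close>)
  next
    case 2
    \<comment> \<open>At 0 the difference quotient of \<open>bump_fun q\<close> is itself a function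
      of this form, for the polynomial s q(s).\<close>
    have "((\<lambda>t. bump_fun (pCons 0 q) t) \<longlongrightarrow> 0) (at 0)" by (rule bump_fun_tendsto_0)
    then have "((\<lambda>t. (bump_fun q t - bump_fun q 0) / (t - 0)) \<longlongrightarrow> 0) (at 0)"
      by (rule Lim_transform_eventually)
        (auto simp: eventually_at_filter bump_fun_def divide_simps)
    then show ?thesis using 2
      by (simp add: has_field_derivative_iff bump_fun_def)
  next
    case 3
    have "((\<lambda>t. 0) has_real_derivative bump_fun (pCons 0 (pCons 0 (q - pderiv q))) t) (at t)"
      using 3 by (simp add: bump_fun_def)
    then show ?thesis
      by (rule has_field_derivative_transform_within_open[of _ _ _ "{..<0}"])
        (use 3 in \<open>auto simp: bump_fun_def\<close>)
  qed
qed

lemma smooth_bump_fun: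
  fixes f :: "real^'n::finite \<Rightarrow> real"
  assumes "smooth f"
  shows "smooth (\<lambda>x. bump_fun 1 (f x))"
proof -
  define h where "h n = bump_fun (((\<lambda>q. pCons 0 (pCons 0 (q - pderiv q))) ^^ n) 1)" for n
  have "(h i has_real_derivative h (Suc i) t) (at t)" for i t
    using bump_fun_deriv by (simp add: h_def)
  from smooth_compose_real[where h=h and U=UNIV and f=f, OF this] show ?thesis
    using assms by (simp add: h_def)
qed

lemma smooth_pd: "smooth f \<Longrightarrow> smooth (pd j f)"
  unfolding smooth_def using Ck_pd by blast

lemma smooth_intros:
  fixes f g :: "real^'n::finite \<Rightarrow> real"
  shows "smooth (\<lambda>x::real^'n. c::real)" "smooth (\<lambda>x::real^'n. x $ i)"
    "smooth f \<Longrightarrow> smooth g \<Longrightarrow> smooth (\<lambda>x. f x + g x)"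
    "smooth f \<Longrightarrow> smooth g \<Longrightarrow> smooth (\<lambda>x. f x - g x)"
    "smooth f \<Longrightarrow> smooth g \<Longrightarrow> smooth (\<lambda>x. f x * g x)"
    "smooth f \<Longrightarrow> smooth (\<lambda>x. - f x)"
    "smooth f \<Longrightarrow> smooth (\<lambda>x. f x ^ n)"
  by (auto simp: smooth_def intro: Ck_const Ck_coord Ck_add Ck_diff Ck_mult Ck_minus Ck_power)

lemma smooth_sum:
  "(\<And>i. i \<in> A \<Longrightarrow> smooth (f i)) \<Longrightarrow> smooth (\<lambda>x. \<Sum>i\<in>A. f i x)"
  by (auto simp: smooth_def intro: Ck_sum)

lemma smooth_nth: "smooth f \<Longrightarrow> smooth (\<lambda>x. f x $ i)"
  by (auto simp: smooth_def intro: Ck_nth)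

section \<open>Symmetry of second partial derivatives\<close>

lemma has_derivative_along_axis:
  fixes f :: "real^'n::finite \<Rightarrow> real"
  assumes "f differentiable at (x + t *\<^sub>R axis j 1)"
  shows "((\<lambda>t. f (x + t *\<^sub>R axis j 1)) has_real_derivative pd j f (x + t *\<^sub>R axis j 1)) (at t)"
proof -
  have "((\<lambda>t. x + t *\<^sub>R axis j 1) has_derivative (\<lambda>s. s *\<^sub>R axis j 1)) (at t)"
    by (auto intro!: derivative_eq_intros)
  from has_derivative_compose[OF this iffD1[OF frechet_derivative_works assms]]
  show ?thesis
    using linear_scale[OF linear_frechet_derivative[OF assms]]
    by (simp add: has_field_derivative_def pd_def mult.commute[of _ "frechet_derivative f _ _"] cong: if_cong)
qed

text \<open>The mean value theorem is used twice: in direction i for the increment of f in direction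
  j, then in direction j for \<open>pd i f\<close>. The left side is symmetric in i and j, the right
  side is not.\<close>

lemma second_difference_mvt:
  fixes f :: "real^'n::finite \<Rightarrow> real"
  assumes f: "Ck 2 f" and h: "h > 0"
  shows "\<exists>s t. 0 < s \<and> s < h \<and> 0 < t \<and> t < h \<and>
    f (x + h *\<^sub>R axis i 1 + h *\<^sub>R axis j 1) - f (x + h *\<^sub>R axis i 1) - f (x + h *\<^sub>R axis j 1) + f x
    = h * h * pd j (pd i f) (x + s *\<^sub>R axis i 1 + t *\<^sub>R axis j 1)"
proof -
  have df: "f differentiable at y" "pd i f differentiable at y" for y
    using f by (auto simp: numeral_2_eq_2 intro: Ck_differentiable simp del: Ck.simps dest: Ck_pd)
  let ?g = "\<lambda>s. f (x + h *\<^sub>R axis j 1 + s *\<^sub>R axis i 1) - f (x + s *\<^sub>R axis i 1)"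
  let ?g' = "\<lambda>s. pd i f (x + h *\<^sub>R axis j 1 + s *\<^sub>R axis i 1) - pd i f (x + s *\<^sub>R axis i 1)"
  have "(?g has_real_derivative ?g' s) (at s)" for s
    by (intro DERIV_diff has_derivative_along_axis df)
  from MVT2[OF h this] obtain s where s: "0 < s" "s < h" "?g h - ?g 0 = h * ?g' s" by auto
  let ?k = "\<lambda>t. pd i f (x + s *\<^sub>R axis i 1 + t *\<^sub>R axis j 1)"
  have "(?k has_real_derivative pd j (pd i f) (x + s *\<^sub>R axis i 1 + t *\<^sub>R axis j 1)) (at t)" for t
    by (intro has_derivative_along_axis df)
  from MVT2[OF h this] obtain t where t: "0 < t" "t < h"
    "?k h - ?k 0 = h * pd j (pd i f) (x + s *\<^sub>R axis i 1 + t *\<^sub>R axis j 1)" by auto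
  have "?g' s = ?k h - ?k 0" by (simp add: add_ac)
  with s(3) t(3) have "?g h - ?g 0 = h * (h * pd j (pd i f) (x + s *\<^sub>R axis i 1 + t *\<^sub>R axis j 1))"
    by simp
  then show ?thesis using s t by (intro exI[of _ s] exI[of _ t]) (auto simp: algebra_simps)
qed

text \<open>The second difference quotient \<open>D i j\<close> is symmetric in i and j, and its
  mean value form converges to \<open>pd j (pd i f) x\<close> by continuity; uniqueness of limits
  does the rest.\<close>

lemma pd_commute:
  fixes f :: "real^'n::finite \<Rightarrow> real"
  assumes f: "Ck 2 f"
  shows "pd i (pd j f) = pd j (pd i f)"
proof
  fix x
  define D where "D i j n = (f (x + (1/Suc n) *\<^sub>R axis i 1 + (1/Suc n) *\<^sub>R axis j 1)
      - f (x + (1/Suc n) *\<^sub>R axis i 1) - f (x + (1/Suc n) *\<^sub>R axis j 1) + f x) * (real (Suc n) * real (Suc n))"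
    for i j and n :: nat
  have conv: "D i j \<longlonglongrightarrow> pd j (pd i f) x" for i j
  proof -
    have "\<exists>p. norm (p - x) \<le> 2 / Suc n \<and>
      f (x + (1/Suc n) *\<^sub>R axis i 1 + (1/Suc n) *\<^sub>R axis j 1) - f (x + (1/Suc n) *\<^sub>R axis i 1)
      - f (x + (1/Suc n) *\<^sub>R axis j 1) + f x = (1/Suc n) * (1/Suc n) * pd j (pd i f) p" for n
    proof -
      obtain s t where st: "0 < s" "s < 1/Suc n" "0 < t" "t < 1/Suc n"
        "f (x + (1/Suc n) *\<^sub>R axis i 1 + (1/Suc n) *\<^sub>R axis j 1) - f (x + (1/Suc n) *\<^sub>R axis i 1)
         - f (x + (1/Suc n) *\<^sub>R axis j 1) + f x
         = (1/Suc n) * (1/Suc n) * pd j (pd i f) (x + s *\<^sub>R axis i 1 + t *\<^sub>R axis j 1)"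
        using second_difference_mvt[OF f, of "1/Suc n" x i j] by auto
      have "norm (s *\<^sub>R (axis i 1::real^'n) + t *\<^sub>R axis j 1) \<le> \<bar>s\<bar> + \<bar>t\<bar>"
        by (rule norm_triangle_le) simp
      also have "\<dots> \<le> 2 / Suc n" using st by simp
      finally show ?thesis using st(5)
        by (intro exI[of _ "x + s *\<^sub>R axis i 1 + t *\<^sub>R axis j 1"]) (simp add: algebra_simps)
    qed
    then obtain p where p: "\<And>n. norm (p n - x) \<le> 2 / Suc n"
      "\<And>n. f (x + (1/Suc n) *\<^sub>R axis i 1 + (1/Suc n) *\<^sub>R axis j 1) - f (x + (1/Suc n) *\<^sub>R axis i 1)
      - f (x + (1/Suc n) *\<^sub>R axis j 1) + f x = (1/Suc n) * (1/Suc n) * pd j (pd i f) (p n)"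
      by metis
    have "(\<lambda>n. 2 * inverse (real (Suc n))) \<longlonglongrightarrow> 2 * 0"
      by (intro tendsto_mult tendsto_const LIMSEQ_inverse_real_of_nat)
    then have "(\<lambda>n. 2 / real (Suc n)) \<longlonglongrightarrow> 0" by (simp add: divide_inverse)
    then have "(\<lambda>n. p n - x) \<longlonglongrightarrow> 0"
      by (rule Lim_null_comparison[OF always_eventually[OF allI[OF p(1)]]])
    then have "p \<longlonglongrightarrow> x" by (simp add: LIM_zero_iff)
    moreover have "isCont (pd j (pd i f)) x"
      using f by (simp add: numeral_2_eq_2 continuous_on_eq_continuous_at)
    ultimately have "(\<lambda>n. pd j (pd i f) (p n)) \<longlonglongrightarrow> pd j (pd i f) x"
      by (intro isCont_tendsto_compose[of x "pd j (pd i f)"])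
    moreover have "D i j = (\<lambda>n. pd j (pd i f) (p n))"
      by (rule ext, unfold D_def p(2)) (simp del: of_nat_Suc)
    ultimately show ?thesis by simp
  qed
  have "D i j = D j i" by (rule ext) (simp add: D_def add_ac)
  with conv[of i j] conv[of j i] show "pd i (pd j f) x = pd j (pd i f) x"
    using LIMSEQ_unique by auto
qed

section \<open>Integration by parts and convolution\<close>

lemma integral_cbox_superset:
  fixes f :: "'a::euclidean_space \<Rightarrow> real"
  assumes "\<And>x. x \<notin> S \<Longrightarrow> f x = 0" "S \<subseteq> T"
  shows "integral T f = integral S f"
proof -
  have "f = (\<lambda>x. if x \<in> S then f x else 0)" using assms(1) by auto
  then have "integral T f = integral T (\<lambda>x. if x \<in> S then f x else 0)" by simp
  also have "\<dots> = integral (S \<inter> T) f" by (rule integral_restrict_Int)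
  finally show ?thesis using assms(2) by (simp add: inf_absorb1)
qed

lemma continuous_integrable_cbox: "continuous_on UNIV f \<Longrightarrow> f integrable_on cbox a b"
  for f :: "'a::euclidean_space \<Rightarrow> real"
  by (auto intro: integrable_continuous continuous_on_subset)

lemma set_integrable_cbox_continuous:
  fixes f :: "'a::euclidean_space \<Rightarrow> real"
  assumes "continuous_on UNIV f"
  shows "set_integrable lborel (cbox a b) f"
  unfolding set_integrable_def
  by (intro borel_integrable_compact compact_cbox) (use assms continuous_on_subset in auto)

lemma lborel_integral_cbox:
  fixes f :: "'a::euclidean_space \<Rightarrow> real"
  assumes "continuous_on UNIV f" "\<And>x. x \<notin> cbox a b \<Longrightarrow> f x = 0"
  shows "integrable lborel f" "integral\<^sup>L lborel f = integral (cbox a b) f"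
proof -
  have eq: "f = (\<lambda>x. indicator (cbox a b) x *\<^sub>R f x)"
    using assms(2) by (auto simp: indicator_def fun_eq_iff)
  have si: "set_integrable lborel (cbox a b) f"
    by (rule set_integrable_cbox_continuous[OF assms(1)])
  then show "integrable lborel f" using eq unfolding set_integrable_def by simp
  show "integral\<^sup>L lborel f = integral (cbox a b) f"
    using set_borel_integral_eq_integral(2)[OF si] eq
    unfolding set_lebesgue_integral_def by simp
qed

lemma pd_eq_0_on_open:
  assumes "open V" "x \<in> V" "\<And>y. y \<in> V \<Longrightarrow> f y = 0"
  shows "pd j f x = 0"
proof -
  have "(f has_derivative (\<lambda>_. 0)) (at x)"
    by (rule has_derivative_transform_within_open[of "\<lambda>_. 0" _ _ _ V]) (use assms in auto)
  from pd_eq[OF this] show ?thesis .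
qed

lemma pd_eq_0_outside_cbox:
  assumes "\<And>y. y \<notin> cbox a b \<Longrightarrow> f y = 0" "x \<notin> cbox a b"
  shows "pd j f x = 0"
  by (rule pd_eq_0_on_open[of "- cbox a b"]) (use assms in auto)

text \<open>Translation invariance makes the integral of f(x + t e) independent of t; differentiate at t = 0.\<close>

lemma integral_pd_eq_0:
  fixes f :: "real^'n::finite \<Rightarrow> real"
  assumes f: "Ck 1 f" and supp: "\<And>x. x \<notin> cbox a b \<Longrightarrow> f x = 0"
  shows "integral (cbox a b) (pd j f) = 0"
proof -
  \<comment> \<open>The margin 1 keeps the translated support inside for |t| < 1, so the parameter
    integral runs over one fixed box.\<close>
  let ?B = "cbox (a - 1) (b + 1)"
  let ?e = "axis j 1 :: real^'n"
  have df: "f differentiable at x" for x using f by (auto intro: Ck_differentiable simp del: Ck.simps)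
  have cf: "continuous_on UNIV f" using f by (auto intro: Ck_continuous)
  have cpd: "continuous_on UNIV (pd j f)" using f by simp
  define F where "F t = integral ?B (\<lambda>x. f (x + t *\<^sub>R ?e))" for t
  have "(F has_field_derivative integral ?B (\<lambda>x. pd j f (x + 0 *\<^sub>R ?e))) (at 0 within UNIV)"
    unfolding F_def
  proof (rule leibniz_rule_field_derivative)
    fix t :: real and x assume "x \<in> ?B"
    show "((\<lambda>t. f (x + t *\<^sub>R ?e)) has_field_derivative pd j f (x + t *\<^sub>R ?e)) (at t within UNIV)"
      using has_derivative_along_axis[OF df] by simp
  next
    fix t :: real
    show "(\<lambda>x. f (x + t *\<^sub>R ?e)) integrable_on ?B"
      by (intro continuous_integrable_cbox continuous_on_compose2[OF cf] continuous_intros) auto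
  next
    show "continuous_on (UNIV \<times> ?B) (\<lambda>(t, x). pd j f (x + t *\<^sub>R ?e))"
      unfolding split_def
      by (intro continuous_on_compose2[OF cpd] continuous_intros) auto
  qed auto
  moreover have "integral ?B (pd j f) = integral (cbox a b) (pd j f)"
  proof (rule integral_cbox_superset)
    show "pd j f x = 0" if "x \<notin> cbox a b" for x
      by (rule pd_eq_0_outside_cbox[OF supp that])
    show "cbox a b \<subseteq> ?B"
      unfolding subset_iff mem_box_cart vector_add_component vector_minus_component one_index
      by (smt (verit))
  qed
  moreover have "F t = integral (cbox a b) f" if "t \<in> {-1<..<1}" for t
  proof -
    have "F t = integral ?B (f \<circ> (+) (t *\<^sub>R ?e))"
      by (simp add: F_def o_def add.commute)
    also have "\<dots> = integral (cbox (a - 1 + t *\<^sub>R ?e) (b + 1 + t *\<^sub>R ?e)) f"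
      by (rule integral_shift_cbox_plus)
    also have "\<dots> = integral (cbox a b) f"
    proof (rule integral_cbox_superset[OF supp])
      have "\<bar>(t *\<^sub>R ?e) $ i\<bar> \<le> 1" for i
        using that by (auto simp: axis_def)
      then have "- 1 \<le> (t *\<^sub>R ?e) $ i" "(t *\<^sub>R ?e) $ i \<le> 1" for i
        by (auto simp: abs_le_iff minus_le_iff)
      then show "cbox a b \<subseteq> cbox (a - 1 + t *\<^sub>R ?e) (b + 1 + t *\<^sub>R ?e)"
        unfolding subset_iff mem_box_cart vector_add_component vector_minus_component one_index
        by (smt (verit))
    qed
    finally show ?thesis .
  qed
  then have "(F has_field_derivative 0) (at 0)"
    using has_field_derivative_transform_within_open[OF DERIV_const, of "{-1<..<1}" 0 "integral (cbox a b) f" F]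
    by auto
  ultimately show ?thesis using DERIV_unique[of F _ 0 0] by simp
qed

lemma integral_by_parts_pd:
  fixes f g :: "real^'n::finite \<Rightarrow> real"
  assumes f: "Ck 1 f" and g: "Ck 1 g" and supp: "\<And>x. x \<notin> cbox a b \<Longrightarrow> f x = 0 \<or> g x = 0"
  shows "integral (cbox a b) (\<lambda>x. f x * pd j g x) = - integral (cbox a b) (\<lambda>x. pd j f x * g x)"
proof -
  have df: "f differentiable at x" "g differentiable at x" for x
    using f g by (auto intro: Ck_differentiable simp del: Ck.simps)
  have c: "continuous_on UNIV f" "continuous_on UNIV g" "continuous_on UNIV (pd j f)" "continuous_on UNIV (pd j g)"
    using f g by simp_all
  have "integral (cbox a b) (pd j (\<lambda>x. f x * g x)) = 0"
    using supp by (intro integral_pd_eq_0 Ck_mult f g) auto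
  also have "pd j (\<lambda>x. f x * g x) = (\<lambda>x. pd j f x * g x + f x * pd j g x)"
    using pd_mult[OF df] by auto
  finally show ?thesis
    by (subst (asm) integral_add) (intro continuous_integrable_cbox continuous_intros c | simp)+
qed

section \<open>Convolution over a box and its derivatives\<close>

lemma frechet_derivative_pd_sum:
  assumes "f differentiable at x"
  shows "frechet_derivative f (at x) h = (\<Sum>j\<in>UNIV. h $ j *\<^sub>R pd j f x)"
proof -
  interpret linear "frechet_derivative f (at x)"
    by (rule linear_frechet_derivative[OF assms])
  have "h = (\<Sum>j\<in>UNIV. h $ j *\<^sub>R axis j 1)"
    by (simp add: basis_expansion scalar_mult_eq_scaleR[symmetric])
  then have "frechet_derivative f (at x) h = frechet_derivative f (at x) (\<Sum>j\<in>UNIV. h $ j *\<^sub>R axis j 1)"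
    by simp
  also have "\<dots> = (\<Sum>j\<in>UNIV. h $ j *\<^sub>R pd j f x)"
    by (simp add: sum scale pd_def)
  finally show ?thesis .
qed

text \<open>The density \<open>g\<close> is truncated by the domain of integration instead of a
  cutoff function: it only has to be continuous, and every derivative falls on
  \<open>K\<close>.\<close>

definition conv :: "real^'n::finite \<Rightarrow> real^'n \<Rightarrow> (real^'n \<Rightarrow> real) \<Rightarrow> (real^'n \<Rightarrow> real) \<Rightarrow> real^'n \<Rightarrow> real" where
  "conv a b g K x = integral (cbox a b) (\<lambda>y. g y * K (x - y))"

lemma conv_integrable:
  fixes g K :: "real^'n::finite \<Rightarrow> real"
  assumes g: "continuous_on UNIV g" and K: "continuous_on UNIV K"
  shows "(\<lambda>y. g y * K (x - y)) integrable_on cbox a b"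
  by (intro continuous_integrable_cbox continuous_intros g continuous_on_compose2[OF K]) auto

lemma conv_has_derivative:
  assumes g: "continuous_on UNIV g" and K: "Ck 1 K"
  shows "(conv a b g K has_derivative (\<lambda>h. \<Sum>j\<in>UNIV. h $ j * conv a b g (pd j K) x)) (at x)"
proof -
  have dK: "K differentiable at z" for z using K by (auto intro: Ck_differentiable simp del: Ck.simps)
  have cK: "continuous_on UNIV K" using K by (auto intro: Ck_continuous)
  have cpd: "continuous_on UNIV (pd j K)" for j using K by simp
  \<comment> \<open>\<open>leibniz_rule\<close> wants the derivative as a continuous map into
    bounded linear functions; it is assembled from the coordinate functionals.\<close>
  define B where "B j = Blinfun (\<lambda>h::real^'a. h $ j)" for j
  have B: "blinfun_apply (B j) h = h $ j" for j h
    unfolding B_def by (simp add: bounded_linear_Blinfun_apply bounded_linear_vec_nth)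
  define fx where "fx z y = (\<Sum>j\<in>UNIV. (g y * pd j K (z - y)) *\<^sub>R B j)" for z y
  have fx: "blinfun_apply (fx z y) h = g y * frechet_derivative K (at (z - y)) h" for z y h
    by (simp add: fx_def blinfun.sum_left blinfun.scaleR_left B frechet_derivative_pd_sum[OF dK]
        sum_distrib_left mult_ac)
  have "((\<lambda>z. integral (cbox a b) (\<lambda>y. g y * K (z - y))) has_derivative
      blinfun_apply (integral (cbox a b) (fx x))) (at x within UNIV)"
  proof (rule leibniz_rule)
    fix z y assume "y \<in> cbox a b"
    have "((\<lambda>z. z - y) has_derivative (\<lambda>h. h)) (at z)"
      by (auto intro!: derivative_eq_intros)
    from has_derivative_compose[OF this iffD1[OF frechet_derivative_works dK]]
    have "((\<lambda>z. g y * K (z - y)) has_derivative (\<lambda>h. g y * frechet_derivative K (at (z - y)) h)) (at z)"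
      by (rule has_derivative_mult_right)
    moreover have "blinfun_apply (fx z y) = (\<lambda>h. g y * frechet_derivative K (at (z - y)) h)"
      using fx by auto
    ultimately show "((\<lambda>z. g y * K (z - y)) has_derivative blinfun_apply (fx z y)) (at z within UNIV)"
      by simp
  next
    show "(\<lambda>y. g y * K (z - y)) integrable_on cbox a b" for z
      by (rule conv_integrable[OF g cK])
  next
    show "continuous_on (UNIV \<times> cbox a b) (\<lambda>(z, y). fx z y)"
      unfolding split_def fx_def
      by (intro continuous_intros continuous_on_compose2[OF cpd] continuous_on_compose2[OF g]) auto
  qed auto
  moreover have "blinfun_apply (integral (cbox a b) (fx x)) = (\<lambda>h. \<Sum>j\<in>UNIV. h $ j * conv a b g (pd j K) x)"
  proof
    fix h :: "real^'a"
    have int: "fx x integrable_on cbox a b"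
      unfolding fx_def
      by (intro integrable_continuous continuous_intros continuous_on_compose2[OF cpd]
          continuous_on_compose2[OF g]) auto
    have "blinfun_apply (integral (cbox a b) (fx x)) h = integral (cbox a b) (\<lambda>y. blinfun_apply (fx x y) h)"
      using integral_linear[OF int blinfun.bounded_linear_left[of h], symmetric]
      by (simp add: o_def)
    also have "\<dots> = integral (cbox a b) (\<lambda>y. \<Sum>j\<in>UNIV. h $ j * (g y * pd j K (x - y)))"
      by (simp add: fx frechet_derivative_pd_sum[OF dK] sum_distrib_left mult_ac)
    also have "\<dots> = (\<Sum>j\<in>UNIV. h $ j * conv a b g (pd j K) x)"
      unfolding conv_def
      by (subst integral_sum) (auto intro!: conv_integrable g cpd integrable_on_mult_right)
    finally show "blinfun_apply (integral (cbox a b) (fx x)) h = (\<Sum>j\<in>UNIV. h $ j * conv a b g (pd j K) x)" .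
  qed
  ultimately show ?thesis by (simp add: conv_def[abs_def])
qed

lemma pd_conv:
  assumes "continuous_on UNIV g" "Ck 1 K"
  shows "pd j (conv a b g K) = conv a b g (pd j K)"
proof
  fix x
  show "pd j (conv a b g K) x = conv a b g (pd j K) x"
    using pd_eq[OF conv_has_derivative[OF assms]]
    by (simp add: axis_def if_distrib[of "\<lambda>r. r * _"] cong: if_cong)
qed

lemma Ck_conv:
  assumes g: "continuous_on UNIV g"
  shows "Ck (Suc k) K \<Longrightarrow> Ck (Suc k) (conv a b g K)"
proof (induction k arbitrary: K)
  case 0
  have c: "continuous_on UNIV (pd j K)" for j using 0 by simp
  have K: "continuous_on UNIV K" using 0 by simp
  have "continuous_on UNIV (conv a b g (pd j K))" for j
    unfolding conv_def
  proof (rule integral_continuous_on_param)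
    show "continuous_on (UNIV \<times> cbox a b) (\<lambda>(x, y). g y * pd j K (x - y))"
      unfolding split_def
      by (intro continuous_intros continuous_on_compose2[OF c] continuous_on_compose2[OF g]) auto
  qed
  moreover have "Ck 1 K" using 0 by simp
  ultimately show ?case using pd_conv[OF g, of K]
    by (intro Ck_SucI differentiableI[OF conv_has_derivative[OF g]]) auto
next
  case (Suc k)
  have 1: "Ck 1 K" using Ck_le[OF Suc.prems, of 1] by simp
  show ?case
    using Suc.IH[OF Ck_pd[OF Suc.prems]]
    by (intro Ck_SucI[OF differentiableI[OF conv_has_derivative[OF g 1]]]) (simp only: pd_conv[OF g 1])
qed

section \<open>BMO: a John-Nirenberg pairing on cubes\<close>

text \<open>Half-open, so that the dyadic children partition a cube exactly; \<open>ccube\<close> is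
  the compact version. They differ by a null set.\<close>

definition hcube :: "real^'n::finite \<Rightarrow> real \<Rightarrow> (real^'n) set" where
  "hcube a l = {x. \<forall>i. a $ i \<le> x $ i \<and> x $ i < a $ i + l}"

definition ccube :: "real^'n::finite \<Rightarrow> real \<Rightarrow> (real^'n) set" where
  "ccube a l = cbox a (a + (\<chi> i. l))"

definition subcorner :: "real^'n::finite \<Rightarrow> real \<Rightarrow> bool^'n \<Rightarrow> real^'n" where
  "subcorner a l s = a + (\<chi> i. if s $ i then l / 2 else 0)"

definition cube_avg :: "(real^'n::finite \<Rightarrow> real) \<Rightarrow> real^'n \<Rightarrow> real \<Rightarrow> real" where
  "cube_avg f a l = (LINT x:hcube a l|lborel. f x) / l ^ CARD('n)"

text \<open>Sums a function of cubes over the n-th dyadic generation. The recursion through the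
  children spares an indexing of that generation.\<close>

fun dyadic_sum :: "nat \<Rightarrow> (real^'n::finite \<Rightarrow> real \<Rightarrow> real) \<Rightarrow> real^'n \<Rightarrow> real \<Rightarrow> real" where
  "dyadic_sum 0 \<phi> a l = \<phi> a l"
| "dyadic_sum (Suc n) \<phi> a l = (\<Sum>s\<in>UNIV. dyadic_sum n \<phi> (subcorner a l s) (l / 2))"

lemma mem_ccube: "x \<in> ccube a l \<longleftrightarrow> (\<forall>i. a $ i \<le> x $ i \<and> x $ i \<le> a $ i + l)"
  by (simp add: ccube_def mem_box_cart)

lemma hcube_subset_ccube: "hcube a l \<subseteq> ccube a l"
  by (auto simp: hcube_def mem_ccube less_imp_le)

lemma box_subset_hcube: "box a (a + (\<chi> i. l)) \<subseteq> hcube a l"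
  by (auto simp: hcube_def mem_box_cart less_imp_le)

lemma sets_hcube [measurable, simp]: "hcube a l \<in> sets borel"
  unfolding hcube_def by measurable

lemma measure_ccube: "l \<ge> 0 \<Longrightarrow> measure lborel (ccube a l) = l ^ CARD('n)" for a :: "real^'n::finite"
  unfolding ccube_def by (subst content_cbox_cart) (auto simp: interval_ne_empty_cart)

lemma AE_hcube_ccube: "AE x in lborel. x \<in> hcube a l \<longleftrightarrow> x \<in> ccube a l"
proof -
  have "AE x in lborel. x \<notin> cbox a (a + (\<chi> i. l)) - box a (a + (\<chi> i. l))"
    by (rule AE_not_in[OF null_sets_cbox_Diff_box])
  then show ?thesis
  proof eventually_elim
    case (elim x)
    then show ?case
      using hcube_subset_ccube[of a l] box_subset_hcube[of a l] by (auto simp: ccube_def)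
  qed
qed

lemma sets_ccube [measurable, simp]: "ccube a l \<in> sets borel"
  by (simp add: ccube_def)

lemma emeasure_hcube_finite: "emeasure lborel (hcube a l) < \<infinity>"
proof -
  have "emeasure lborel (hcube a l) \<le> emeasure lborel (ccube a l)"
    by (intro emeasure_mono hcube_subset_ccube) simp
  also have "\<dots> < \<infinity>" unfolding ccube_def by (rule emeasure_lborel_cbox_finite)
  finally show ?thesis .
qed

lemma measure_hcube: "l \<ge> 0 \<Longrightarrow> measure lborel (hcube a l) = l ^ CARD('n)" for a :: "real^'n::finite"
  using measure_ccube[of l a] AE_hcube_ccube[of a l] measure_eq_AE[of "hcube a l" "ccube a l" lborel]
  by simp

lemma set_integral_hcube_eq_ccube:
  fixes f :: "real^'n::finite \<Rightarrow> real"
  assumes "f \<in> borel_measurable lborel"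
  shows "(LINT x:ccube a l|lborel. f x) = (LINT x:hcube a l|lborel. f x)"
  by (rule set_integral_cong_set)
    (use assms AE_hcube_ccube[of a l] in \<open>auto simp: set_borel_measurable_def\<close>)

lemma set_integrable_hcube_const [simp]: "set_integrable lborel (hcube a l) (\<lambda>x. c::real)"
  unfolding set_integrable_def
  by (intro integrable_scaleR_left impI integrable_real_indicator emeasure_hcube_finite) simp

lemma set_integral_hcube_const:
  "l \<ge> 0 \<Longrightarrow> (LINT x:hcube a l|lborel. c) = c * l ^ CARD('n)" for a :: "real^'n::finite"
  using emeasure_hcube_finite[of a l] by (simp add: set_integral_const measure_hcube)

lemma hcube_eq_UN_subcubes:
  assumes "l > 0"
  shows "hcube a l = (\<Union>s. hcube (subcorner a l s) (l / 2))"
proof (intro equalityI subsetI)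
  fix x assume x: "x \<in> hcube a l"
  have "x \<in> hcube (subcorner a l (\<chi> i. a $ i + l / 2 \<le> x $ i)) (l / 2)"
    unfolding hcube_def subcorner_def mem_Collect_eq
  proof
    fix i
    show "(a + (\<chi> i. if (\<chi> i. a $ i + l / 2 \<le> x $ i) $ i then l / 2 else 0)) $ i \<le> x $ i \<and>
      x $ i < (a + (\<chi> i. if (\<chi> i. a $ i + l / 2 \<le> x $ i) $ i then l / 2 else 0)) $ i + l / 2"
      using x unfolding hcube_def mem_Collect_eq
      by (cases "a $ i + l / 2 \<le> x $ i") (auto dest!: spec[of _ i])
  qed
  then show "x \<in> (\<Union>s. hcube (subcorner a l s) (l / 2))" by blast
next
  fix x assume "x \<in> (\<Union>s. hcube (subcorner a l s) (l / 2))"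
  then obtain s where s: "x \<in> hcube (subcorner a l s) (l / 2)" by blast
  show "x \<in> hcube a l"
    unfolding hcube_def mem_Collect_eq
  proof
    fix i
    show "a $ i \<le> x $ i \<and> x $ i < a $ i + l"
      using s[unfolded hcube_def subcorner_def mem_Collect_eq, rule_format, of i] assms
      by (cases "s $ i") auto
  qed
qed

lemma disjoint_subcubes: "disjoint_family (\<lambda>s. hcube (subcorner a l s) (l / 2))"
proof -
  have "s = s'" if x: "x \<in> hcube (subcorner a l s) (l / 2)" "x \<in> hcube (subcorner a l s') (l / 2)" for x s s'
  proof -
    have "s $ i = s' $ i" for i
      using x unfolding hcube_def subcorner_def mem_Collect_eq
      by (auto dest!: spec[of _ i] split: if_splits)
    then show ?thesis by (simp add: vec_eq_iff)
  qed
  then show ?thesis by (auto simp: disjoint_family_on_def)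
qed

lemma subcube_subset: "l > 0 \<Longrightarrow> hcube (subcorner a l s) (l / 2) \<subseteq> hcube a l"
  using hcube_eq_UN_subcubes by blast

lemma set_integral_subcubes:
  fixes f :: "real^'n::finite \<Rightarrow> real"
  assumes "l > 0" "set_integrable lborel (hcube a l) f"
  shows "(\<Sum>s\<in>UNIV. LINT x:hcube (subcorner a l s) (l / 2)|lborel. f x) = (LINT x:hcube a l|lborel. f x)"
proof -
  have "set_integrable lborel (hcube (subcorner a l s) (l / 2)) f" for s
    by (rule set_integrable_subset[OF assms(2)]) (use subcube_subset[OF assms(1)] in auto)
  then show ?thesis
    unfolding hcube_eq_UN_subcubes[OF assms(1), of a]
    by (subst set_integral_finite_Union) (auto simp: disjoint_subcubes)
qed

text \<open>The comparison is asked only of subcubes of the right generation; this is where uniform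
  continuity of an integrand can enter.\<close>

lemma dyadic_sum_mono:
  assumes "\<And>a' l'. l' > 0 \<Longrightarrow> l' = l / 2 ^ n \<Longrightarrow> hcube a' l' \<subseteq> hcube a l \<Longrightarrow> \<phi> a' l' \<le> \<psi> a' l'" "l > 0"
  shows "dyadic_sum n \<phi> a l \<le> dyadic_sum n \<psi> a l"
  using assms
proof (induction n arbitrary: a l)
  case (Suc n)
  show ?case unfolding dyadic_sum.simps
  proof (rule sum_mono, rule Suc.IH)
    fix s a' l' assume "(0::real) < l'" "l' = l / 2 / 2 ^ n" "hcube a' l' \<subseteq> hcube (subcorner a l s) (l / 2)"
    then show "\<phi> a' l' \<le> \<psi> a' l'"
      using subcube_subset[OF Suc.prems(2), of a s] by (intro Suc.prems) auto
  qed (use Suc.prems in auto)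
qed auto

lemma dyadic_sum_add: "dyadic_sum n (\<lambda>a l. \<phi> a l + \<psi> a l) a l = dyadic_sum n \<phi> a l + dyadic_sum n \<psi> a l"
  by (induction n arbitrary: a l) (auto simp: sum.distrib)

lemma dyadic_sum_cmult: "dyadic_sum n (\<lambda>a l. c * \<phi> a l) a l = c * dyadic_sum n \<phi> a l"
  by (induction n arbitrary: a l) (auto simp: sum_distrib_left)

lemma dyadic_sum_abs: "\<bar>dyadic_sum n \<phi> a l\<bar> \<le> dyadic_sum n (\<lambda>a l. \<bar>\<phi> a l\<bar>) a l"
proof (induction n arbitrary: a l)
  case (Suc n)
  show ?case unfolding dyadic_sum.simps
    by (rule order_trans[OF sum_abs sum_mono]) (rule Suc.IH)
qed simp

lemma dyadic_sum_integral:
  fixes f :: "real^'n::finite \<Rightarrow> real"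
  assumes "l > 0" "set_integrable lborel (hcube a l) f"
  shows "dyadic_sum n (\<lambda>a l. LINT x:hcube a l|lborel. f x) a l = (LINT x:hcube a l|lborel. f x)"
  using assms
proof (induction n arbitrary: a l)
  case (Suc n)
  have "set_integrable lborel (hcube (subcorner a l s) (l / 2)) f" for s
    by (rule set_integrable_subset[OF Suc.prems(2)]) (use subcube_subset[OF Suc.prems(1)] in auto)
  with Suc have "dyadic_sum (Suc n) (\<lambda>a l. LINT x:hcube a l|lborel. f x) a l
     = (\<Sum>s\<in>UNIV. LINT x:hcube (subcorner a l s) (l / 2)|lborel. f x)" by simp
  then show ?case using set_integral_subcubes[OF Suc.prems] by simp
qed simp

lemma dyadic_sum_volume: "l > 0 \<Longrightarrow> dyadic_sum n (\<lambda>a l. l ^ CARD('n)) a l = l ^ CARD('n)" for a :: "real^'n::finite"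
  by (induction n arbitrary: a l) (auto simp: power_divide)

lemma power_add_le: "\<bar>x + y\<bar> ^ p \<le> 2 ^ p * (\<bar>x\<bar> ^ p + \<bar>y\<bar> ^ p)" for x y :: real
proof -
  have "\<bar>x + y\<bar> ^ p \<le> (2 * max \<bar>x\<bar> \<bar>y\<bar>) ^ p" by (intro power_mono) auto
  also have "\<dots> \<le> 2 ^ p * (\<bar>x\<bar> ^ p + \<bar>y\<bar> ^ p)"
    by (cases "\<bar>x\<bar> \<le> \<bar>y\<bar>") (auto simp: power_mult_distrib max_def distrib_left)
  finally show ?thesis .
qed

lemma cube_avg_diff_le:
  fixes f :: "real^'n::finite \<Rightarrow> real"
  assumes l: "l > 0" and int: "set_integrable lborel (hcube a l) f"
  shows "\<bar>cube_avg f a l - c\<bar> * l ^ CARD('n) \<le> (LINT x:hcube a l|lborel. \<bar>f x - c\<bar>)"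
proof -
  have i: "set_integrable lborel (hcube a l) (\<lambda>x. f x - c)"
    by (intro set_integral_diff int set_integrable_hcube_const)
  have "(cube_avg f a l - c) * l ^ CARD('n) = (LINT x:hcube a l|lborel. f x - c)"
    using l int by (simp add: cube_avg_def set_integral_diff set_integral_hcube_const field_simps)
  moreover have "\<bar>LINT x:hcube a l|lborel. f x - c\<bar> \<le> (LINT x:hcube a l|lborel. \<bar>f x - c\<bar>)"
    using i unfolding set_lebesgue_integral_def set_integrable_def
    by (intro order_trans[OF integral_abs_bound]) (simp add: abs_mult)
  ultimately show ?thesis using l by (simp add: abs_mult[symmetric])
qed

text \<open>A John-Nirenberg bound for the dyadic averages, uniform in the depth n. A subcube on which
  the mean of |f - c| exceeds the level K is handled by the bound for smaller depths (recentred at its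
  own average); such cubes carry at most the fraction M / K of the volume.\<close>

lemma dyadic_John_Nirenberg:
  fixes f :: "real^'n::finite \<Rightarrow> real"
  assumes int: "\<And>a l. l > 0 \<Longrightarrow> set_integrable lborel (hcube a l) f"
    and osc: "\<And>a l. l > 0 \<Longrightarrow> (LINT x:hcube a l|lborel. \<bar>f x - cube_avg f a l\<bar>) \<le> M * l ^ CARD('n)"
    and M: "M > 0"
  shows "\<exists>B\<ge>0. \<forall>n a l. l > 0 \<longrightarrow>
    dyadic_sum n (\<lambda>a' l'. l' ^ CARD('n) * \<bar>cube_avg f a' l' - cube_avg f a l\<bar> ^ p) a l \<le> B * l ^ CARD('n)"
proof -
  define A where "A m a l c = dyadic_sum m (\<lambda>a' l'. l' ^ CARD('n) * \<bar>cube_avg f a' l' - c\<bar> ^ p) a l" for m a l c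
  define J where "J a l c = (LINT x:hcube a l|lborel. \<bar>f x - c\<bar>)" for a l c
  \<comment> \<open>\<open>D\<close> bounds the growth of a mean from a cube to a child. With K =
    2^(p+1) M the stopped cubes fill at most the fraction 2^-(p+1), which beats the factor 2^p lost
    in recentring by 1/2. \<open>L\<close> is the price per unit of \<open>J\<close> on stopped
    cubes, and \<open>B\<close> solves B = K^p + (B + (D K)^p) / 2.\<close>
  define D :: real where "D = 2 ^ CARD('n)"
  define K where "K = M * 2 ^ (p + 1)"
  define B where "B = 2 * K ^ p + (D * K) ^ p"
  define L where "L = 2 ^ p / K * (B + (D * K) ^ p)"
  have pos: "K > 0" "D > 0" "B \<ge> 0" "L \<ge> 0"
    using M by (auto simp: K_def D_def B_def L_def intro!: mult_nonneg_nonneg add_nonneg_nonneg divide_nonneg_nonneg)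
  have LM: "L * M = (B + (D * K) ^ p) / 2"
    using M by (simp add: L_def K_def field_simps)
  have intJ: "set_integrable lborel (hcube a l) (\<lambda>x. \<bar>f x - c\<bar>)" if "l > 0" for a l c
    by (intro set_integrable_abs set_integral_diff int set_integrable_hcube_const that)
  have avgJ: "\<bar>cube_avg f a l - c\<bar> * l ^ CARD('n) \<le> J a l c" if "l > 0" for a l c
    unfolding J_def by (rule cube_avg_diff_le[OF that int[OF that]])
  have J0: "J a l c \<ge> 0" for a l c
    unfolding J_def set_lebesgue_integral_def by (intro integral_nonneg_AE) auto
  have sumJ: "(\<Sum>s\<in>UNIV. J (subcorner a l s) (l / 2) c) = J a l c" if "l > 0" for a l c
    unfolding J_def by (rule set_integral_subcubes[OF that intJ[OF that]])
  \<comment> \<open>The \<open>J\<close> of the children add up to that of the parent, so the price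
    L J passes through the subdivision without loss. A child of a cube with mean at most K has mean
    at most D K.\<close>
  have step: "A (Suc m) a l c \<le> K ^ p * l ^ CARD('n) + L * J a l c"
    if l: "l > 0" and J: "J a l c \<le> K * l ^ CARD('n)"
      and rec: "\<And>a'. J a' (l / 2) c \<le> D * K * (l / 2) ^ CARD('n) \<Longrightarrow>
        A m a' (l / 2) c \<le> K ^ p * (l / 2) ^ CARD('n) + L * J a' (l / 2) c" for m a l c
  proof -
    have "J (subcorner a l s) (l / 2) c \<le> J a l c" for s
      using sumJ[OF l, of a c] J0 member_le_sum[of s UNIV "\<lambda>s. J (subcorner a l s) (l / 2) c"] by simp
    then have "J (subcorner a l s) (l / 2) c \<le> D * K * (l / 2) ^ CARD('n)" for s
      using J by (auto simp: D_def power_divide intro: order_trans)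
    then have "A (Suc m) a l c \<le> (\<Sum>s\<in>(UNIV::(bool^'n) set). K ^ p * (l / 2) ^ CARD('n) + L * J (subcorner a l s) (l / 2) c)"
      unfolding A_def dyadic_sum.simps by (intro sum_mono rec[unfolded A_def])
    also have "\<dots> = K ^ p * l ^ CARD('n) + L * J a l c"
      by (simp add: sum.distrib sum_distrib_left[symmetric] sumJ[OF l] power_divide)
    finally show ?thesis .
  qed
  have main: "\<forall>a l. l > 0 \<longrightarrow> A n a l (cube_avg f a l) \<le> B * l ^ CARD('n)" for n
  proof (induction n rule: less_induct)
    case (less n)
    \<comment> \<open>The centre \<open>c\<close> is kept until a cube is stopped. The hypothesis
      with D K is the one inherited from a parent that was not stopped.\<close>
    have inner: "m < n \<Longrightarrow> l > 0 \<Longrightarrow> J a l c \<le> D * K * l ^ CARD('n) \<Longrightarrow>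
        A m a l c \<le> K ^ p * l ^ CARD('n) + L * J a l c" for m a l c
    proof (induction m arbitrary: a l)
      fix m a and l :: real
      \<comment> \<open>Recentring at the own average \<open>?q\<close> moves the centre by at most
        D K and makes the outer induction hypothesis applicable; the resulting multiple of the
        volume is charged to \<open>J\<close>, which exceeds K times the volume.\<close>
      have stopped: "A m a l c \<le> L * J a l c"
        if m: "m < n" and l: "l > 0" and J: "J a l c \<le> D * K * l ^ CARD('n)" "J a l c > K * l ^ CARD('n)" for m a l
      proof -
        let ?q = "cube_avg f a l"
        have q: "\<bar>?q - c\<bar> \<le> D * K"
          using order_trans[OF avgJ[OF l, of a c] J(1)] l by simp
        have "A m a l c \<le> dyadic_sum m (\<lambda>a' l'. 2 ^ p * (l' ^ CARD('n) * \<bar>cube_avg f a' l' - ?q\<bar> ^ p)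
            + 2 ^ p * \<bar>?q - c\<bar> ^ p * l' ^ CARD('n)) a l"
          unfolding A_def
        proof (rule dyadic_sum_mono[OF _ l])
          fix a' :: "real^'n" and l' :: real assume "l' > 0"
          then have "l' ^ CARD('n) * \<bar>cube_avg f a' l' - c\<bar> ^ p
              \<le> l' ^ CARD('n) * (2 ^ p * (\<bar>cube_avg f a' l' - ?q\<bar> ^ p + \<bar>?q - c\<bar> ^ p))"
            using power_add_le[of "cube_avg f a' l' - ?q" "?q - c" p] by (intro mult_left_mono) auto
          then show "l' ^ CARD('n) * \<bar>cube_avg f a' l' - c\<bar> ^ p
              \<le> 2 ^ p * (l' ^ CARD('n) * \<bar>cube_avg f a' l' - ?q\<bar> ^ p) + 2 ^ p * \<bar>?q - c\<bar> ^ p * l' ^ CARD('n)"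
            by (simp add: algebra_simps)
        qed
        also have "\<dots> = 2 ^ p * A m a l ?q + 2 ^ p * \<bar>?q - c\<bar> ^ p * l ^ CARD('n)"
          using l by (simp add: dyadic_sum_add dyadic_sum_cmult dyadic_sum_volume A_def)
        also have "\<dots> \<le> 2 ^ p * (B * l ^ CARD('n)) + 2 ^ p * (D * K) ^ p * l ^ CARD('n)"
          using less.IH[OF m] l q by (intro add_mono mult_left_mono mult_right_mono power_mono) auto
        also have "\<dots> = L * (K * l ^ CARD('n))"
          using pos by (simp add: L_def field_simps)
        also have "\<dots> \<le> L * J a l c"
          using J(2) pos by (intro mult_left_mono) auto
        finally show ?thesis .
      qed
      {
        case 0
        show ?case
        proof (cases "J a l c > K * l ^ CARD('n)")
          case True
          then show ?thesis using stopped[OF 0 True] pos 0 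
            by (smt (verit) mult_nonneg_nonneg zero_le_power)
        next
          case False
          with avgJ[OF 0(2), of a c] have "\<bar>cube_avg f a l - c\<bar> * l ^ CARD('n) \<le> K * l ^ CARD('n)" by linarith
          then have "\<bar>cube_avg f a l - c\<bar> \<le> K" using 0 by simp
          then have "l ^ CARD('n) * \<bar>cube_avg f a l - c\<bar> ^ p \<le> l ^ CARD('n) * K ^ p"
            using 0 by (intro mult_left_mono power_mono) auto
          then show ?thesis using J0[of a l c] pos
            by (simp add: A_def mult.commute add_increasing2)
        qed
      next
        case (Suc m)
        show ?case
        proof (cases "J a l c > K * l ^ CARD('n)")
          case True
          then show ?thesis using stopped[OF Suc.prems True] pos Suc.prems
            by (smt (verit) mult_nonneg_nonneg zero_le_power)
        next
          case False
          then show ?thesis using Suc by (intro step) auto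
        qed
      }
    qed
    show ?case
    proof (intro allI impI)
      fix a :: "real^'n" and l :: real assume l: "l > 0"
      let ?q = "cube_avg f a l"
      have JM: "J a l ?q \<le> M * l ^ CARD('n)" unfolding J_def by (rule osc[OF l])
      have "M \<le> K" using M one_le_power[of "2::real" "p + 1"] by (simp add: K_def)
      show "A n a l ?q \<le> B * l ^ CARD('n)"
      proof (cases n)
        case 0
        then show ?thesis using pos l 
          by (cases "p = 0") (auto simp: A_def B_def power_0_left)
      next
        case (Suc m)
        have "A (Suc m) a l ?q \<le> K ^ p * l ^ CARD('n) + L * J a l ?q"
        proof (rule step[OF l])
          show "J a l ?q \<le> K * l ^ CARD('n)"
            using JM \<open>M \<le> K\<close> l by (smt (verit) mult_right_mono zero_le_power)
        qed (use inner[of m "l/2"] Suc l in auto)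
        also have "\<dots> \<le> K ^ p * l ^ CARD('n) + L * (M * l ^ CARD('n))"
          using JM pos by (intro add_left_mono mult_left_mono) auto
        also have "\<dots> = (K ^ p + L * M) * l ^ CARD('n)" by (simp add: algebra_simps)
        also have "\<dots> = B * l ^ CARD('n)" unfolding LM by (simp add: B_def)
        finally show ?thesis using Suc by simp
      qed
    qed
  qed
  then show ?thesis using pos(3) unfolding A_def by blast
qed

section \<open>From mean oscillation on balls to cubes\<close>

lemma self_mem_hcube: "l > 0 \<Longrightarrow> a \<in> hcube a l"
  by (simp add: hcube_def)

lemma norm_diff_hcube_le:
  fixes x :: "real^'n::finite"
  assumes "x \<in> hcube a l" "y \<in> hcube a l"
  shows "norm (x - y) \<le> real CARD('n) * l"
proof -
  have "norm (x - y) \<le> (\<Sum>i\<in>UNIV. \<bar>(x - y) $ i\<bar>)" by (rule norm_le_l1_cart)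
  also have "\<dots> \<le> sum (\<lambda>_. l) (UNIV::'n set)"
  proof (rule sum_mono)
    fix i
    show "\<bar>(x - y) $ i\<bar> \<le> l"
      using assms[unfolded hcube_def mem_Collect_eq, rule_format, of i] by auto
  qed
  finally show ?thesis by simp
qed

lemma BMO_set_integrable_hcube:
  assumes "BMO f" "l > 0"
  shows "set_integrable lborel (hcube a l) f"
proof (rule set_integrable_subset)
  show "set_integrable lborel (ball a (real CARD('a) * l + 1)) f"
  proof -
    have "real CARD('a) * l + 1 > 0" using assms(2) by (intro add_nonneg_pos) auto
    then show ?thesis using assms(1) by (simp add: BMO_def)
  qed
  show "hcube a l \<subseteq> ball a (real CARD('a) * l + 1)"
    using norm_diff_hcube_le[OF self_mem_hcube[OF assms(2)], of _ a] 
    by (force simp: dist_norm)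
qed simp

text \<open>A cube lies in a ball of comparable volume, and replacing the ball average by the cube
  average at most doubles the mean deviation.\<close>

lemma BMO_cube_oscillation:
  fixes f :: "real^'n::finite \<Rightarrow> real"
  assumes f: "BMO f"
  shows "\<exists>M>0. \<forall>a l. l > 0 \<longrightarrow> (LINT x:hcube a l|lborel. \<bar>f x - cube_avg f a l\<bar>) \<le> M * l ^ CARD('n)"
proof -
  obtain M where M: "\<And>x r. r > 0 \<Longrightarrow> (LINT y:ball x r|lborel. \<bar>f y - ball_avg f x r\<bar>) / measure lborel (ball x r) \<le> M"
    using f unfolding BMO_def by blast
  \<comment> \<open>The ball below has radius 2 n l in dimension n and fits into a cube of side 4 n
    l. The 2 pays for the change of centre, and |M| + 1 makes the constant positive.\<close>
  define K where "K = 2 * (\<bar>M\<bar> + 1) * (4 * real CARD('n)) ^ CARD('n)"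
  have "K > 0" by (auto simp: K_def)
  moreover have "(LINT x:hcube a l|lborel. \<bar>f x - cube_avg f a l\<bar>) \<le> K * l ^ CARD('n)" if l: "l > 0" for a l
  proof -
    define r where "r = 2 * real CARD('n) * l"
    have r: "r > 0" using l by (simp add: r_def)
    define c where "c = ball_avg f a r"
    have int: "set_integrable lborel (hcube a l) f" by (rule BMO_set_integrable_hcube[OF f l])
    have intb: "set_integrable lborel (ball a r) f" using f r by (auto simp: BMO_def)
    have fin: "set_integrable lborel (ball a r) (\<lambda>x. c)"
      unfolding set_integrable_def
      using emeasure_lborel_ball_finite[of a r]
      by (intro integrable_scaleR_left impI integrable_real_indicator) auto
    have intbc: "set_integrable lborel (ball a r) (\<lambda>x. \<bar>f x - c\<bar>)"
      by (intro set_integrable_abs set_integral_diff intb fin)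
    have sub: "hcube a l \<subseteq> ball a r"
    proof
      fix x assume x: "x \<in> hcube a l"
      have "norm (a - x) \<le> real CARD('n) * l" by (rule norm_diff_hcube_le[OF self_mem_hcube[OF l] x])
      also have "\<dots> < r" using l by (simp add: r_def)
      finally show "x \<in> ball a r" by (simp add: dist_norm)
    qed
    have intc: "set_integrable lborel (hcube a l) (\<lambda>x. \<bar>f x - c\<bar>)"
      by (rule set_integrable_subset[OF intbc _ sub]) simp
    have mball: "measure lborel (ball a r) \<le> (4 * real CARD('n) * l) ^ CARD('n)"
    proof -
      have "ball a r \<subseteq> ccube (a - (\<chi> i. r)) (2 * r)"
      proof
        fix x assume "x \<in> ball a r"
        then have "\<bar>a $ i - x $ i\<bar> < r" for i
          using component_le_norm_cart[of "a - x" i] by (simp add: dist_norm)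
        then show "x \<in> ccube (a - (\<chi> i. r)) (2 * r)"
          unfolding mem_ccube by (simp add: abs_less_iff) (smt (verit))
      qed
      then have "measure lborel (ball a r) \<le> measure lborel (ccube (a - (\<chi> i. r)) (2 * r))"
        by (intro measure_mono_fmeasurable) (auto simp: ccube_def)
      also have "\<dots> = (2 * r) ^ CARD('n)" using r by (simp only: measure_ccube)
      finally show ?thesis by (simp add: r_def mult.assoc)
    qed
    have mpos: "measure lborel (ball a r) > 0" using r by (rule content_ball_pos)
    have J: "(LINT x:hcube a l|lborel. \<bar>f x - c\<bar>) \<le> \<bar>M\<bar> * (4 * real CARD('n) * l) ^ CARD('n)"
    proof -
      have "(LINT x:hcube a l|lborel. \<bar>f x - c\<bar>) \<le> (LINT x:ball a r|lborel. \<bar>f x - c\<bar>)"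
        using intc intbc sub unfolding set_lebesgue_integral_def set_integrable_def
        by (intro integral_mono) (auto simp: indicator_def)
      also have "\<dots> \<le> M * measure lborel (ball a r)"
        using M[OF r, of a] mpos by (simp add: c_def field_simps)
      also have "\<dots> \<le> \<bar>M\<bar> * (4 * real CARD('n) * l) ^ CARD('n)"
        using mball by (intro mult_mono) auto
      finally show ?thesis .
    qed
    let ?q = "cube_avg f a l"
    have "(LINT x:hcube a l|lborel. \<bar>f x - ?q\<bar>) \<le> (LINT x:hcube a l|lborel. \<bar>f x - c\<bar> + \<bar>?q - c\<bar>)"
      by (intro set_integral_mono set_integrable_abs set_integral_diff set_integral_add int intc
          set_integrable_hcube_const) auto
    also have "\<dots> = (LINT x:hcube a l|lborel. \<bar>f x - c\<bar>) + \<bar>?q - c\<bar> * l ^ CARD('n)"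
      using l intc by (subst set_integral_add) (auto simp: set_integral_hcube_const)
    also have "\<dots> \<le> 2 * (LINT x:hcube a l|lborel. \<bar>f x - c\<bar>)"
      using cube_avg_diff_le[OF l int, of c] by simp
    also have "\<dots> \<le> K * l ^ CARD('n)"
    proof -
      have "2 * (\<bar>M\<bar> * (4 * real CARD('n) * l) ^ CARD('n)) \<le> 2 * ((\<bar>M\<bar> + 1) * (4 * real CARD('n) * l) ^ CARD('n))"
        using l by (intro mult_left_mono mult_right_mono zero_le_power) auto
      also have "\<dots> = K * l ^ CARD('n)" by (simp add: K_def power_mult_distrib)
      finally show ?thesis using J by linarith
    qed
    finally show ?thesis .
  qed
  ultimately show ?thesis by blast
qed

lemma uniform_on_small_cubes:
  fixes F :: "real^'n::finite \<Rightarrow> real"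
  assumes F: "continuous_on UNIV F" and e: "e > 0" and l: "l > 0"
  shows "\<exists>n0. \<forall>n\<ge>n0. \<forall>a'. hcube a' (l / 2 ^ n) \<subseteq> hcube a l \<longrightarrow>
    (\<forall>x\<in>hcube a' (l / 2 ^ n). \<bar>F x - F a'\<bar> \<le> e)"
proof -
  have "uniformly_continuous_on (ccube a l) F"
    unfolding ccube_def by (intro compact_uniformly_continuous continuous_on_subset[OF F] compact_cbox) auto
  then obtain d where d: "d > 0" "\<And>x y. x \<in> ccube a l \<Longrightarrow> y \<in> ccube a l \<Longrightarrow> dist x y < d \<Longrightarrow> dist (F x) (F y) < e"
    using e unfolding uniformly_continuous_on_def by metis
  have "(\<lambda>n. (real CARD('n) * l) * (1 / 2) ^ n) \<longlonglongrightarrow> (real CARD('n) * l) * 0"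
    by (intro tendsto_mult tendsto_const LIMSEQ_power_zero) auto
  then have "eventually (\<lambda>n. (real CARD('n) * l) * (1 / 2) ^ n < d) sequentially"
    using d(1) by (auto dest: order_tendstoD(2))
  then obtain n0 where n0: "\<And>n. n \<ge> n0 \<Longrightarrow> real CARD('n) * (l / 2 ^ n) < d"
    by (auto simp: eventually_sequentially power_divide)
  show ?thesis
  proof (intro exI[of _ n0] allI impI ballI)
    fix n a' x
    assume n: "n \<ge> n0" and sub: "hcube a' (l / 2 ^ n) \<subseteq> hcube a l" and x: "x \<in> hcube a' (l / 2 ^ n)"
    have a': "a' \<in> hcube a' (l / 2 ^ n)" using l by (intro self_mem_hcube) simp
    have "dist x a' < d"
      using norm_diff_hcube_le[OF x a'] n0[OF n] by (simp add: dist_norm)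
    then have "dist (F x) (F a') < e"
      using sub x a' hcube_subset_ccube[of a l] by (intro d) auto
    then show "\<bar>F x - F a'\<bar> \<le> e" by (simp add: dist_real_def)
  qed
qed

lemma set_integrable_hcube_continuous:
  fixes F :: "real^'n::finite \<Rightarrow> real"
  assumes "continuous_on UNIV F"
  shows "set_integrable lborel (hcube a l) F"
proof (rule set_integrable_subset[OF _ _ hcube_subset_ccube])
  show "set_integrable lborel (ccube a l) F"
    unfolding ccube_def by (rule set_integrable_cbox_continuous[OF assms])
qed simp

lemma integral_ccube_eq_hcube:
  fixes F :: "real^'n::finite \<Rightarrow> real"
  assumes "continuous_on UNIV F"
  shows "integral (ccube a l) F = (LINT x:hcube a l|lborel. F x)"
proof -
  have "F \<in> borel_measurable lborel" using borel_measurable_continuous_onI[OF assms] by simp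
  from set_integral_hcube_eq_ccube[OF this, of a l] show ?thesis
    using set_borel_integral_eq_integral(2)[OF set_integrable_cbox_continuous[OF assms], of a "a + (\<chi> i. l)"]
    by (simp add: ccube_def)
qed

lemma set_integrable_mult_continuous:
  fixes f G :: "real^'n::finite \<Rightarrow> real"
  assumes f: "set_integrable lborel A f" and A: "A \<subseteq> cbox u v" and G: "continuous_on UNIV G"
  shows "set_integrable lborel A (\<lambda>x. f x * G x)"
proof -
  have "bounded (G ` cbox u v)"
    by (intro compact_imp_bounded compact_continuous_image continuous_on_subset[OF G]) auto
  then obtain C where C: "\<And>x. x \<in> cbox u v \<Longrightarrow> \<bar>G x\<bar> \<le> C" by (auto simp: bounded_iff)
  have [measurable]: "G \<in> borel_measurable borel" using G by (rule borel_measurable_continuous_onI)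
  have int: "integrable lborel (\<lambda>x. C * (indicator (A) x *\<^sub>R f x))"
    using f unfolding set_integrable_def by (rule integrable_mult_right)
  have [measurable]: "(\<lambda>x. indicator (A) x *\<^sub>R f x) \<in> borel_measurable lborel"
    using f unfolding set_integrable_def by (rule borel_measurable_integrable)
  have "(\<lambda>x. (indicator (A) x *\<^sub>R f x) * G x) \<in> borel_measurable lborel" by measurable
  then have meas: "(\<lambda>x. indicator (A) x *\<^sub>R (f x * G x)) \<in> borel_measurable lborel"
    by (simp add: mult.assoc)
  have le: "norm (indicator (A) x *\<^sub>R (f x * G x)) \<le> norm (C * (indicator (A) x *\<^sub>R f x))" for x
  proof (cases "x \<in> A")
    case True
    then have "\<bar>G x\<bar> \<le> C" using A C by auto
    then have "\<bar>f x\<bar> * \<bar>G x\<bar> \<le> \<bar>C\<bar> * \<bar>f x\<bar>" by (simp add: mult.commute mult_mono)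
    then show ?thesis using True by (simp add: abs_mult)
  qed simp
  show ?thesis
    unfolding set_integrable_def
    by (rule Bochner_Integration.integrable_bound[OF int meas AE_I2[OF le]])
qed

lemmas set_integrable_hcube_mult = set_integrable_mult_continuous[OF _ hcube_subset_ccube[unfolded ccube_def]]

text \<open>Young with exponents 4 and 4/3 splits D^2 S^3 into D^8 + S^4, here by comparing D^2 with
  S; the remaining product with X is split with weight \<open>\<theta>\<close>. This is why the
  eighth moment of the oscillation and the integral of S^4 appear in
  \<open>BMO_pairing\<close>.\<close>

lemma weighted_Young:
  fixes D G X S :: real
  assumes "G\<^sup>2 \<le> X * S ^ 3" "X \<ge> 0" "S \<ge> 0" "\<theta> > 0"
  shows "\<bar>G\<bar> * \<bar>D\<bar> \<le> \<theta> * X + (\<bar>D\<bar> ^ 8 + S ^ 4) / \<theta>"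
proof -
  have D: "\<bar>D\<bar>\<^sup>2 * S ^ 3 \<le> \<bar>D\<bar> ^ 8 + S ^ 4"
  proof (cases "\<bar>D\<bar>\<^sup>2 \<le> S")
    case True
    then have "\<bar>D\<bar>\<^sup>2 * S ^ 3 \<le> S * S ^ 3" using assms by (intro mult_right_mono) auto
    also have "\<dots> = S ^ 4" by (simp add: eval_nat_numeral)
    finally show ?thesis by (simp add: add_increasing)
  next
    case False
    then have "\<bar>D\<bar>\<^sup>2 * S ^ 3 \<le> \<bar>D\<bar>\<^sup>2 * (\<bar>D\<bar>\<^sup>2) ^ 3" using assms by (intro mult_left_mono power_mono) auto
    also have "\<dots> = \<bar>D\<bar> ^ 8" by (simp add: eval_nat_numeral)
    finally show ?thesis using assms by (simp add: add_increasing2)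
  qed
  have "(\<bar>G\<bar> * \<bar>D\<bar>)\<^sup>2 = G\<^sup>2 * \<bar>D\<bar>\<^sup>2" by (simp add: power_mult_distrib)
  also have "\<dots> \<le> (X * S ^ 3) * \<bar>D\<bar>\<^sup>2" using assms by (intro mult_right_mono) auto
  also have "\<dots> = X * (\<bar>D\<bar>\<^sup>2 * S ^ 3)" by simp
  also have "\<dots> \<le> X * (\<bar>D\<bar> ^ 8 + S ^ 4)" using D assms by (intro mult_left_mono) auto
  also have "\<dots> = (\<theta> * X) * ((\<bar>D\<bar> ^ 8 + S ^ 4) / \<theta>)" using assms by simp
  also have "\<dots> \<le> (\<theta> * X + (\<bar>D\<bar> ^ 8 + S ^ 4) / \<theta>)\<^sup>2"
  proof -
    have ab: "a * b \<le> (a + b)\<^sup>2" if "0 \<le> a" "0 \<le> b" for a b :: real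
    proof -
      have "0 \<le> a\<^sup>2 + a * b + b\<^sup>2" using that by auto
      then show ?thesis by (simp add: power2_sum)
    qed
    show ?thesis by (rule ab) (use assms in auto)
  qed
  finally show ?thesis
    by (rule power2_le_imp_le) (use assms in \<open>auto intro!: add_nonneg_nonneg\<close>)
qed

text \<open>G, X and S are frozen on the cubes of a fine dyadic generation. There f enters the
  leading term through its averages only, whose eighth moments are bounded uniformly in the
  generation, and the freezing error disappears in the limit. \<open>B\<close> depends on f alone,
  not on the cube, which is what makes rescaling possible later.\<close>

theorem BMO_pairing:
  fixes f :: "real^'n::finite \<Rightarrow> real"
  assumes f: "BMO f"
  shows "\<exists>B\<ge>0. \<forall>a l \<theta> G X S. l > 0 \<longrightarrow> \<theta> > 0 \<longrightarrow>
    continuous_on UNIV G \<longrightarrow> continuous_on UNIV X \<longrightarrow> continuous_on UNIV S \<longrightarrow>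
    (\<forall>x\<in>ccube a l. 0 \<le> X x \<and> 0 \<le> S x \<and> (G x)\<^sup>2 \<le> X x * S x ^ 3) \<longrightarrow>
    \<bar>LINT x:ccube a l|lborel. (f x - cube_avg f a l) * G x\<bar>
      \<le> \<theta> * integral (ccube a l) X + (B * l ^ CARD('n) + integral (ccube a l) (\<lambda>x. S x ^ 4)) / \<theta>"
proof -
  obtain M where M: "M > 0" "\<And>a l. l > 0 \<Longrightarrow>
      (LINT x:hcube a l|lborel. \<bar>f x - cube_avg f a l\<bar>) \<le> M * l ^ CARD('n)"
    using BMO_cube_oscillation[OF f] by blast
  obtain B where B: "B \<ge> 0" "\<And>n a l. l > 0 \<Longrightarrow>
    dyadic_sum n (\<lambda>a' l'. l' ^ CARD('n) * \<bar>cube_avg f a' l' - cube_avg f a l\<bar> ^ 8) a l \<le> B * l ^ CARD('n)"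
    using dyadic_John_Nirenberg[OF BMO_set_integrable_hcube[OF f] M(2) M(1), of 8] by blast
  show ?thesis
  proof (intro exI[of _ B] conjI B allI impI)
    fix a :: "real^'n" and l \<theta> :: real and G X S :: "real^'n \<Rightarrow> real"
    assume l: "l > 0" and \<theta>: "\<theta> > 0" and G: "continuous_on UNIV G" and X: "continuous_on UNIV X"
      and S: "continuous_on UNIV S"
      and GXS: "\<forall>x\<in>ccube a l. 0 \<le> X x \<and> 0 \<le> S x \<and> (G x)\<^sup>2 \<le> X x * S x ^ 3"
    define c where "c = cube_avg f a l"
    let ?I = "\<lambda>(h :: real^'n \<Rightarrow> real) a l. LINT x:hcube a l|lborel. h x"
    have S4: "continuous_on UNIV (\<lambda>x. S x ^ 4)" by (intro continuous_intros S)
    have fm: "f \<in> borel_measurable lborel" using f by (simp add: BMO_def)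
    have fc: "set_integrable lborel (hcube a l) (\<lambda>x. f x - c)" if "l > 0" for a l
      by (intro set_integral_diff BMO_set_integrable_hcube f set_integrable_hcube_const that)
    have fcG: "set_integrable lborel (hcube a l) (\<lambda>x. (f x - c) * G x)" if "l > 0" for a l
      by (intro set_integrable_hcube_mult fc G that)
    have key: "\<bar>?I (\<lambda>x. (f x - c) * G x) a l\<bar> \<le> \<theta> * ?I X a l + (B * l ^ CARD('n) + ?I (\<lambda>x. S x ^ 4) a l) / \<theta>
        + e * (?I (\<lambda>x. \<bar>f x - c\<bar>) a l + \<theta> * l ^ CARD('n) + l ^ CARD('n) / \<theta>)" if e: "e > 0" for e
    proof -
      obtain n1 where n1: "\<forall>n\<ge>n1. \<forall>a'. hcube a' (l / 2 ^ n) \<subseteq> hcube a l \<longrightarrow>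
          (\<forall>x\<in>hcube a' (l / 2 ^ n). \<bar>G x - G a'\<bar> \<le> e)"
        using uniform_on_small_cubes[OF G e l, of a] by blast
      obtain n2 where n2: "\<forall>n\<ge>n2. \<forall>a'. hcube a' (l / 2 ^ n) \<subseteq> hcube a l \<longrightarrow>
          (\<forall>x\<in>hcube a' (l / 2 ^ n). \<bar>X x - X a'\<bar> \<le> e)"
        using uniform_on_small_cubes[OF X e l, of a] by blast
      obtain n3 where n3: "\<forall>n\<ge>n3. \<forall>a'. hcube a' (l / 2 ^ n) \<subseteq> hcube a l \<longrightarrow>
          (\<forall>x\<in>hcube a' (l / 2 ^ n). \<bar>S x ^ 4 - S a' ^ 4\<bar> \<le> e)"
        using uniform_on_small_cubes[OF S4 e l, of a] by blast
      define n where "n = max n1 (max n2 n3)"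
      let ?bd = "\<lambda>a' l'. \<theta> * ?I X a' l' + (l' ^ CARD('n) * \<bar>cube_avg f a' l' - c\<bar> ^ 8) * (1 / \<theta>)
        + (1 / \<theta>) * ?I (\<lambda>x. S x ^ 4) a' l' + e * ?I (\<lambda>x. \<bar>f x - c\<bar>) a' l' + (e * (\<theta> + 1 / \<theta>)) * l' ^ CARD('n)"
      \<comment> \<open>With G frozen at the corner a', the integral becomes G a' times the
        deviation of the average of f, to which \<open>weighted_Young\<close> applies; the rest is
        at most e times the integral of |f - c|.\<close>
      have local: "\<bar>?I (\<lambda>x. (f x - c) * G x) a' l'\<bar> \<le> ?bd a' l'"
        if l': "l' > 0" "l' = l / 2 ^ n" and sub: "hcube a' l' \<subseteq> hcube a l" for a' l'
      proof -
        have a': "a' \<in> hcube a' l'" by (rule self_mem_hcube[OF l'(1)])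
        then have a'c: "a' \<in> ccube a l" using sub hcube_subset_ccube[of a l] by auto
        have oG: "\<bar>G x - G a'\<bar> \<le> e" and oX: "\<bar>X x - X a'\<bar> \<le> e" and oS: "\<bar>S x ^ 4 - S a' ^ 4\<bar> \<le> e"
          if "x \<in> hcube a' l'" for x
          using n1[rule_format, of n a' x] n2[rule_format, of n a' x] n3[rule_format, of n a' x] that sub l'(2)
          by (simp_all add: n_def)
        let ?V = "l' ^ CARD('n)"
        have V: "?V > 0" using l' by simp
        have "?I (\<lambda>x. (f x - c) * G x) a' l' =
            ?I (\<lambda>x. (f x - c) * G a') a' l' + ?I (\<lambda>x. (f x - c) * (G x - G a')) a' l'"
        proof (subst set_integral_add(2)[symmetric])
          show "set_integrable lborel (hcube a' l') (\<lambda>x. (f x - c) * (G x - G a'))"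
            by (intro set_integrable_hcube_mult fc l' continuous_intros G)
          show "set_integrable lborel (hcube a' l') (\<lambda>x. (f x - c) * G a')"
            by (intro set_integrable_mult_left impI fc l')
        qed (simp add: algebra_simps)
        moreover have "?I (\<lambda>x. (f x - c) * G a') a' l' = (cube_avg f a' l' - c) * ?V * G a'"
        proof -
          have "?I (\<lambda>x. f x - c) a' l' = (cube_avg f a' l' - c) * ?V"
            using l'(1) BMO_set_integrable_hcube[OF f l'(1), of a']
            by (simp add: cube_avg_def set_integral_diff set_integral_hcube_const field_simps)
          then show ?thesis by (simp only: set_integral_mult_left)
        qed
        moreover have "\<bar>?I (\<lambda>x. (f x - c) * (G x - G a')) a' l'\<bar> \<le> e * ?I (\<lambda>x. \<bar>f x - c\<bar>) a' l'"
        proof -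
          have i: "set_integrable lborel (hcube a' l') (\<lambda>x. (f x - c) * (G x - G a'))"
            by (intro set_integrable_hcube_mult fc l' continuous_intros G)
          have "\<bar>?I (\<lambda>x. (f x - c) * (G x - G a')) a' l'\<bar> \<le> ?I (\<lambda>x. \<bar>(f x - c) * (G x - G a')\<bar>) a' l'"
            using i unfolding set_lebesgue_integral_def set_integrable_def
            by (intro order_trans[OF integral_abs_bound]) (simp add: abs_mult)
          also have "\<dots> \<le> ?I (\<lambda>x. e * \<bar>f x - c\<bar>) a' l'"
          proof (rule set_integral_mono)
            fix x assume "x \<in> hcube a' l'"
            then show "\<bar>(f x - c) * (G x - G a')\<bar> \<le> e * \<bar>f x - c\<bar>"
              using mult_left_mono[OF oG, of x "\<bar>f x - c\<bar>"] by (simp add: abs_mult mult.commute)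
          qed (auto intro!: set_integrable_abs i set_integrable_mult_right fc l')
          finally show ?thesis by simp
        qed
        ultimately have h1: "\<bar>?I (\<lambda>x. (f x - c) * G x) a' l'\<bar>
            \<le> ?V * (\<bar>G a'\<bar> * \<bar>cube_avg f a' l' - c\<bar>) + e * ?I (\<lambda>x. \<bar>f x - c\<bar>) a' l'"
        proof -
          assume *: "?I (\<lambda>x. (f x - c) * G x) a' l' =
              ?I (\<lambda>x. (f x - c) * G a') a' l' + ?I (\<lambda>x. (f x - c) * (G x - G a')) a' l'"
            "?I (\<lambda>x. (f x - c) * G a') a' l' = (cube_avg f a' l' - c) * ?V * G a'"
            "\<bar>?I (\<lambda>x. (f x - c) * (G x - G a')) a' l'\<bar> \<le> e * ?I (\<lambda>x. \<bar>f x - c\<bar>) a' l'"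
          have "\<bar>(cube_avg f a' l' - c) * ?V * G a'\<bar> = ?V * (\<bar>G a'\<bar> * \<bar>cube_avg f a' l' - c\<bar>)"
            using V by (simp add: abs_mult)
          with * show ?thesis by linarith
        qed
        have "?V * (\<bar>G a'\<bar> * \<bar>cube_avg f a' l' - c\<bar>)
            \<le> ?V * (\<theta> * X a' + (\<bar>cube_avg f a' l' - c\<bar> ^ 8 + S a' ^ 4) / \<theta>)"
          using GXS a'c \<theta> V by (intro mult_left_mono weighted_Young) auto
        also have "\<dots> = \<theta> * (X a' * ?V) + (?V * \<bar>cube_avg f a' l' - c\<bar> ^ 8) * (1 / \<theta>) + (1 / \<theta>) * (S a' ^ 4 * ?V)"
          using \<theta> by (simp add: field_simps)
        finally have h2: "?V * (\<bar>G a'\<bar> * \<bar>cube_avg f a' l' - c\<bar>) \<le> \<theta> * (X a' * ?V)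
            + (?V * \<bar>cube_avg f a' l' - c\<bar> ^ 8) * (1 / \<theta>) + (1 / \<theta>) * (S a' ^ 4 * ?V)" .
        have "X a' * ?V \<le> ?I X a' l' + e * ?V"
        proof -
          have "?I (\<lambda>x. X a') a' l' \<le> ?I (\<lambda>x. X x + e) a' l'"
            by (intro set_integral_mono set_integral_add set_integrable_hcube_const set_integrable_hcube_continuous X)
              (use oX in force)
          then show ?thesis using l' by (simp add: set_integral_add set_integrable_hcube_continuous X set_integral_hcube_const)
        qed
        from mult_left_mono[OF this, of \<theta>] \<theta> have h3: "\<theta> * (X a' * ?V) \<le> \<theta> * (?I X a' l' + e * ?V)" by simp
        have "S a' ^ 4 * ?V \<le> ?I (\<lambda>x. S x ^ 4) a' l' + e * ?V"
        proof -
          have "?I (\<lambda>x. S a' ^ 4) a' l' \<le> ?I (\<lambda>x. S x ^ 4 + e) a' l'"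
            by (intro set_integral_mono set_integral_add set_integrable_hcube_const set_integrable_hcube_continuous S4)
              (use oS in force)
          then show ?thesis using l' by (simp add: set_integral_add set_integrable_hcube_continuous S4 set_integral_hcube_const)
        qed
        from mult_left_mono[OF this, of "1 / \<theta>"] \<theta>
        have h4: "(1 / \<theta>) * (S a' ^ 4 * ?V) \<le> (1 / \<theta>) * (?I (\<lambda>x. S x ^ 4) a' l' + e * ?V)" by simp
        have "(e * (\<theta> + 1 / \<theta>)) * ?V = \<theta> * (e * ?V) + (1 / \<theta>) * (e * ?V)" by (simp add: algebra_simps)
        with h1 h2 h3 h4 show ?thesis by (simp only: distrib_left)
      qed
      have "\<bar>?I (\<lambda>x. (f x - c) * G x) a l\<bar> = \<bar>dyadic_sum n (?I (\<lambda>x. (f x - c) * G x)) a l\<bar>"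
        by (subst dyadic_sum_integral[OF l fcG[OF l]]) simp
      also have "\<dots> \<le> dyadic_sum n (\<lambda>a' l'. \<bar>?I (\<lambda>x. (f x - c) * G x) a' l'\<bar>) a l"
        by (rule dyadic_sum_abs)
      also have "\<dots> \<le> dyadic_sum n ?bd a l"
        by (rule dyadic_sum_mono[OF local l])
      also have "\<dots> = \<theta> * ?I X a l + dyadic_sum n (\<lambda>a' l'. l' ^ CARD('n) * \<bar>cube_avg f a' l' - c\<bar> ^ 8) a l * (1 / \<theta>)
        + (1 / \<theta>) * ?I (\<lambda>x. S x ^ 4) a l + e * ?I (\<lambda>x. \<bar>f x - c\<bar>) a l + (e * (\<theta> + 1 / \<theta>)) * l ^ CARD('n)"
        by (simp only: dyadic_sum_add dyadic_sum_cmult mult.commute[of _ "1 / \<theta>"] dyadic_sum_volume[OF l]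
            dyadic_sum_integral[OF l set_integrable_hcube_continuous[OF X]]
            dyadic_sum_integral[OF l set_integrable_hcube_continuous[OF S4]]
            dyadic_sum_integral[OF l set_integrable_abs[OF fc[OF l]]])
      also have "dyadic_sum n (\<lambda>a' l'. l' ^ CARD('n) * \<bar>cube_avg f a' l' - c\<bar> ^ 8) a l * (1 / \<theta>)
          \<le> B * l ^ CARD('n) * (1 / \<theta>)"
        using B(2)[OF l, of n a] \<theta> unfolding c_def by (intro mult_right_mono) auto
      finally show ?thesis by (simp add: algebra_simps add_divide_distrib)
    qed
    \<comment> \<open>All freezing errors together are e times this number, which does not depend on
      e.\<close>
    define K where "K = ?I (\<lambda>x. \<bar>f x - c\<bar>) a l + \<theta> * l ^ CARD('n) + l ^ CARD('n) / \<theta>"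
    have "?I (\<lambda>x. \<bar>f x - c\<bar>) a l \<ge> 0"
      unfolding set_lebesgue_integral_def by (intro integral_nonneg_AE) auto
    moreover have "\<theta> * l ^ CARD('n) > 0" "l ^ CARD('n) / \<theta> > 0" using l \<theta> by auto
    ultimately have K: "K > 0" unfolding K_def by linarith
    have "\<bar>?I (\<lambda>x. (f x - c) * G x) a l\<bar> \<le> \<theta> * ?I X a l + (B * l ^ CARD('n) + ?I (\<lambda>x. S x ^ 4) a l) / \<theta>"
    proof (rule field_le_epsilon)
      fix e :: real assume "e > 0"
      with key[of "e / K"] K show "\<bar>?I (\<lambda>x. (f x - c) * G x) a l\<bar>
          \<le> \<theta> * ?I X a l + (B * l ^ CARD('n) + ?I (\<lambda>x. S x ^ 4) a l) / \<theta> + e"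
        unfolding K_def[symmetric] by simp
    qed
    moreover have "(LINT x:ccube a l|lborel. (f x - cube_avg f a l) * G x) = ?I (\<lambda>x. (f x - c) * G x) a l"
      unfolding c_def[symmetric]
      by (rule set_integral_hcube_eq_ccube)
        (use fm borel_measurable_continuous_onI[OF G] in \<open>auto intro!: borel_measurable_times borel_measurable_diff\<close>)
    ultimately show "\<bar>LINT x:ccube a l|lborel. (f x - cube_avg f a l) * G x\<bar>
      \<le> \<theta> * integral (ccube a l) X + (B * l ^ CARD('n) + integral (ccube a l) (\<lambda>x. S x ^ 4)) / \<theta>"
      by (simp only: integral_ccube_eq_hcube[OF X] integral_ccube_eq_hcube[OF S4])
  qed
qed

section \<open>A mollified Newton kernel\<close>

lemma has_real_derivative_glue:
  fixes f g :: "real \<Rightarrow> real"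
  assumes f: "\<And>s. s \<ge> c \<Longrightarrow> (f has_real_derivative f' s) (at s)"
    and g: "\<And>s. s \<le> c \<Longrightarrow> (g has_real_derivative g' s) (at s)"
    and eq: "f c = g c" "f' c = g' c"
  shows "((\<lambda>s. if s \<ge> c then f s else g s) has_real_derivative (if s \<ge> c then f' s else g' s)) (at s)"
proof -
  let ?h = "\<lambda>s. if s \<ge> c then f s else g s"
  consider "s > c" | "s = c" | "s < c" by linarith
  then show ?thesis
  proof cases
    case 1
    then have "(f has_real_derivative (if s \<ge> c then f' s else g' s)) (at s)" using f[of s] by simp
    then show ?thesis
      by (rule has_field_derivative_transform_within_open[of _ _ _ "{c<..}"]) (use 1 in auto)
  next
    case 3
    then have "(g has_real_derivative (if s \<ge> c then f' s else g' s)) (at s)" using g[of s] by simp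
    then show ?thesis
      by (rule has_field_derivative_transform_within_open[of _ _ _ "{..<c}"]) (use 3 in auto)
  next
    case 2
    have "((\<lambda>y. (f y - f c) / (y - c)) \<longlongrightarrow> f' c) (at_right c)"
      using f[of c] unfolding has_field_derivative_iff by (simp add: filterlim_at_split)
    then have "((\<lambda>y. (?h y - ?h c) / (y - c)) \<longlongrightarrow> f' c) (at_right c)"
      by (rule Lim_transform_eventually) (auto simp: eventually_at_right_field intro!: exI[of _ "c + 1"])
    moreover have "((\<lambda>y. (g y - g c) / (y - c)) \<longlongrightarrow> g' c) (at_left c)"
      using g[of c] unfolding has_field_derivative_iff by (simp add: filterlim_at_split)
    then have "((\<lambda>y. (?h y - ?h c) / (y - c)) \<longlongrightarrow> g' c) (at_left c)"
      by (rule Lim_transform_eventually) (auto simp: eventually_at_left_field eq intro!: exI[of _ "c - 1"])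
    ultimately show ?thesis using 2 eq
      by (simp add: has_field_derivative_iff filterlim_at_split)
  qed
qed

text \<open>The profile s \<mapsto> 1/sqrt s for s \<ge> 1, continued to s < 1 by its Taylor polynomial of degree 4 at 1;
  the index counts derivatives. Radially, this is the Newton kernel smoothed inside the unit ball.\<close>

definition newton_profile :: "nat \<Rightarrow> real \<Rightarrow> real" where
  "newton_profile i s = (if s \<ge> 1 then [1, -1/2, 3/4, -15/8, 105/16] ! i * s powr (-1/2 - real i)
    else [1 + (1-s)/2 + 3/8*(1-s)^2 + 5/16*(1-s)^3 + 35/128*(1-s)^4,
          -(1/2 + 3/4*(1-s) + 15/16*(1-s)^2 + 35/32*(1-s)^3),
          3/4 + 15/8*(1-s) + 105/32*(1-s)^2, -(15/8 + 105/16*(1-s)), 105/16] ! i)"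

lemma newton_profile_deriv:
  assumes "i < 4"
  shows "(newton_profile i has_real_derivative newton_profile (Suc i) s) (at s)"
proof -
  define f where "f i s = [1, -1/2, 3/4, -15/8, 105/16] ! i * s powr (-1/2 - real i)" for i s
  define g where "g i s = [1 + (1-s)/2 + 3/8*(1-s)^2 + 5/16*(1-s)^3 + 35/128*(1-s)^4,
          -(1/2 + 3/4*(1-s) + 15/16*(1-s)^2 + 35/32*(1-s)^3),
          3/4 + 15/8*(1-s) + 105/32*(1-s)^2, -(15/8 + 105/16*(1-s)), 105/16] ! i" for i and s :: real
  have i: "i = 0 \<or> i = 1 \<or> i = 2 \<or> i = 3" using assms by linarith
  have f: "(f i has_real_derivative f (Suc i) s) (at s)" if "s \<ge> 1" for s
  proof -
    have "((\<lambda>s. s powr (-1/2 - real i)) has_real_derivative (-1/2 - real i) * s powr (-1/2 - real i - 1)) (at s)"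
      using that by (intro has_real_derivative_powr) simp
    from DERIV_cmult[OF this, of "[1, -1/2, 3/4, -15/8, 105/16] ! i"]
    show ?thesis unfolding f_def[abs_def] using i by (auto simp: numeral_2_eq_2 numeral_3_eq_3 algebra_simps)
  qed
  have g: "(g i has_real_derivative g (Suc i) s) (at s)" for s
    using i
    by (elim disjE; simp add: g_def[abs_def] numeral_2_eq_2 numeral_3_eq_3 del: power_Suc)
      (auto intro!: derivative_eq_intros simp: field_simps power2_eq_square power3_eq_cube)
  have "((\<lambda>s. if s \<ge> 1 then f i s else g i s) has_real_derivative (if s \<ge> 1 then f (Suc i) s else g (Suc i) s)) (at s)"
    by (rule has_real_derivative_glue[OF f g]) (use i in \<open>auto simp: f_def g_def numeral_2_eq_2 numeral_3_eq_3\<close>)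
  moreover have "newton_profile i = (\<lambda>s. if s \<ge> 1 then f i s else g i s)" for i
    by (rule ext) (simp only: newton_profile_def f_def g_def)
  ultimately show ?thesis by simp
qed

lemma newton_profile_continuous: "i \<le> 4 \<Longrightarrow> continuous_on UNIV (newton_profile i)"
proof -
  assume "i \<le> 4"
  then consider "i < 4" | "i = 4" by linarith
  then show ?thesis
  proof cases
    case 1
    show ?thesis
      using newton_profile_deriv[OF 1] by (meson DERIV_continuous_on DERIV_subset top_greatest)
  next
    case 2
    have eq: "newton_profile 4 = (\<lambda>s. 105/16 * max 1 s powr (-9/2))"
      by (rule ext) (auto simp: newton_profile_def max_def)
    show ?thesis unfolding 2 eq by (intro continuous_intros) auto
  qed
qed

definition sqn :: "real^3 \<Rightarrow> real" where "sqn z = (\<Sum>i\<in>UNIV. (z $ i)\<^sup>2)"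

lemma sqn_norm: "sqn z = (norm z)\<^sup>2"
  by (simp add: sqn_def norm_vec_def L2_set_def sum_nonneg)

lemma smooth_sqn: "smooth sqn"
  unfolding sqn_def[abs_def] by (intro smooth_sum smooth_intros)

lemma pd_sqn: "pd j sqn = (\<lambda>z. 2 * z $ j)"
proof
  fix z :: "real^3"
  have "(sqn has_derivative (\<lambda>h. \<Sum>i\<in>UNIV. 2 * (z $ i) * h $ i)) (at z)"
    unfolding sqn_def[abs_def]
    by (auto intro!: derivative_eq_intros bounded_linear.has_derivative[OF bounded_linear_vec_nth] simp: mult_ac)
  from pd_eq[OF this] show "pd j sqn z = 2 * z $ j"
    by (simp add: axis_def if_distrib[of "\<lambda>x. _ * x"] cong: if_cong)
qed

lemma Ck_newton: "i + k \<le> 4 \<Longrightarrow> Ck k (\<lambda>z. newton_profile i (sqn z))"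
  by (rule Ck_compose_real[where K=4 and U=UNIV])
    (use smooth_sqn newton_profile_deriv newton_profile_continuous in \<open>auto simp: smooth_def simp del: Ck.simps\<close>)

lemma sqn_differentiable: "sqn differentiable at z"
  using smooth_sqn Ck_differentiable[of 0 sqn] unfolding smooth_def by blast

lemma pd_newton: "i < 4 \<Longrightarrow> pd j (\<lambda>z. newton_profile i (sqn z)) = (\<lambda>z. newton_profile (Suc i) (sqn z) * (2 * z $ j))"
  by (rule ext, subst pd_compose_real[OF newton_profile_deriv]) (auto simp: sqn_differentiable pd_sqn)

definition newton :: "real^3 \<Rightarrow> real" where "newton z = newton_profile 0 (sqn z)"

text \<open>Minus the Laplacian of \<open>newton\<close>: exponent and constant come from the Taylor
  polynomial of degree 4 in \<open>newton_profile\<close>. The total mass \<open>mu\<close> is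
  therefore 4 pi, not 1.\<close>

definition mollifier :: "real^3 \<Rightarrow> real" where "mollifier z = 315/16 * (max 0 (1 - sqn z)) ^ 3"

text \<open>For a function F of s = |z|^2 in dimension 3 the Laplacian is 4 s F'' + 6 F'. This
  vanishes for s^(-1/2); for the Taylor polynomial all orders cancel except the third power of 1 -
  s.\<close>

lemma laplacian_newton: "(\<Sum>j\<in>UNIV. pd j (pd j newton) z) = - mollifier z"
proof -
  have "pd j (pd j newton) z = newton_profile 2 (sqn z) * (2 * z $ j) * (2 * z $ j) + newton_profile 1 (sqn z) * 2" for j
  proof -
    have 1: "pd j newton = (\<lambda>z. newton_profile 1 (sqn z) * (2 * z $ j))"
      using pd_newton[of 0 j] by (simp add: newton_def[abs_def])
    have "(\<lambda>z. newton_profile 1 (sqn z)) differentiable at z"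
      by (rule Ck_differentiable[OF Ck_newton[of 1 "Suc 0"]]) simp
    moreover have "(\<lambda>z::real^3. 2 * z $ j) differentiable at z"
      by (rule Ck_differentiable[OF Ck_cmult[OF Ck_coord[of "Suc 0"]]])
    ultimately have "pd j (pd j newton) z = pd j (\<lambda>z. newton_profile 1 (sqn z)) z * (2 * z $ j)
        + newton_profile 1 (sqn z) * pd j (\<lambda>z. 2 * z $ j) z"
      unfolding 1 by (rule pd_mult)
    also have "pd j (\<lambda>z::real^3. 2 * z $ j) z = 2 * pd j (\<lambda>z. z $ j) z"
      by (rule pd_linear[OF bounded_linear_mult_right Ck_differentiable[OF Ck_coord[of "Suc 0"]]])
    also have "\<dots> = 2" by (simp add: pd_coord)
    finally show ?thesis by (simp add: pd_newton[of 1, simplified] numeral_2_eq_2)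
  qed
  then have "(\<Sum>j\<in>UNIV. pd j (pd j newton) z) = 4 * sqn z * newton_profile 2 (sqn z) + 6 * newton_profile 1 (sqn z)"
    by (simp add: sum.distrib sqn_def sum_distrib_left sum_distrib_right power2_eq_square mult_ac)
  also have "\<dots> = - mollifier z"
  proof (cases "sqn z \<ge> 1")
    case True
    then have "sqn z * sqn z powr (-5/2) = sqn z powr (-3/2)"
      using powr_add[of "sqn z" 1 "-5/2"] by simp
    with True show ?thesis by (simp add: newton_profile_def mollifier_def)
  next
    case False
    then show ?thesis
      by (simp add: newton_profile_def mollifier_def max_def field_simps power2_eq_square power3_eq_cube)
  qed
  finally show ?thesis .
qed

lemma mollifier_nonneg: "mollifier z \<ge> 0"
  by (simp add: mollifier_def)

lemma mollifier_even: "mollifier (- z) = mollifier z"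
  by (simp add: mollifier_def sqn_norm)

lemma mollifier_eq_0: "norm z \<ge> 1 \<Longrightarrow> mollifier z = 0"
  using one_le_power[of "norm z" 2] by (auto simp: mollifier_def sqn_norm max_def simp del: one_le_power)

lemma Ck_mollifier: "Ck 2 mollifier"
proof -
  have eq: "mollifier = (\<lambda>z. - (\<Sum>j\<in>UNIV. pd j (pd j newton) z))" by (simp add: laplacian_newton)
  have "Ck (Suc (Suc 2)) newton"
    using Ck_newton[of 0 "Suc (Suc 2)"] by (simp add: newton_def[abs_def] del: Ck.simps)
  then have "Ck 2 (pd j (pd j newton))" for j by (intro Ck_pd)
  then show ?thesis unfolding eq by (intro Ck_minus Ck_sum)
qed

lemma Ck_newton4: "Ck 4 newton"
  using Ck_newton[of 0 4] by (simp add: newton_def[abs_def] del: Ck.simps)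

lemma pd_scaled:
  fixes f :: "real^'n::finite \<Rightarrow> real"
  assumes "Ck 1 f"
  shows "pd j (\<lambda>x. c * f (a *\<^sub>R x)) = (\<lambda>x. (c * a) * pd j f (a *\<^sub>R x))"
proof
  fix x
  have d: "f differentiable at z" for z using assms by (auto intro: Ck_differentiable simp del: Ck.simps)
  have "(\<lambda>x. f (a *\<^sub>R x)) differentiable at x"
    using Ck_affine[OF assms, of a 0] by (auto intro: Ck_differentiable simp del: Ck.simps)
  then have "pd j (\<lambda>x. c * f (a *\<^sub>R x)) x = c * pd j (\<lambda>x. f (a *\<^sub>R x)) x"
    by (rule pd_linear[OF bounded_linear_mult_right])
  also have "pd j (\<lambda>x. f (a *\<^sub>R x)) x = a * pd j f (a *\<^sub>R x)"
    using pd_affine[OF d, where b=0] by simp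
  finally show "pd j (\<lambda>x. c * f (a *\<^sub>R x)) x = (c * a) * pd j f (a *\<^sub>R x)" by simp
qed

text \<open>The truncated Newton potential. Both regularizations equal 1/|z| off the unit ball, so
  the difference has compact support, and its Laplacian compares averages at scale 1 with averages
  at scale e.\<close>

definition newton_diff :: "real \<Rightarrow> real^3 \<Rightarrow> real" where
  "newton_diff e z = (1 / e) * newton ((1 / e) *\<^sub>R z) - newton z"

definition mollifier_scaled :: "real \<Rightarrow> real^3 \<Rightarrow> real" where
  "mollifier_scaled e z = (1 / e ^ 3) * mollifier ((1 / e) *\<^sub>R z)"

lemma Ck_newton_diff: "Ck 4 (newton_diff e)"
  unfolding newton_diff_def[abs_def]
  by (intro Ck_diff Ck_cmult Ck_newton4 Ck_affine[OF Ck_newton4, of "1/e" 0, simplified add_0_right])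

lemma newton_diff_eq_0:
  assumes "0 < e" "e \<le> 1" "norm z \<ge> 1"
  shows "newton_diff e z = 0"
proof -
  have s: "sqn z \<ge> 1" using assms by (simp add: sqn_norm one_le_power)
  have se: "sqn ((1/e) *\<^sub>R z) = sqn z / e\<^sup>2" by (simp add: sqn_norm power_divide)
  have "e\<^sup>2 \<le> 1" using assms by (simp add: power_le_one)
  then have "sqn z / e\<^sup>2 \<ge> 1" using s assms by (simp add: le_divide_eq)
  moreover have "(sqn z / e\<^sup>2) powr (-1/2) = e * sqn z powr (-1/2)"
  proof -
    have "(sqn z / e\<^sup>2) powr (-1/2) = sqn z powr (-1/2) / (e\<^sup>2) powr (-1/2)"
      using s by (intro powr_divide)
    also have "(e\<^sup>2) powr (-1/2) = e powr (-1)"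
      using assms powr_powr[of e 2 "-1/2"] by (simp add: powr_numeral)
    finally show ?thesis using assms by (simp add: powr_minus_divide)
  qed
  ultimately show ?thesis using s assms by (simp add: newton_diff_def newton_def newton_profile_def se)
qed

lemma laplacian_newton_diff:
  assumes "e > 0"
  shows "(\<Sum>j\<in>UNIV. pd j (pd j (newton_diff e)) z) = mollifier z - mollifier_scaled e z"
proof -
  have C: "Ck 1 newton" "Ck 1 (pd j newton)" "Ck 2 newton" for j
    by (rule Ck_le[OF Ck_newton4], simp, rule Ck_pd, rule Ck_le[OF Ck_newton4], simp,
        rule Ck_le[OF Ck_newton4], simp)
  have C': "Ck 1 (\<lambda>z. c * f ((1 / e) *\<^sub>R z))" if "Ck 1 f" for f :: "real^3 \<Rightarrow> real" and c
    by (intro Ck_cmult Ck_affine[OF that, of "1/e" 0, simplified add_0_right])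
  have dd: "pd j (\<lambda>z. f z - g z) = (\<lambda>z. pd j f z - pd j g z)" if "Ck 1 f" "Ck 1 g" for f g :: "real^3 \<Rightarrow> real" and j
  proof
    fix z
    have d: "f differentiable at z" "g differentiable at z"
      using that by (auto intro: Ck_differentiable simp del: Ck.simps)
    show "pd j (\<lambda>z. f z - g z) z = pd j f z - pd j g z"
      using pd_eq[OF has_derivative_diff[OF d[THEN frechet_derivative_works[THEN iffD1]]]] by (simp add: pd_def)
  qed
  have "pd j (newton_diff e) = (\<lambda>z. (1 / e * (1 / e)) * pd j newton ((1 / e) *\<^sub>R z) - pd j newton z)" for j
    unfolding newton_diff_def[abs_def] dd[OF C'[OF C(1)] C(1)] pd_scaled[OF C(1)] ..
  then have "pd j (pd j (newton_diff e)) z =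
      (1 / e * (1 / e) * (1 / e)) * pd j (pd j newton) ((1 / e) *\<^sub>R z) - pd j (pd j newton) z" for j z
    by (simp only: dd[OF C'[OF C(2)] C(2)] pd_scaled[OF C(2)])
  then have "(\<Sum>j\<in>UNIV. pd j (pd j (newton_diff e)) z) =
     (1 / e * (1 / e) * (1 / e)) * (\<Sum>j\<in>UNIV. pd j (pd j newton) ((1 / e) *\<^sub>R z)) - (\<Sum>j\<in>UNIV. pd j (pd j newton) z)"
    by (simp add: sum_subtractf sum_distrib_left)
  then show ?thesis unfolding laplacian_newton
    by (simp add: mollifier_scaled_def power3_eq_cube)
qed

section \<open>Centred boxes and convolution with an even kernel\<close>

abbreviation bx :: "real \<Rightarrow> (real^3) set" where
  "bx r \<equiv> cbox (- (\<chi> i. r)) (\<chi> i. r)"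

lemma mem_bx: "x \<in> bx r \<longleftrightarrow> (\<forall>i. \<bar>x $ i\<bar> \<le> r)"
  by (auto simp: mem_box_cart abs_le_iff minus_le_iff)

lemma bx_mono: "r \<le> s \<Longrightarrow> bx r \<subseteq> bx s"
  unfolding subset_iff mem_bx using order_trans by blast

lemma mem_bx_norm: "norm x \<le> r \<Longrightarrow> x \<in> bx r"
  using component_le_norm_cart order_trans unfolding mem_bx by blast

lemma bx_shift:
  assumes "x \<in> bx r" "norm (y - x) \<le> s"
  shows "y \<in> bx (r + s)"
  unfolding mem_bx
proof
  fix i
  have "\<bar>(y - x) $ i\<bar> \<le> s" using component_le_norm_cart assms(2) order_trans by blast
  then show "\<bar>y $ i\<bar> \<le> r + s" using assms(1)[unfolded mem_bx, rule_format, of i] by simp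
qed

lemma content_bx: "r \<ge> 0 \<Longrightarrow> measure lborel (bx r) = (2 * r) ^ 3"
  by (simp add: content_cbox_cart interval_ne_empty_cart)

lemma smooth_continuous: "smooth f \<Longrightarrow> continuous_on S f"
  unfolding smooth_def using Ck_continuous by blast

lemma smooth_Ck: "smooth f \<Longrightarrow> Ck k f"
  by (simp add: smooth_def)

lemma smooth_differentiable: "smooth f \<Longrightarrow> f differentiable at x"
  using smooth_Ck[of f "Suc 0"] by (rule Ck_differentiable)

lemma continuous_on_translate:
  fixes k :: "real^'n::finite \<Rightarrow> real"
  assumes "continuous_on UNIV k"
  shows "continuous_on S (\<lambda>y. k (x - y))" "continuous_on S (\<lambda>y. k (y - x))"
  by (intro continuous_on_compose2[OF assms] continuous_intros; simp)+

text \<open>Shared by \<open>mollifier\<close> and \<open>mollifier_scaled e\<close>, so that the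
  L^2 bounds below are uniform in e. Radial symmetry is recorded as evenness.\<close>

locale radial_kernel =
  fixes k :: "real^3 \<Rightarrow> real"
  assumes k_cont: "continuous_on UNIV k" and k_nonneg: "\<And>z. k z \<ge> 0"
    and k_even: "\<And>z. k (- z) = k z" and k_supp: "\<And>z. norm z \<ge> 1 \<Longrightarrow> k z = 0"
begin

definition mass :: real where "mass = integral (bx 1) k"

lemma k_outside: "z \<notin> bx 1 \<Longrightarrow> k z = 0"
  using k_supp mem_bx_norm[of z 1] by fastforce

lemma k_commute: "k (x - y) = k (y - x)"
  using k_even[of "x - y"] by simp

lemma integral_translate: "integral (cbox a b) (\<lambda>y. k (y - x)) = integral (cbox (a - x) (b - x)) k"
  using integral_shift_cbox_plus[of a b k "- x"] by (simp add: o_def)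

lemma integral_translate_le: "integral (cbox a b) (\<lambda>y. k (y - x)) \<le> mass"
proof -
  have "integral (cbox (a - x) (b - x)) k = integral (cbox (a - x) (b - x)) (\<lambda>z. if z \<in> bx 1 then k z else 0)"
    by (rule integral_cong) (use k_outside in auto)
  also have "\<dots> = integral (bx 1 \<inter> cbox (a - x) (b - x)) k" by (rule integral_restrict_Int)
  also have "\<dots> \<le> integral (bx 1) k"
    unfolding Int_interval
    by (intro integral_subset_le continuous_integrable_cbox k_cont ballI k_nonneg)
      (use Int_interval[of "-(\<chi> i. 1)" "\<chi> i. 1" "a - x" "b - x"] in blast)
  finally show ?thesis unfolding integral_translate mass_def .
qed

lemma integral_translate_eq:
  assumes "x \<in> bx r"
  shows "integral (bx (r + 1)) (\<lambda>y. k (y - x)) = mass"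
proof -
  have "bx 1 \<subseteq> cbox (- (\<chi> i. r + 1) - x) ((\<chi> i. r + 1) - x)"
  proof
    fix z assume z: "z \<in> bx 1"
    show "z \<in> cbox (- (\<chi> i. r + 1) - x) ((\<chi> i. r + 1) - x)"
      unfolding mem_box_cart
    proof
      fix i
      show "(- (\<chi> i. r + 1) - x) $ i \<le> z $ i \<and> z $ i \<le> ((\<chi> i. r + 1) - x) $ i"
        using z[unfolded mem_bx, rule_format, of i] assms[unfolded mem_bx, rule_format, of i] by auto
    qed
  qed
  then show ?thesis unfolding integral_translate mass_def
    by (intro integral_cbox_superset k_outside)
qed

lemma mass_nonneg: "mass \<ge> 0"
  unfolding mass_def by (intro integral_nonneg continuous_integrable_cbox k_cont k_nonneg)

text \<open>Cauchy-Schwarz for the weight k(x - y): the weighted integral of (g y - t)^2 is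
  nonnegative for every t, and t = \<open>?c / mass\<close> is the optimal choice.\<close>

lemma conv_square_le:
  assumes g: "continuous_on UNIV g"
  shows "(conv a b g k x)\<^sup>2 \<le> mass * conv a b (\<lambda>y. (g y)\<^sup>2) k x"
proof -
  have g2: "continuous_on UNIV (\<lambda>y. (g y)\<^sup>2)" by (intro continuous_intros g)
  let ?c = "conv a b g k x" and ?d = "conv a b (\<lambda>y. (g y)\<^sup>2) k x"
  have key: "0 \<le> ?d - 2 * t * ?c + t\<^sup>2 * mass" for t
  proof -
    have ints: "(\<lambda>y. (g y)\<^sup>2 * k (x - y)) integrable_on cbox a b" "(\<lambda>y. g y * k (x - y)) integrable_on cbox a b"
      "(\<lambda>y. k (x - y)) integrable_on cbox a b"
      by (intro conv_integrable g g2 k_cont continuous_integrable_cbox continuous_on_translate)+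
    have "0 \<le> integral (cbox a b) (\<lambda>y. (g y - t)\<^sup>2 * k (x - y))"
      by (intro integral_nonneg continuous_integrable_cbox continuous_intros g continuous_on_translate[OF k_cont])
        (simp add: k_nonneg)
    also have "(\<lambda>y. (g y - t)\<^sup>2 * k (x - y)) = (\<lambda>y. (g y)\<^sup>2 * k (x - y) - (2 * t) * (g y * k (x - y)) + t\<^sup>2 * k (x - y))"
      by (auto simp: power2_diff algebra_simps)
    also have "integral (cbox a b) \<dots> = ?d - 2 * t * ?c + t\<^sup>2 * integral (cbox a b) (\<lambda>y. k (x - y))"
      unfolding conv_def
      by (subst integral_add integral_diff; (intro integrable_diff integrable_on_mult_right ints)?)+
        simp
    also have "\<dots> \<le> ?d - 2 * t * ?c + t\<^sup>2 * mass"
      using integral_translate_le[of a b x] k_commute[of x] by (intro add_left_mono mult_left_mono) auto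
    finally show ?thesis .
  qed
  show ?thesis
  proof (cases "mass = 0")
    case True
    have "?c = 0"
    proof (rule ccontr)
      assume "?c \<noteq> 0"
      \<comment> \<open>Without mass the bound is affine in t, and this t gives it the value
        -1.\<close>
      then show False using key[of "(?d + 1) / (2 * ?c)"] True by simp
    qed
    then show ?thesis using True by simp
  next
    case False
    then have m: "mass > 0" using mass_nonneg by simp
    have "0 \<le> mass * (?d - 2 * (?c / mass) * ?c + (?c / mass)\<^sup>2 * mass)"
      using key[of "?c / mass"] m by simp
    also have "\<dots> = mass * ?d - ?c\<^sup>2" using m by (simp add: field_simps power2_eq_square)
    finally show ?thesis by simp
  qed
qed

lemma continuous_on_conv:
  fixes g :: "real^3 \<Rightarrow> real"
  assumes g: "continuous_on UNIV g"
  shows "continuous_on UNIV (conv a b g k)"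
proof -
  have "continuous_on (UNIV \<times> cbox a b) (\<lambda>(x, y). g y * k (x - y))"
    unfolding split_def
    by (intro continuous_intros continuous_on_compose2[OF g] continuous_on_compose2[OF k_cont]) auto
  from integral_continuous_on_param[OF this] show ?thesis by (simp add: conv_def[abs_def])
qed

lemma integral_conv_swap:
  fixes f g :: "real^3 \<Rightarrow> real"
  assumes f: "continuous_on UNIV f" and g: "continuous_on UNIV g"
  shows "integral (cbox c d) (\<lambda>x. f x * conv a b g k x) = integral (cbox a b) (\<lambda>y. g y * conv c d f k y)"
proof -
  have "integral (cbox c d) (\<lambda>x. f x * conv a b g k x)
      = integral (cbox c d) (\<lambda>x. integral (cbox a b) (\<lambda>y. f x * (g y * k (x - y))))"
    unfolding conv_def by (simp add: integral_mult_right)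
  also have "\<dots> = integral (cbox a b) (\<lambda>y. integral (cbox c d) (\<lambda>x. f x * (g y * k (x - y))))"
  proof (rule integral_swap_continuous)
    show "continuous_on (cbox (c, a) (d, b)) (\<lambda>(x, y). f x * (g y * k (x - y)))"
      unfolding split_def
      by (intro continuous_intros continuous_on_compose2[OF f] continuous_on_compose2[OF g]
          continuous_on_compose2[OF k_cont]) auto
  qed
  also have "(\<lambda>y. integral (cbox c d) (\<lambda>x. f x * (g y * k (x - y)))) = (\<lambda>y. g y * conv c d f k y)"
  proof
    fix y
    have "(\<lambda>x. f x * (g y * k (x - y))) = (\<lambda>x. g y * (f x * k (y - x)))"
      using k_commute by (auto simp: mult_ac)
    then show "integral (cbox c d) (\<lambda>x. f x * (g y * k (x - y))) = g y * conv c d f k y"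
      by (simp add: conv_def integral_mult_right)
  qed
  finally show ?thesis .
qed

text \<open>Young's inequality for convolutions in L^2: the pointwise bound, then Fubini and the
  mass in the other variable.\<close>

lemma integral_conv_square_le:
  fixes g :: "real^3 \<Rightarrow> real"
  assumes g: "continuous_on UNIV g"
  shows "integral (cbox c d) (\<lambda>x. (conv a b g k x)\<^sup>2) \<le> mass\<^sup>2 * integral (cbox a b) (\<lambda>y. (g y)\<^sup>2)"
proof -
  have g2: "continuous_on UNIV (\<lambda>y. (g y)\<^sup>2)" by (intro continuous_intros g)
  have "integral (cbox c d) (\<lambda>x. (conv a b g k x)\<^sup>2) \<le> integral (cbox c d) (\<lambda>x. mass * conv a b (\<lambda>y. (g y)\<^sup>2) k x)"
    by (intro integral_le continuous_integrable_cbox continuous_intros continuous_on_conv g g2 conv_square_le)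
  also have "\<dots> = mass * integral (cbox a b) (\<lambda>y. (g y)\<^sup>2 * conv c d (\<lambda>_. 1) k y)"
    using integral_conv_swap[of "\<lambda>_. 1" "\<lambda>y. (g y)\<^sup>2" c d a b] g2 by (simp add: integral_mult_right)
  also have "\<dots> \<le> mass * integral (cbox a b) (\<lambda>y. (g y)\<^sup>2 * mass)"
  proof (rule mult_left_mono[OF _ mass_nonneg], intro integral_le continuous_integrable_cbox continuous_intros continuous_on_conv g)
    fix y
    show "(g y)\<^sup>2 * conv c d (\<lambda>_. 1) k y \<le> (g y)\<^sup>2 * mass"
      using integral_translate_le[of c d y] k_commute[of y] by (intro mult_left_mono) (auto simp: conv_def)
  qed
  also have "\<dots> = mass\<^sup>2 * integral (cbox a b) (\<lambda>y. (g y)\<^sup>2)"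
    by (simp add: integral_mult_left power2_eq_square)
  finally show ?thesis .
qed

end

lemma mollifier_kernel: "radial_kernel mollifier"
  by standard
    (auto intro: Ck_continuous[OF Ck_mollifier] mollifier_nonneg mollifier_eq_0 simp: mollifier_even)

lemma mollifier_scaled_eq_0: "0 < e \<Longrightarrow> norm z \<ge> e \<Longrightarrow> mollifier_scaled e z = 0"
  by (simp add: mollifier_scaled_def mollifier_eq_0)

lemma mollifier_scaled_kernel:
  assumes "0 < e" "e \<le> 1"
  shows "radial_kernel (mollifier_scaled e)"
proof
  show "continuous_on UNIV (mollifier_scaled e)"
    unfolding mollifier_scaled_def[abs_def]
    by (intro continuous_intros continuous_on_compose2[OF Ck_continuous[OF Ck_mollifier, of UNIV]]) auto
  show "mollifier_scaled e (- z) = mollifier_scaled e z" for z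
    using mollifier_even[of "(1/e) *\<^sub>R z"] by (simp add: mollifier_scaled_def)
  show "mollifier_scaled e z \<ge> 0" for z
    using assms by (simp add: mollifier_scaled_def mollifier_nonneg)
  show "mollifier_scaled e z = 0" if "norm z \<ge> 1" for z
    by (rule mollifier_scaled_eq_0) (use assms that in auto)
qed

definition mu :: real where "mu = integral (bx 1) mollifier"

lemma mu_pos: "mu > 0"
proof -
  have c: "continuous_on (bx 1) mollifier" by (rule Ck_continuous[OF Ck_mollifier])
  have "mu \<ge> 0" unfolding mu_def
    by (intro integral_nonneg integrable_continuous c mollifier_nonneg)
  moreover have "mu \<noteq> 0"
  proof
    assume "mu = 0"
    then have "(mollifier has_integral 0) (bx 1)"
      using integrable_integral[OF integrable_continuous[OF c]] by (simp add: mu_def)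
    then have "mollifier 0 = 0"
      by (intro has_integral_0_cbox_imp_0[OF c]) (auto simp: mollifier_nonneg mem_box_cart interval_ne_empty_cart)
    then show False by (simp add: mollifier_def sqn_def)
  qed
  ultimately show ?thesis by simp
qed

lemma mass_mollifier: "radial_kernel.mass mollifier = mu"
  by (simp add: radial_kernel.mass_def[OF mollifier_kernel] mu_def)

text \<open>The Laplacian of the compactly supported \<open>newton_diff e\<close> has integral zero,
  and it is the difference of the two mollifiers.\<close>

lemma mass_mollifier_scaled:
  assumes e: "0 < e" "e \<le> 1"
  shows "radial_kernel.mass (mollifier_scaled e) = mu"
proof -
  have supp: "newton_diff e z = 0" if "z \<notin> bx 1" for z
    using newton_diff_eq_0[OF e] mem_bx_norm[of z 1] that by fastforce
  have C1: "Ck 1 (pd j (newton_diff e))" for j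
    by (rule Ck_pd[OF Ck_le[OF Ck_newton_diff]]) simp
  have c2: "continuous_on UNIV (pd j (pd j (newton_diff e)))" for j
    using C1[of j] by simp
  have "0 = (\<Sum>j\<in>UNIV. integral (bx 1) (pd j (pd j (newton_diff e))))"
    using pd_eq_0_outside_cbox[OF supp] by (subst integral_pd_eq_0[OF C1]) auto
  also have "\<dots> = integral (bx 1) (\<lambda>z. \<Sum>j\<in>UNIV. pd j (pd j (newton_diff e)) z)"
    by (intro integral_sum[symmetric] continuous_integrable_cbox c2) simp
  also have "\<dots> = mu - radial_kernel.mass (mollifier_scaled e)"
    unfolding laplacian_newton_diff[OF e(1)] mu_def radial_kernel.mass_def[OF mollifier_scaled_kernel[OF e]]
    by (intro integral_diff continuous_integrable_cbox radial_kernel.k_cont mollifier_kernel mollifier_scaled_kernel e)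
  finally show ?thesis by simp
qed

text \<open>P is the physical pressure, i.e. \<open>- p\<close> for the p of the final theorem.\<close>

locale stationary_NS =
  fixes U :: "3 \<Rightarrow> real^3 \<Rightarrow> real" and P :: "real^3 \<Rightarrow> real"
  assumes smooth_U: "\<And>i. smooth (U i)" and smooth_P: "smooth P"
    and momentum: "\<And>i x. pd i P x = (\<Sum>j\<in>UNIV. pd j (pd j (U i)) x) - (\<Sum>j\<in>UNIV. U j x * pd j (U i) x)"
    and incompressible: "\<And>x. (\<Sum>j\<in>UNIV. pd j (U j) x) = 0"
begin

text \<open>All derivatives are moved to \<psi>, twice in the viscous and once in the convective
  term, where incompressibility removes the divergence of u. The pressure gradient, tested against
  \<psi>, is thus controlled by |u| and |u|^2.\<close>

lemma weak_momentum:
  fixes \<psi> :: "real^3 \<Rightarrow> real"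
  assumes \<psi>: "Ck 2 \<psi>" and supp: "\<And>x. x \<notin> bx 4 \<Longrightarrow> \<psi> x = 0"
  shows "integral (bx 4) (\<lambda>x. pd a P x * \<psi> x) =
    integral (bx 4) (\<lambda>x. U a x * (\<Sum>k\<in>UNIV. pd k (pd k \<psi>) x))
    + integral (bx 4) (\<lambda>x. \<Sum>k\<in>UNIV. U k x * U a x * pd k \<psi> x)"
proof -
  have C1: "Ck 1 \<psi>" "Ck 1 (pd k \<psi>)" for k
    using Ck_le[OF \<psi>, of 1] Ck_pd[of 1 \<psi> k] \<psi> by (simp_all add: numeral_2_eq_2 del: Ck.simps)
  have c: "continuous_on UNIV \<psi>" "continuous_on UNIV (pd k \<psi>)" "continuous_on UNIV (pd k (pd k \<psi>))" for k
    using C1(2)[of k] C1(1) by (auto intro: Ck_continuous)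
  note cont = continuous_intros smooth_continuous smooth_pd smooth_U smooth_P c
  have supp': "pd k \<psi> x = 0" if "x \<notin> bx 4" for k x by (rule pd_eq_0_outside_cbox[OF supp that])
  have visc: "integral (bx 4) (\<lambda>x. pd k (pd k (U a)) x * \<psi> x) = integral (bx 4) (\<lambda>x. U a x * pd k (pd k \<psi>) x)" for k
  proof -
    have "integral (bx 4) (\<lambda>x. \<psi> x * pd k (pd k (U a)) x) = - integral (bx 4) (\<lambda>x. pd k \<psi> x * pd k (U a) x)"
      by (rule integral_by_parts_pd) (use supp C1 in \<open>auto intro: smooth_Ck smooth_pd smooth_U simp del: Ck.simps\<close>)
    also have "\<dots> = integral (bx 4) (\<lambda>x. pd k (pd k \<psi>) x * U a x)"
      by (subst integral_by_parts_pd) (use supp' C1 in \<open>auto intro: smooth_Ck smooth_U simp del: Ck.simps\<close>)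
    finally show ?thesis by (simp add: mult.commute)
  qed
  have conv: "integral (bx 4) (\<lambda>x. U k x * pd k (U a) x * \<psi> x)
    = - integral (bx 4) (\<lambda>x. U k x * U a x * pd k \<psi> x) - integral (bx 4) (\<lambda>x. pd k (U k) x * (U a x * \<psi> x))" for k
  proof -
    have C: "Ck 1 (\<lambda>x. \<psi> x * U k x)" by (intro Ck_mult C1 smooth_Ck smooth_U)
    have "pd k (\<lambda>x. \<psi> x * U k x) = (\<lambda>x. pd k \<psi> x * U k x + \<psi> x * pd k (U k) x)"
    proof
      fix x
      have "\<psi> differentiable at x" using C1(1) by (auto intro: Ck_differentiable simp del: Ck.simps)
      then show "pd k (\<lambda>x. \<psi> x * U k x) x = pd k \<psi> x * U k x + \<psi> x * pd k (U k) x"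
        by (rule pd_mult[OF _ smooth_differentiable[OF smooth_U]])
    qed
    moreover have "integral (bx 4) (\<lambda>x. \<psi> x * U k x * pd k (U a) x)
      = - integral (bx 4) (\<lambda>x. pd k (\<lambda>x. \<psi> x * U k x) x * U a x)"
      by (rule integral_by_parts_pd[OF C]) (use supp in \<open>auto intro: smooth_Ck smooth_U simp del: Ck.simps\<close>)
    ultimately have "integral (bx 4) (\<lambda>x. U k x * pd k (U a) x * \<psi> x)
      = - integral (bx 4) (\<lambda>x. U k x * U a x * pd k \<psi> x + pd k (U k) x * (U a x * \<psi> x))"
      by (simp add: algebra_simps)
    also have "integral (bx 4) (\<lambda>x. U k x * U a x * pd k \<psi> x + pd k (U k) x * (U a x * \<psi> x))
      = integral (bx 4) (\<lambda>x. U k x * U a x * pd k \<psi> x) + integral (bx 4) (\<lambda>x. pd k (U k) x * (U a x * \<psi> x))"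
      by (intro integral_add continuous_integrable_cbox cont)
    finally show ?thesis by simp
  qed
  have zero: "(\<Sum>k\<in>UNIV. integral (bx 4) (\<lambda>x. pd k (U k) x * (U a x * \<psi> x))) = 0"
  proof -
    have "(\<Sum>k\<in>UNIV. integral (bx 4) (\<lambda>x. pd k (U k) x * (U a x * \<psi> x)))
      = integral (bx 4) (\<lambda>x. \<Sum>k\<in>UNIV. pd k (U k) x * (U a x * \<psi> x))"
      by (intro integral_sum[symmetric] continuous_integrable_cbox cont) simp
    also have "\<dots> = 0" by (simp add: sum_distrib_right[symmetric] incompressible)
    finally show ?thesis .
  qed
  have "integral (bx 4) (\<lambda>x. pd a P x * \<psi> x)
     = integral (bx 4) (\<lambda>x. (\<Sum>k\<in>UNIV. pd k (pd k (U a)) x * \<psi> x) - (\<Sum>k\<in>UNIV. U k x * pd k (U a) x * \<psi> x))"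
    by (simp add: momentum left_diff_distrib sum_distrib_right)
  also have "\<dots> = (\<Sum>k\<in>UNIV. integral (bx 4) (\<lambda>x. pd k (pd k (U a)) x * \<psi> x))
      - (\<Sum>k\<in>UNIV. integral (bx 4) (\<lambda>x. U k x * pd k (U a) x * \<psi> x))"
    by (subst integral_diff integral_sum; (intro finite continuous_integrable_cbox cont)?)+ simp
  also have "\<dots> = (\<Sum>k\<in>UNIV. integral (bx 4) (\<lambda>x. U a x * pd k (pd k \<psi>) x))
      + (\<Sum>k\<in>UNIV. integral (bx 4) (\<lambda>x. U k x * U a x * pd k \<psi> x))"
    unfolding visc conv using zero by (simp add: sum_subtractf sum_negf)
  also have "\<dots> = integral (bx 4) (\<lambda>x. \<Sum>k\<in>UNIV. U a x * pd k (pd k \<psi>) x)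
      + integral (bx 4) (\<lambda>x. \<Sum>k\<in>UNIV. U k x * U a x * pd k \<psi> x)"
    by (subst (1 2) integral_sum) (intro finite continuous_integrable_cbox cont | simp)+
  finally show ?thesis by (simp add: sum_distrib_left)
qed

end

section \<open>The pressure estimate\<close>

lemma integral_abs_le:
  fixes f g :: "real^'n::finite \<Rightarrow> real"
  assumes "continuous_on UNIV f" "continuous_on UNIV g" "\<And>x. x \<in> cbox a b \<Longrightarrow> \<bar>f x\<bar> \<le> g x"
  shows "\<bar>integral (cbox a b) f\<bar> \<le> integral (cbox a b) g"
  using integral_norm_bound_integral[of f "cbox a b" g] assms
  by (simp add: continuous_integrable_cbox)

text \<open>Two integrations by parts exchange the roles of i and j and turn the sum of squares into
  the square of the sum. This is the L^2 Calderon-Zygmund estimate with constant 1.\<close>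

lemma hessian_energy:
  fixes W :: "real^'n::finite \<Rightarrow> real"
  assumes W: "Ck 3 W" and supp: "\<And>x. x \<notin> cbox a b \<Longrightarrow> W x = 0"
  shows "(\<Sum>i\<in>UNIV. \<Sum>j\<in>UNIV. integral (cbox a b) (\<lambda>x. (pd i (pd j W) x)\<^sup>2))
    = integral (cbox a b) (\<lambda>x. (\<Sum>j\<in>UNIV. pd j (pd j W) x)\<^sup>2)"
proof -
  have C3: "Ck (Suc (Suc 1)) W" using W by (simp add: numeral_3_eq_3)
  have C2: "Ck (Suc 1) (pd j W)" for j by (rule Ck_pd[OF C3])
  have C1: "Ck 1 (pd i (pd j W))" for i j by (rule Ck_pd[OF C2])
  have two: "Ck 2 W" "Ck 2 (pd j W)" "Ck 1 (pd j W)" for j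
    using C2[of j] Ck_SucD[OF C3] Ck_SucD[OF C2] by (simp_all add: numeral_2_eq_2 del: Ck.simps)
  have c: "continuous_on UNIV (pd i (pd j W))" for i j by (rule Ck_continuous[OF C1])
  have supp1: "pd j W x = 0" if "x \<notin> cbox a b" for j x by (rule pd_eq_0_outside_cbox[OF supp that])
  have *: "integral (cbox a b) (\<lambda>x. (pd i (pd j W) x)\<^sup>2) = integral (cbox a b) (\<lambda>x. pd i (pd i W) x * pd j (pd j W) x)" for i j
  proof -
    have "integral (cbox a b) (\<lambda>x. (pd i (pd j W) x)\<^sup>2) = - integral (cbox a b) (\<lambda>x. pd i (pd i (pd j W)) x * pd j W x)"
      unfolding power2_eq_square by (rule integral_by_parts_pd[OF C1 two(3)]) (simp add: supp1)
    also have "pd i (pd i (pd j W)) = pd j (pd i (pd i W))"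
      using pd_commute[OF two(1), of i j] pd_commute[OF two(2), of i j i] by simp
    also have "- integral (cbox a b) (\<lambda>x. pd j (pd i (pd i W)) x * pd j W x)
      = integral (cbox a b) (\<lambda>x. pd i (pd i W) x * pd j (pd j W) x)"
      by (rule integral_by_parts_pd[OF C1 two(3), symmetric]) (simp add: supp1)
    finally show ?thesis .
  qed
  have "(\<Sum>i\<in>UNIV. \<Sum>j\<in>UNIV. integral (cbox a b) (\<lambda>x. (pd i (pd j W) x)\<^sup>2))
    = (\<Sum>i\<in>UNIV. integral (cbox a b) (\<lambda>x. \<Sum>j\<in>UNIV. pd i (pd i W) x * pd j (pd j W) x))"
    unfolding * by (intro sum.cong refl integral_sum[symmetric] finite continuous_integrable_cbox continuous_intros c)
  also have "\<dots> = integral (cbox a b) (\<lambda>x. \<Sum>i\<in>UNIV. \<Sum>j\<in>UNIV. pd i (pd i W) x * pd j (pd j W) x)"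
    by (intro integral_sum[symmetric] finite continuous_integrable_cbox continuous_intros c)
  finally show ?thesis by (simp add: power2_eq_square sum_product)
qed

lemma compact_support_bounded:
  fixes f :: "real^'n::finite \<Rightarrow> real"
  assumes "continuous_on UNIV f" "\<And>x. x \<notin> cbox a b \<Longrightarrow> f x = 0"
  shows "\<exists>C\<ge>0. \<forall>x. \<bar>f x\<bar> \<le> C"
proof -
  have "bounded (f ` cbox a b)"
    by (intro compact_imp_bounded compact_continuous_image continuous_on_subset[OF assms(1)]) auto
  then obtain C where C: "\<And>x. x \<in> cbox a b \<Longrightarrow> \<bar>f x\<bar> \<le> C" by (auto simp: bounded_iff)
  have "\<bar>f x\<bar> \<le> \<bar>C\<bar>" for x using C[of x] assms(2)[of x] by (cases "x \<in> cbox a b") auto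
  then show ?thesis by (intro exI[of _ "\<bar>C\<bar>"]) auto
qed

lemma mollifier_bounds:
  "\<exists>C\<ge>0. (\<forall>k z. \<bar>pd k mollifier z\<bar> \<le> C) \<and> (\<forall>z. \<bar>\<Sum>k\<in>UNIV. pd k (pd k mollifier) z\<bar> \<le> C)"
proof -
  have supp: "mollifier z = 0" if "z \<notin> bx 1" for z
    using mollifier_eq_0 mem_bx_norm[of z 1] that by fastforce
  have C2: "Ck (Suc 1) mollifier" using Ck_mollifier by (simp add: numeral_2_eq_2 del: Ck.simps)
  have C1: "Ck 1 (pd k mollifier)" for k by (rule Ck_pd[OF C2])
  have c: "continuous_on UNIV (pd k mollifier)" "continuous_on UNIV (pd k (pd k mollifier))" for k
    using C1[of k] by simp_all
  have s1: "pd k mollifier z = 0" if "z \<notin> bx 1" for k z by (rule pd_eq_0_outside_cbox[OF supp that])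
  have s2: "pd k (pd k mollifier) z = 0" if "z \<notin> bx 1" for k z by (rule pd_eq_0_outside_cbox[OF s1 that])
  have "\<exists>C\<ge>0. \<forall>z. \<bar>pd k mollifier z\<bar> \<le> C" for k by (rule compact_support_bounded[OF c(1) s1])
  then obtain D where D: "\<And>k. D k \<ge> 0" "\<And>k z. \<bar>pd k mollifier z\<bar> \<le> D k" by metis
  have "\<exists>C\<ge>0. \<forall>z. \<bar>\<Sum>k\<in>UNIV. pd k (pd k mollifier) z\<bar> \<le> C"
    by (rule compact_support_bounded[of _ "- (\<chi> i. 1)" "\<chi> i. 1"])
      (auto intro!: continuous_intros c sum.neutral s2)
  then obtain E where E: "E \<ge> 0" "\<And>z. \<bar>\<Sum>k\<in>UNIV. pd k (pd k mollifier) z\<bar> \<le> E" by blast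
  have Dk: "D k \<le> sum D UNIV" for k by (rule member_le_sum) (auto simp: D)
  have D0: "sum D UNIV \<ge> 0" by (rule sum_nonneg) (rule D)
  have "\<bar>pd k mollifier z\<bar> \<le> sum D UNIV + E" for k z using D(2)[of k z] Dk[of k] E(1) by linarith
  moreover have "\<bar>\<Sum>k\<in>UNIV. pd k (pd k mollifier) z\<bar> \<le> sum D UNIV + E" for z using E(2)[of z] D0 by linarith
  ultimately show ?thesis using D0 E(1) by (intro exI[of _ "sum D UNIV + E"]) auto
qed

text \<open>Removes the approximation error t of \<open>pressure_estimate\<close> from the final
  bound.\<close>

lemma le_quadratic_limit:
  fixes a b c d :: real
  assumes "\<And>t. t > 0 \<Longrightarrow> a \<le> b * (t + c)\<^sup>2 + d"
  shows "a \<le> b * c\<^sup>2 + d"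
proof -
  have "((\<lambda>t. b * (t + c)\<^sup>2 + d) \<longlongrightarrow> b * (0 + c)\<^sup>2 + d) (at_right 0)"
    by (intro tendsto_intros)
  then have "a \<le> b * (0 + c)\<^sup>2 + d"
    by (rule tendsto_lowerbound)
      (auto simp: eventually_at_right_field assms intro!: exI[of _ 1])
  then show ?thesis by simp
qed

text \<open>Fixed outside the locale, so that it is the same for all solutions, in particular for
  all rescalings of u.\<close>

definition pressure_const :: real where
  "pressure_const = (SOME C. C \<ge> 0 \<and> (\<forall>k z. \<bar>pd k mollifier z\<bar> \<le> C) \<and> (\<forall>z. \<bar>\<Sum>k\<in>UNIV. pd k (pd k mollifier) z\<bar> \<le> C))"

lemma pressure_const: "pressure_const \<ge> 0" "\<bar>pd k mollifier z\<bar> \<le> pressure_const"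
  "\<bar>\<Sum>k\<in>UNIV. pd k (pd k mollifier) z\<bar> \<le> pressure_const"
  using someI_ex[OF mollifier_bounds] unfolding pressure_const_def by auto

context stationary_NS
begin

abbreviation cv :: "(real^3 \<Rightarrow> real) \<Rightarrow> (real^3 \<Rightarrow> real) \<Rightarrow> real^3 \<Rightarrow> real" where
  "cv \<equiv> conv (- (\<chi> i. 4)) (\<chi> i. 4)"

definition usq :: "real^3 \<Rightarrow> real" where "usq x = (\<Sum>i\<in>UNIV. (U i x)\<^sup>2)"

text \<open>The size of u seen by a fixed test function: |u| through the viscosity, |u|^2 through
  the convection.\<close>

definition K1 :: real where "K1 = integral (bx 4) (\<lambda>x. (\<Sum>i\<in>UNIV. \<bar>U i x\<bar>) + usq x)"

definition A4 :: real where "A4 = integral (bx 4) (\<lambda>x. (usq x)\<^sup>2)"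

lemma continuous_U: "continuous_on S (U i)"
  by (rule smooth_continuous[OF smooth_U])

lemma continuous_P: "continuous_on S P"
  by (rule smooth_continuous[OF smooth_P])

lemma continuous_usq: "continuous_on S usq"
  unfolding usq_def[abs_def] by (intro continuous_intros continuous_U)

lemma usq_ge: "(U i x)\<^sup>2 \<le> usq x"
  unfolding usq_def by (rule member_le_sum) auto

lemma K1_nonneg: "K1 \<ge> 0"
  unfolding K1_def
  by (intro integral_nonneg continuous_integrable_cbox continuous_intros continuous_U continuous_usq)
    (auto simp: usq_def intro!: add_nonneg_nonneg sum_nonneg)

text \<open>This is a partial derivative of the pressure averaged at scale 1.
  \<open>weak_momentum\<close> with the translated mollifier as test function applies, since its
  support stays within distance 1 of \<open>bx 2\<close>.\<close>

lemma mollified_gradient_bound: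
  assumes y: "y \<in> bx 2"
  shows "\<bar>cv P (pd a mollifier) y\<bar> \<le> 3 * pressure_const * K1"
proof -
  define \<psi> where "\<psi> = (\<lambda>x. mollifier (y - x))"
  have C1m: "Ck 1 mollifier" "Ck 1 (pd k mollifier)" for k
    using Ck_le[OF Ck_mollifier, of 1] Ck_pd[of 1 mollifier k] Ck_mollifier
    by (simp_all add: numeral_2_eq_2 del: Ck.simps)
  have dm: "mollifier differentiable at z" "pd k mollifier differentiable at z" for k z
    using C1m by (auto intro: Ck_differentiable simp del: Ck.simps)
  have \<psi>2: "Ck 2 \<psi>"
    using Ck_affine[OF Ck_mollifier, of "-1" y] by (simp add: \<psi>_def)
  have p1: "pd k \<psi> = (\<lambda>x. - pd k mollifier (y - x))" for k
    using pd_affine[of mollifier "-1" _ y k] dm(1) by (auto simp: \<psi>_def)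
  have p2: "pd k (pd k \<psi>) = (\<lambda>x. pd k (pd k mollifier) (y - x))" for k
  proof
    fix x
    have d: "(\<lambda>x. pd k mollifier (y - x)) differentiable at x"
      using Ck_affine[OF C1m(2), of k "-1" y] by (auto intro: Ck_differentiable simp del: Ck.simps)
    show "pd k (pd k \<psi>) x = pd k (pd k mollifier) (y - x)"
      using pd_linear[OF bounded_linear_minus[OF bounded_linear_ident] d, of k] pd_affine[of "pd k mollifier" "-1" x y k] dm(2)
      by (simp add: p1)
  qed
  have supp: "\<psi> x = 0" if x: "x \<notin> bx 4" for x
  proof (rule ccontr)
    assume "\<psi> x \<noteq> 0"
    then have "norm (x - y) \<le> 1" using mollifier_eq_0[of "y - x"] by (force simp: \<psi>_def norm_minus_commute)
    from bx_shift[OF y this] x show False using bx_mono[of 3 4] by auto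
  qed
  have \<psi>1: "Ck 1 \<psi>" by (rule Ck_le[OF \<psi>2]) simp
  have c\<psi>: "continuous_on UNIV (pd k mollifier)" "continuous_on UNIV (pd k (pd k mollifier))" for k
    using C1m(2)[of k] by simp_all
  have ct: "continuous_on UNIV (\<lambda>x. pd k mollifier (y - x))" "continuous_on UNIV (\<lambda>x. pd k (pd k mollifier) (y - x))" for k
    by (intro continuous_on_translate c\<psi>)+
  have "cv P (pd a mollifier) y = - integral (bx 4) (\<lambda>x. P x * pd a \<psi> x)"
    by (simp add: conv_def p1)
  also have "\<dots> = integral (bx 4) (\<lambda>x. pd a P x * \<psi> x)"
    by (subst integral_by_parts_pd[OF smooth_Ck[OF smooth_P] \<psi>1]) (auto simp: supp)
  also have "\<dots> = integral (bx 4) (\<lambda>x. U a x * (\<Sum>k\<in>UNIV. pd k (pd k \<psi>) x))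
    + integral (bx 4) (\<lambda>x. \<Sum>k\<in>UNIV. U k x * U a x * pd k \<psi> x)"
    by (rule weak_momentum[OF \<psi>2 supp])
  also have "\<dots> = integral (bx 4) (\<lambda>x. U a x * (\<Sum>k\<in>UNIV. pd k (pd k \<psi>) x) + (\<Sum>k\<in>UNIV. U k x * U a x * pd k \<psi> x))"
    unfolding p2 unfolding p1
    by (intro integral_add[symmetric] continuous_integrable_cbox continuous_intros continuous_U ct)
  finally have eq: "cv P (pd a mollifier) y = \<dots>" .
  have "\<bar>cv P (pd a mollifier) y\<bar> \<le> integral (bx 4) (\<lambda>x. 3 * pressure_const * ((\<Sum>i\<in>UNIV. \<bar>U i x\<bar>) + usq x))"
    unfolding eq
  proof (rule integral_abs_le)
    fix x
    have "\<bar>U a x * (\<Sum>k\<in>UNIV. pd k (pd k \<psi>) x)\<bar> \<le> \<bar>U a x\<bar> * pressure_const"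
      unfolding abs_mult p2 by (intro mult_left_mono pressure_const) auto
    also have "\<dots> \<le> (\<Sum>i\<in>UNIV. \<bar>U i x\<bar>) * pressure_const"
      by (intro mult_right_mono member_le_sum[of a UNIV "\<lambda>i. \<bar>U i x\<bar>"] pressure_const) auto
    finally have 1: "\<bar>U a x * (\<Sum>k\<in>UNIV. pd k (pd k \<psi>) x)\<bar> \<le> (\<Sum>i\<in>UNIV. \<bar>U i x\<bar>) * pressure_const" .
    have "\<bar>\<Sum>k\<in>UNIV. U k x * U a x * pd k \<psi> x\<bar> \<le> (\<Sum>k\<in>(UNIV::3 set). usq x * pressure_const)"
    proof (rule order_trans[OF sum_abs sum_mono])
      fix k
      have "\<bar>U k x * U a x\<bar> \<le> usq x"
      proof -
        have "0 \<le> (\<bar>U k x\<bar> - \<bar>U a x\<bar>)\<^sup>2" by simp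
        then have "2 * \<bar>U k x * U a x\<bar> \<le> (U k x)\<^sup>2 + (U a x)\<^sup>2" by (simp add: power2_diff abs_mult)
        then show ?thesis using usq_ge[of k x] usq_ge[of a x] by linarith
      qed
      then show "\<bar>U k x * U a x * pd k \<psi> x\<bar> \<le> usq x * pressure_const"
        unfolding abs_mult[of "U k x * U a x"] p1 abs_minus_cancel
        by (intro mult_mono pressure_const) (auto simp: usq_def intro: sum_nonneg)
    qed
    also have "\<dots> = 3 * pressure_const * usq x" by simp
    finally have 2: "\<bar>\<Sum>k\<in>UNIV. U k x * U a x * pd k \<psi> x\<bar> \<le> 3 * pressure_const * usq x" .
    have 3: "(\<Sum>i\<in>UNIV. \<bar>U i x\<bar>) * pressure_const \<le> 3 * pressure_const * (\<Sum>i\<in>UNIV. \<bar>U i x\<bar>)"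
      using mult_nonneg_nonneg[OF pressure_const(1), of "\<Sum>i\<in>UNIV. \<bar>U i x\<bar>"] by (simp add: sum_nonneg mult.commute)
    show "\<bar>U a x * (\<Sum>k\<in>UNIV. pd k (pd k \<psi>) x) + (\<Sum>k\<in>UNIV. U k x * U a x * pd k \<psi> x)\<bar>
      \<le> 3 * pressure_const * ((\<Sum>i\<in>UNIV. \<bar>U i x\<bar>) + usq x)"
      unfolding distrib_left using 1 2 3 by linarith
  next
    show "continuous_on UNIV (\<lambda>x. U a x * (\<Sum>k\<in>UNIV. pd k (pd k \<psi>) x) + (\<Sum>k\<in>UNIV. U k x * U a x * pd k \<psi> x))"
      unfolding p2 unfolding p1 by (intro continuous_intros continuous_U ct)
  qed (intro continuous_intros continuous_U continuous_usq)
  then show ?thesis by (simp add: K1_def)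
qed

text \<open>Mean value theorem on the segment from 0 to y. The 18 is 3 coordinates, each of size at
  most 2, times the 3 of the gradient bound.\<close>

lemma mollified_pressure_oscillation:
  assumes y: "y \<in> bx 2"
  shows "\<bar>cv P mollifier y - cv P mollifier 0\<bar> \<le> 18 * pressure_const * K1"
proof -
  have C1m: "Ck 1 mollifier" by (rule Ck_le[OF Ck_mollifier]) simp
  have der: "((\<lambda>t. cv P mollifier (t *\<^sub>R y)) has_real_derivative
      (\<Sum>j\<in>UNIV. y $ j * cv P (pd j mollifier) (t *\<^sub>R y))) (at t)" for t
  proof -
    have "((\<lambda>t. t *\<^sub>R y) has_derivative (\<lambda>s. s *\<^sub>R y)) (at t)"
      by (auto intro!: derivative_eq_intros)
    from has_derivative_compose[OF this conv_has_derivative[OF continuous_P C1m]]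
    show ?thesis
      unfolding has_field_derivative_def
      by (rule has_derivative_eq_rhs) (auto simp: sum_distrib_left mult_ac)
  qed
  obtain t where t: "0 < t" "t < 1" "cv P mollifier (1 *\<^sub>R y) - cv P mollifier (0 *\<^sub>R y)
     = (1 - 0) * (\<Sum>j\<in>UNIV. y $ j * cv P (pd j mollifier) (t *\<^sub>R y))"
    using MVT2[of 0 1 "\<lambda>t. cv P mollifier (t *\<^sub>R y)", OF _ der] by auto
  have "\<bar>t * y $ i\<bar> \<le> 2" for i
  proof -
    have "\<bar>t * y $ i\<bar> \<le> 1 * 2" unfolding abs_mult
      using t y by (intro mult_mono) (auto simp: mem_bx)
    then show ?thesis by simp
  qed
  then have ty: "t *\<^sub>R y \<in> bx 2" by (simp add: mem_bx)
  have "\<bar>\<Sum>j\<in>UNIV. y $ j * cv P (pd j mollifier) (t *\<^sub>R y)\<bar> \<le> (\<Sum>j\<in>(UNIV::3 set). 2 * (3 * pressure_const * K1))"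
  proof (rule order_trans[OF sum_abs sum_mono])
    fix j
    show "\<bar>y $ j * cv P (pd j mollifier) (t *\<^sub>R y)\<bar> \<le> 2 * (3 * pressure_const * K1)"
      unfolding abs_mult using y mollified_gradient_bound[OF ty] by (intro mult_mono) (auto simp: mem_bx)
  qed
  then show ?thesis using t(3) by simp
qed

text \<open>Let g be P minus its mean on \<open>bx 2\<close> and W the convolution of g with
  \<open>newton_diff e\<close>. Testing the pressure with the Laplacian of W compares two pairings
  of g: with P averaged at scale e, which gives nearly mu times the integral of g^2, and with P
  averaged at scale 1, which is nearly constant. The difference is the integral of u \<otimes> u
  against the Hessian of W, whose L^2 norm is bounded by that of g.\<close>

theorem pressure_estimate:
  "\<exists>c. integral (bx 2) (\<lambda>x. (P x - c)\<^sup>2) \<le> 256 * (18 * pressure_const * K1 / mu)\<^sup>2 + 8 * A4"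
proof -
  define c where "c = integral (bx 2) P / 64"
  define g where "g x = P x - c" for x
  define G where "G = integral (bx 2) (\<lambda>x. (g x)\<^sup>2)"
  define L where "L = integral (bx 2) (\<lambda>x. \<bar>g x\<bar>)"
  define H where "H = 18 * pressure_const * K1"
  interpret m: radial_kernel mollifier by (rule mollifier_kernel)
  have cg: "continuous_on UNIV g" unfolding g_def[abs_def] by (intro continuous_intros continuous_P)
  have g0: "integral (bx 2) g = 0"
  proof -
    have "integral (bx 2) g = integral (bx 2) P - integral (bx 2) (\<lambda>x. c)"
      unfolding g_def[abs_def] by (intro integral_diff continuous_integrable_cbox continuous_P continuous_intros)
    then show ?thesis by (simp add: content_bx c_def)
  qed
  have gP: "integral (bx 2) (\<lambda>x. g x * P x) = G"
  proof -
    have "integral (bx 2) (\<lambda>x. g x * P x) = integral (bx 2) (\<lambda>x. (g x)\<^sup>2 + c * g x)"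
      by (rule integral_cong) (simp add: g_def power2_eq_square algebra_simps)
    also have "\<dots> = G + c * integral (bx 2) g"
      unfolding G_def by (subst integral_add) (auto intro!: continuous_integrable_cbox continuous_intros cg)
    finally show ?thesis using g0 by simp
  qed
  have main: "mu * G \<le> t * mu * L + H * L + 2 * mu * A4 + mu / 2 * G" if t: "t > 0" for t
  proof -
    have "uniformly_continuous_on (bx 4) P"
      by (intro compact_uniformly_continuous continuous_P) simp
    then obtain d where d: "d > 0" "\<And>x y. x \<in> bx 4 \<Longrightarrow> y \<in> bx 4 \<Longrightarrow> dist y x < d \<Longrightarrow> dist (P y) (P x) < t"
      using t unfolding uniformly_continuous_on_def by metis
    \<comment> \<open>Uniform continuity makes P averaged at scale e, times mu, differ from mu P by
      at most t mu on \<open>bx 2\<close>; e then stays fixed and only t tends to 0.\<close>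
    define e where "e = min 1 (d / 2)"
    have e: "0 < e" "e \<le> 1" "e < d" using d(1) by (auto simp: e_def)
    interpret n: radial_kernel "mollifier_scaled e" by (rule mollifier_scaled_kernel[OF e(1,2)])
    have mass: "m.mass = mu" "n.mass = mu" using mass_mollifier mass_mollifier_scaled[OF e(1,2)] by auto
    let ?W = "conv (- (\<chi> i. 2)) (\<chi> i. 2) g (newton_diff e)"
    let ?cg = "conv (- (\<chi> i. 2)) (\<chi> i. 2) g"
    have W4: "Ck 4 ?W"
    proof -
      have "Suc 3 = 4" by simp
      from Ck_conv[OF cg, of 3 "newton_diff e", unfolded this, OF Ck_newton_diff] show ?thesis .
    qed
    have W: "Ck 3 ?W" "Ck 2 ?W" "Ck 1 ?W" "Ck 2 (pd j ?W)" "Ck 1 (pd j ?W)" "Ck 1 (pd i (pd j ?W))" for i j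
      by (rule Ck_le[OF W4], simp, rule Ck_le[OF W4], simp, rule Ck_le[OF W4], simp, rule Ck_pd, rule Ck_le[OF W4], simp,
          rule Ck_pd, rule Ck_le[OF W4], simp, rule Ck_pd, rule Ck_pd, rule Ck_le[OF W4], simp)
    have suppW: "?W x = 0" if x: "x \<notin> bx 4" for x
    proof -
      have "newton_diff e (x - y) = 0" if y: "y \<in> bx 2" for y
      proof (rule newton_diff_eq_0[OF e(1,2)], rule ccontr)
        assume "\<not> 1 \<le> norm (x - y)"
        then have "x \<in> bx (2 + 1)" by (intro bx_shift[OF y]) simp
        then show False using x bx_mono[of 3 4] by auto
      qed
      then have "?W x = integral (bx 2) (\<lambda>y. 0)" unfolding conv_def by (intro integral_cong) auto
      then show ?thesis by simp
    qed
    have supp1: "pd j ?W x = 0" if "x \<notin> bx 4" for j x by (rule pd_eq_0_outside_cbox[OF suppW that])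
    have nd1: "Ck 1 (newton_diff e)" "Ck 1 (pd j (newton_diff e))" for j
      by (rule Ck_le[OF Ck_newton_diff], simp, rule Ck_pd, rule Ck_le[OF Ck_newton_diff], simp)
    have cnd: "continuous_on UNIV (pd j (pd j (newton_diff e)))" for j using nd1(2)[of j] by simp
    have lapW: "(\<Sum>j\<in>UNIV. pd j (pd j ?W) x) = ?cg mollifier x - ?cg (mollifier_scaled e) x" for x
    proof -
      have "(\<Sum>j\<in>UNIV. pd j (pd j ?W) x) = (\<Sum>j\<in>UNIV. ?cg (pd j (pd j (newton_diff e))) x)"
        by (simp only: pd_conv[OF cg nd1(1)] pd_conv[OF cg nd1(2)])
      also have "\<dots> = integral (bx 2) (\<lambda>y. \<Sum>j\<in>UNIV. g y * pd j (pd j (newton_diff e)) (x - y))"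
        unfolding conv_def by (intro integral_sum[symmetric] finite conv_integrable cg cnd)
      also have "\<dots> = integral (bx 2) (\<lambda>y. g y * mollifier (x - y) - g y * mollifier_scaled e (x - y))"
        by (simp only: sum_distrib_left[symmetric] laplacian_newton_diff[OF e(1)] right_diff_distrib)
      also have "\<dots> = ?cg mollifier x - ?cg (mollifier_scaled e) x"
        unfolding conv_def by (intro integral_diff conv_integrable cg m.k_cont n.k_cont)
      finally show ?thesis .
    qed
    have cW: "continuous_on UNIV (pd i (pd j ?W))" for i j by (rule Ck_continuous[OF W(6)])
    have cPk: "continuous_on UNIV (cv P mollifier)" "continuous_on UNIV (cv P (mollifier_scaled e))"
      by (intro m.continuous_on_conv n.continuous_on_conv continuous_P)+
    have cgk: "continuous_on UNIV (?cg mollifier)" "continuous_on UNIV (?cg (mollifier_scaled e))"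
      by (intro m.continuous_on_conv n.continuous_on_conv cg)+
    \<comment> \<open>Both mollifiers have mass \<open>mu\<close>, so the Laplacian of W is bounded
      in L^2 independently of e.\<close>
    have hess: "(\<Sum>i\<in>UNIV. \<Sum>j\<in>UNIV. integral (bx 4) (\<lambda>x. (pd i (pd j ?W) x)\<^sup>2)) \<le> 4 * mu\<^sup>2 * G"
    proof -
      have "(\<Sum>i\<in>UNIV. \<Sum>j\<in>UNIV. integral (bx 4) (\<lambda>x. (pd i (pd j ?W) x)\<^sup>2))
        = integral (bx 4) (\<lambda>x. (?cg mollifier x - ?cg (mollifier_scaled e) x)\<^sup>2)"
        by (rule trans[OF hessian_energy[OF W(1)]], erule suppW) (simp only: lapW)
      also have "\<dots> \<le> integral (bx 4) (\<lambda>x. 2 * (?cg mollifier x)\<^sup>2 + 2 * (?cg (mollifier_scaled e) x)\<^sup>2)"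
      proof (intro integral_le continuous_integrable_cbox continuous_intros cgk)
        fix x
        have "0 \<le> (?cg mollifier x + ?cg (mollifier_scaled e) x)\<^sup>2" by simp
        then show "(?cg mollifier x - ?cg (mollifier_scaled e) x)\<^sup>2 \<le> 2 * (?cg mollifier x)\<^sup>2 + 2 * (?cg (mollifier_scaled e) x)\<^sup>2"
          by (simp add: power2_diff power2_sum)
      qed
      also have "\<dots> = 2 * integral (bx 4) (\<lambda>x. (?cg mollifier x)\<^sup>2) + 2 * integral (bx 4) (\<lambda>x. (?cg (mollifier_scaled e) x)\<^sup>2)"
        by (subst integral_add) (auto intro!: continuous_integrable_cbox continuous_intros cgk)
      also have "\<dots> \<le> 2 * (mu\<^sup>2 * G) + 2 * (mu\<^sup>2 * G)"
        using m.integral_conv_square_le[OF cg] n.integral_conv_square_le[OF cg]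
        unfolding G_def mass by (intro add_mono mult_left_mono) auto
      finally show ?thesis by linarith
    qed
    \<comment> \<open>As the kernels are even, both mollifications can be moved from P to g, where
      they form the Laplacian of W; one integration by parts then brings in the momentum
      equation.\<close>
    have flux: "integral (bx 2) (\<lambda>y. g y * cv P (mollifier_scaled e) y) - integral (bx 2) (\<lambda>y. g y * cv P mollifier y)
      = integral (bx 4) (\<lambda>x. \<Sum>a\<in>UNIV. \<Sum>k\<in>UNIV. U k x * U a x * pd k (pd a ?W) x)"
    proof -
      have wm: "integral (bx 4) (\<lambda>x. pd a P x * pd a ?W x) =
          integral (bx 4) (\<lambda>x. U a x * (\<Sum>k\<in>UNIV. pd k (pd k (pd a ?W)) x))
          + integral (bx 4) (\<lambda>x. \<Sum>k\<in>UNIV. U k x * U a x * pd k (pd a ?W) x)" for a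
        by (rule weak_momentum[OF W(4)]) (rule supp1)
      have "integral (bx 2) (\<lambda>y. g y * cv P mollifier y) - integral (bx 2) (\<lambda>y. g y * cv P (mollifier_scaled e) y)
        = integral (bx 4) (\<lambda>x. P x * ?cg mollifier x) - integral (bx 4) (\<lambda>x. P x * ?cg (mollifier_scaled e) x)"
        by (simp only: m.integral_conv_swap[OF continuous_P cg] n.integral_conv_swap[OF continuous_P cg])
      also have "\<dots> = integral (bx 4) (\<lambda>x. P x * ?cg mollifier x - P x * ?cg (mollifier_scaled e) x)"
        by (intro integral_diff[symmetric] continuous_integrable_cbox continuous_intros continuous_P cgk)
      also have "\<dots> = integral (bx 4) (\<lambda>x. \<Sum>a\<in>UNIV. P x * pd a (pd a ?W) x)"
        by (simp only: sum_distrib_left[symmetric] lapW right_diff_distrib)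
      also have "\<dots> = (\<Sum>a\<in>UNIV. integral (bx 4) (\<lambda>x. P x * pd a (pd a ?W) x))"
        by (intro integral_sum finite continuous_integrable_cbox continuous_intros continuous_P cW)
      also have "\<dots> = (\<Sum>a\<in>UNIV. - integral (bx 4) (\<lambda>x. pd a P x * pd a ?W x))"
        by (intro sum.cong refl integral_by_parts_pd smooth_Ck smooth_P W disjI2 supp1)
      also have "\<dots> = - (\<Sum>a\<in>UNIV. integral (bx 4) (\<lambda>x. U a x * (\<Sum>k\<in>UNIV. pd k (pd k (pd a ?W)) x))
          + integral (bx 4) (\<lambda>x. \<Sum>k\<in>UNIV. U k x * U a x * pd k (pd a ?W) x))"
        by (simp only: sum_negf wm)
      also have "\<dots> = - (\<Sum>a\<in>UNIV. integral (bx 4) (\<lambda>x. U a x * (\<Sum>k\<in>UNIV. pd k (pd k (pd a ?W)) x)))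
          - (\<Sum>a\<in>UNIV. integral (bx 4) (\<lambda>x. \<Sum>k\<in>UNIV. U k x * U a x * pd k (pd a ?W) x))"
        by (simp add: sum.distrib)
      \<comment> \<open>The viscous part pairs u with the gradient of the Laplacian of W and
        vanishes by incompressibility.\<close>
      also have "(\<Sum>a\<in>UNIV. integral (bx 4) (\<lambda>x. U a x * (\<Sum>k\<in>UNIV. pd k (pd k (pd a ?W)) x))) = 0"
      proof -
        define D where "D = (\<lambda>x. \<Sum>k\<in>UNIV. pd k (pd k ?W) x)"
        have D1: "Ck 1 D" unfolding D_def by (intro Ck_sum W)
        have pdD: "pd a D x = (\<Sum>k\<in>UNIV. pd k (pd k (pd a ?W)) x)" for a x
        proof -
          have "(D has_derivative (\<lambda>h. \<Sum>k\<in>UNIV. frechet_derivative (pd k (pd k ?W)) (at x) h)) (at x)"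
            unfolding D_def
            using W(6) by (intro has_derivative_sum iffD1[OF frechet_derivative_works] Ck_differentiable[of 0]) simp
          from pd_eq[OF this] have "pd a D x = (\<Sum>k\<in>UNIV. pd a (pd k (pd k ?W)) x)" by (simp add: pd_def)
          also have "\<dots> = (\<Sum>k\<in>UNIV. pd k (pd k (pd a ?W)) x)"
            using pd_commute[OF W(2)] pd_commute[OF W(4)] by (intro sum.cong refl) metis
          finally show ?thesis .
        qed
        have suppD: "D x = 0" if "x \<notin> bx 4" for x
          using pd_eq_0_outside_cbox[OF supp1 that] by (simp add: D_def)
        have cD: "continuous_on UNIV D" by (rule Ck_continuous[OF D1])
        have "(\<Sum>a\<in>UNIV. integral (bx 4) (\<lambda>x. U a x * (\<Sum>k\<in>UNIV. pd k (pd k (pd a ?W)) x)))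
          = (\<Sum>a\<in>UNIV. - integral (bx 4) (\<lambda>x. pd a (U a) x * D x))"
          unfolding pdD[symmetric]
          by (intro sum.cong refl integral_by_parts_pd smooth_Ck smooth_U D1) (simp add: suppD)
        also have "\<dots> = - integral (bx 4) (\<lambda>x. \<Sum>a\<in>UNIV. pd a (U a) x * D x)"
          unfolding sum_negf
          by (rule arg_cong[of _ _ uminus], intro integral_sum[symmetric] finite continuous_integrable_cbox
              continuous_intros cD smooth_continuous smooth_pd smooth_U)
        also have "\<dots> = 0" by (simp add: sum_distrib_right[symmetric] incompressible)
        finally show ?thesis .
      qed
      finally have "integral (bx 2) (\<lambda>y. g y * cv P (mollifier_scaled e) y) - integral (bx 2) (\<lambda>y. g y * cv P mollifier y)
        = (\<Sum>a\<in>UNIV. integral (bx 4) (\<lambda>x. \<Sum>k\<in>UNIV. U k x * U a x * pd k (pd a ?W) x))" by simp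
      also have "\<dots> = integral (bx 4) (\<lambda>x. \<Sum>a\<in>UNIV. \<Sum>k\<in>UNIV. U k x * U a x * pd k (pd a ?W) x)"
        by (intro integral_sum[symmetric] finite continuous_integrable_cbox continuous_intros continuous_U cW)
      finally show ?thesis .
    qed
    \<comment> \<open>The weights 2 mu and 1 / (8 mu) turn the Hessian bound 4 mu^2 G into mu / 2 G,
      half of the left side of \<open>main\<close>.\<close>
    have I1: "integral (bx 4) (\<lambda>x. \<Sum>a\<in>UNIV. \<Sum>k\<in>UNIV. U k x * U a x * pd k (pd a ?W) x) \<le> 2 * mu * A4 + mu / 2 * G"
    proof -
      have "integral (bx 4) (\<lambda>x. \<Sum>a\<in>UNIV. \<Sum>k\<in>UNIV. U k x * U a x * pd k (pd a ?W) x)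
        \<le> integral (bx 4) (\<lambda>x. 2 * mu * (usq x)\<^sup>2 + 1 / (8 * mu) * (\<Sum>a\<in>UNIV. \<Sum>k\<in>UNIV. (pd k (pd a ?W) x)\<^sup>2))"
      proof (intro integral_le continuous_integrable_cbox continuous_intros continuous_U cW continuous_usq)
        fix x
        have y: "p * q \<le> 2 * mu * p\<^sup>2 + 1 / (8 * mu) * q\<^sup>2" for p q :: real
        proof -
          have "0 \<le> (4 * mu * p - q)\<^sup>2 / (8 * mu)" using mu_pos by simp
          also have "\<dots> = 2 * mu * p\<^sup>2 + 1 / (8 * mu) * q\<^sup>2 - p * q"
            using mu_pos by (simp add: power2_diff field_simps power2_eq_square)
          finally show ?thesis by simp
        qed
        have "(\<Sum>a\<in>UNIV. \<Sum>k\<in>UNIV. U k x * U a x * pd k (pd a ?W) x)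
          \<le> (\<Sum>a\<in>UNIV. \<Sum>k\<in>UNIV. 2 * mu * (U k x * U a x)\<^sup>2 + 1 / (8 * mu) * (pd k (pd a ?W) x)\<^sup>2)"
          by (intro sum_mono y)
        also have "\<dots> = 2 * mu * (usq x)\<^sup>2 + 1 / (8 * mu) * (\<Sum>a\<in>UNIV. \<Sum>k\<in>UNIV. (pd k (pd a ?W) x)\<^sup>2)"
          unfolding usq_def power2_eq_square[of "\<Sum>i\<in>UNIV. (U i x)\<^sup>2"] sum_product
          by (simp add: sum.distrib sum_distrib_left power_mult_distrib mult.commute)
        finally show "(\<Sum>a\<in>UNIV. \<Sum>k\<in>UNIV. U k x * U a x * pd k (pd a ?W) x) \<le> \<dots>" .
      qed
      also have "\<dots> = 2 * mu * A4 + 1 / (8 * mu) * (\<Sum>a\<in>UNIV. \<Sum>k\<in>UNIV. integral (bx 4) (\<lambda>x. (pd k (pd a ?W) x)\<^sup>2))"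
      proof -
        have "integral (bx 4) (\<lambda>x. \<Sum>a\<in>UNIV. \<Sum>k\<in>UNIV. (pd k (pd a ?W) x)\<^sup>2)
          = (\<Sum>a\<in>UNIV. integral (bx 4) (\<lambda>x. \<Sum>k\<in>UNIV. (pd k (pd a ?W) x)\<^sup>2))"
          by (intro integral_sum finite continuous_integrable_cbox continuous_intros cW)
        also have "\<dots> = (\<Sum>a\<in>UNIV. \<Sum>k\<in>UNIV. integral (bx 4) (\<lambda>x. (pd k (pd a ?W) x)\<^sup>2))"
          by (intro sum.cong refl integral_sum finite continuous_integrable_cbox continuous_intros cW)
        finally show ?thesis unfolding A4_def
          using mu_pos
          by (subst integral_add) (auto intro!: continuous_integrable_cbox continuous_intros cW continuous_usq)
      qed
      finally have "integral (bx 4) (\<lambda>x. \<Sum>a\<in>UNIV. \<Sum>k\<in>UNIV. U k x * U a x * pd k (pd a ?W) x)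
        \<le> 2 * mu * A4 + 1 / (8 * mu) * (\<Sum>a\<in>UNIV. \<Sum>k\<in>UNIV. integral (bx 4) (\<lambda>x. (pd k (pd a ?W) x)\<^sup>2))" .
      moreover have "1 / (8 * mu) * (\<Sum>a\<in>UNIV. \<Sum>k\<in>UNIV. integral (bx 4) (\<lambda>x. (pd k (pd a ?W) x)\<^sup>2))
          \<le> 1 / (8 * mu) * (4 * mu\<^sup>2 * G)"
        using hess mu_pos by (subst sum.swap) (intro mult_left_mono, auto)
      moreover have "1 / (8 * mu) * (4 * mu\<^sup>2 * G) = mu / 2 * G"
        using mu_pos by (simp add: power2_eq_square)
      ultimately show ?thesis by linarith
    qed
    \<comment> \<open>As g has mean zero, only the oscillation of the averaged pressure
      counts.\<close>
    have I2: "integral (bx 2) (\<lambda>y. g y * cv P mollifier y) \<le> H * L"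
    proof -
      let ?r = "cv P mollifier 0"
      have "integral (bx 2) (\<lambda>y. g y * cv P mollifier y) = integral (bx 2) (\<lambda>y. g y * (cv P mollifier y - ?r) + ?r * g y)"
        by (rule integral_cong) (simp add: algebra_simps)
      also have "\<dots> = integral (bx 2) (\<lambda>y. g y * (cv P mollifier y - ?r)) + ?r * integral (bx 2) g"
        by (subst integral_add) (auto intro!: continuous_integrable_cbox continuous_intros cg cPk)
      also have "\<dots> \<le> integral (bx 2) (\<lambda>y. H * \<bar>g y\<bar>)"
        unfolding g0 mult_zero_right add_0_right
      proof (intro integral_le continuous_integrable_cbox continuous_intros cg cPk)
        fix y assume "y \<in> bx 2"
        then have "\<bar>g y * (cv P mollifier y - ?r)\<bar> \<le> \<bar>g y\<bar> * H"
          unfolding abs_mult H_def by (intro mult_left_mono mollified_pressure_oscillation) auto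
        then show "g y * (cv P mollifier y - ?r) \<le> H * \<bar>g y\<bar>" by (simp add: mult.commute)
      qed
      finally show ?thesis by (simp add: L_def)
    qed
    have I3: "mu * G - t * mu * L \<le> integral (bx 2) (\<lambda>y. g y * cv P (mollifier_scaled e) y)"
    proof -
      have near: "\<bar>cv P (mollifier_scaled e) y - mu * P y\<bar> \<le> t * mu" if y: "y \<in> bx 2" for y
      proof -
        have tr: "integral (bx 4) (\<lambda>x. mollifier_scaled e (y - x)) = mu"
          using n.integral_translate_eq[of y 3] bx_mono[of 2 3] y n.k_commute[of y] mass by auto
        have "cv P (mollifier_scaled e) y - mu * P y
          = integral (bx 4) (\<lambda>x. P x * mollifier_scaled e (y - x)) - integral (bx 4) (\<lambda>x. P y * mollifier_scaled e (y - x))"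
          by (simp add: conv_def tr[symmetric] mult.commute)
        also have "\<dots> = integral (bx 4) (\<lambda>x. P x * mollifier_scaled e (y - x) - P y * mollifier_scaled e (y - x))"
          by (intro integral_diff[symmetric] conv_integrable n.k_cont continuous_P continuous_intros)
        finally have eq: "cv P (mollifier_scaled e) y - mu * P y = \<dots>" .
        have "\<bar>cv P (mollifier_scaled e) y - mu * P y\<bar> \<le> integral (bx 4) (\<lambda>x. t * mollifier_scaled e (y - x))"
          unfolding eq
        proof (rule integral_abs_le)
          fix x assume x: "x \<in> bx 4"
          show "\<bar>P x * mollifier_scaled e (y - x) - P y * mollifier_scaled e (y - x)\<bar> \<le> t * mollifier_scaled e (y - x)"
          proof (cases "norm (y - x) \<ge> e")
            case True
            then show ?thesis by (simp add: mollifier_scaled_eq_0[OF e(1)])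
          next
            case False
            then have "dist (P y) (P x) < t" 
              using x y bx_mono[of 2 4] e(3) by (intro d) (auto simp: dist_norm)
            then have "\<bar>P x - P y\<bar> * mollifier_scaled e (y - x) \<le> t * mollifier_scaled e (y - x)"
              by (intro mult_right_mono n.k_nonneg) (simp add: dist_real_def abs_minus_commute)
            then show ?thesis
              by (simp add: left_diff_distrib[symmetric] abs_mult n.k_nonneg)
          qed
        qed (intro continuous_intros continuous_P continuous_on_translate n.k_cont)+
        then show ?thesis using tr by simp
      qed
      have "mu * G - t * mu * L = integral (bx 2) (\<lambda>y. mu * (g y * P y) - t * mu * \<bar>g y\<bar>)"
        unfolding gP[symmetric] L_def
        by (subst integral_diff) (auto intro!: continuous_integrable_cbox continuous_intros cg continuous_P)
      also have "\<dots> \<le> integral (bx 2) (\<lambda>y. g y * cv P (mollifier_scaled e) y)"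
      proof (intro integral_le continuous_integrable_cbox continuous_intros cg cPk continuous_P)
        fix y assume "y \<in> bx 2"
        then have "\<bar>g y * (cv P (mollifier_scaled e) y - mu * P y)\<bar> \<le> \<bar>g y\<bar> * (t * mu)"
          unfolding abs_mult by (intro mult_left_mono near) auto
        then show "mu * (g y * P y) - t * mu * \<bar>g y\<bar> \<le> g y * cv P (mollifier_scaled e) y"
          by (simp add: algebra_simps abs_le_iff)
      qed
      finally show ?thesis .
    qed
    show ?thesis using flux I1 I2 I3 by linarith
  qed
  have "G \<le> 256 * (t + H / mu)\<^sup>2 + 8 * A4" if t: "t > 0" for t
  proof -
    define s where "s = t * mu + H"
    \<comment> \<open>The 64 is the volume of \<open>bx 2\<close>. After this second absorption mu /
      4 G is left on the other side.\<close>
    have sL: "s * L \<le> mu / 4 * G + 64 * s\<^sup>2 / mu"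
    proof -
      have "s * L = integral (bx 2) (\<lambda>x. s * \<bar>g x\<bar>)" by (simp add: L_def)
      also have "\<dots> \<le> integral (bx 2) (\<lambda>x. mu / 4 * (g x)\<^sup>2 + s\<^sup>2 / mu)"
      proof (intro integral_le continuous_integrable_cbox continuous_intros cg)
        fix x
        have "0 \<le> (mu * \<bar>g x\<bar> / 2 - s)\<^sup>2 / mu" using mu_pos by simp
        also have "\<dots> = mu / 4 * (g x)\<^sup>2 + s\<^sup>2 / mu - s * \<bar>g x\<bar>"
          using mu_pos by (simp add: power2_diff field_simps power2_eq_square)
        finally show "s * \<bar>g x\<bar> \<le> mu / 4 * (g x)\<^sup>2 + s\<^sup>2 / mu" by simp
      qed
      also have "\<dots> = mu / 4 * G + 64 * s\<^sup>2 / mu"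
        unfolding G_def by (subst integral_add) (auto intro!: continuous_integrable_cbox continuous_intros cg simp: content_bx)
      finally show ?thesis .
    qed
    have "s * L = t * mu * L + H * L" by (simp add: s_def algebra_simps)
    with main[OF t] sL have "mu / 4 * G \<le> 64 * s\<^sup>2 / mu + 2 * mu * A4" by simp
    then have "4 / mu * (mu / 4 * G) \<le> 4 / mu * (64 * s\<^sup>2 / mu + 2 * mu * A4)"
      using mu_pos by (intro mult_left_mono) auto
    also have "\<dots> = 256 * (s / mu)\<^sup>2 + 8 * A4"
      using mu_pos by (simp add: field_simps power2_eq_square)
    also have "s / mu = t + H / mu" using mu_pos by (simp add: s_def field_simps)
    finally show ?thesis using mu_pos by simp
  qed
  from le_quadratic_limit[OF this] show ?thesis
    unfolding G_def g_def H_def by blast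
qed

end

section \<open>The head pressure\<close>

lemma smooth_pd_mult:
  fixes f g :: "real^'n::finite \<Rightarrow> real"
  shows "smooth f \<Longrightarrow> smooth g \<Longrightarrow> pd j (\<lambda>x. f x * g x) = (\<lambda>x. pd j f x * g x + f x * pd j g x)"
  by (rule ext, rule pd_mult) (auto intro: smooth_differentiable)

lemma smooth_pd_add:
  "smooth f \<Longrightarrow> smooth g \<Longrightarrow> pd j (\<lambda>x. f x + g x) = (\<lambda>x. pd j f x + pd j g x)"
  by (rule ext, rule pd_add) (auto intro: smooth_differentiable)

lemma smooth_pd_cmult:
  fixes f :: "real^'n::finite \<Rightarrow> real"
  shows "smooth f \<Longrightarrow> pd j (\<lambda>x. c * f x) = (\<lambda>x. c * pd j f x)"
  by (rule ext, rule pd_linear[OF bounded_linear_mult_right]) (auto intro: smooth_differentiable)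

lemma smooth_pd_diff:
  fixes f g :: "real^'n::finite \<Rightarrow> real"
  shows "smooth f \<Longrightarrow> smooth g \<Longrightarrow> pd j (\<lambda>x. f x - g x) = (\<lambda>x. pd j f x - pd j g x)"
  using smooth_pd_add[of f "\<lambda>x. (-1) * g x" j] smooth_pd_cmult[of g j "-1"]
  by (simp add: smooth_intros)

lemma pd_const: "pd j (\<lambda>x::real^'n::finite. c) = (\<lambda>x. 0)"
  by (rule ext) (simp add: pd_eq[OF has_derivative_const])

lemma smooth_pd_sum:
  fixes f :: "'i \<Rightarrow> real^'n::finite \<Rightarrow> real"
  shows "finite A \<Longrightarrow> (\<And>i. i \<in> A \<Longrightarrow> smooth (f i)) \<Longrightarrow> pd j (\<lambda>x. \<Sum>i\<in>A. f i x) = (\<lambda>x. \<Sum>i\<in>A. pd j (f i) x)"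
  by (induction A rule: finite_induct) (auto simp: pd_const smooth_pd_add smooth_sum)

lemma smooth_pd_commute: "smooth f \<Longrightarrow> pd i (pd j f) = pd j (pd i f)" for f :: "real^'n::finite \<Rightarrow> real"
  by (rule pd_commute[OF smooth_Ck])

section \<open>The cutoff and the growth of the weight\<close>

definition cutoff :: "real^3 \<Rightarrow> real" where "cutoff x = bump_fun 1 (4 - sqn x)"

text \<open>For the square, |\<nabla>\<open>cutoff2\<close>|^2 is at most a multiple of
  \<open>cutoff2\<close>, so terms with the gradient of the cutoff can be absorbed in terms with the
  cutoff itself.\<close>

definition cutoff2 :: "real^3 \<Rightarrow> real" where "cutoff2 x = cutoff x * cutoff x"

lemma smooth_cutoff: "smooth cutoff"
  unfolding cutoff_def[abs_def] by (intro smooth_bump_fun smooth_intros smooth_sqn)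

lemma smooth_cutoff2: "smooth cutoff2"
  unfolding cutoff2_def[abs_def] by (intro smooth_intros smooth_cutoff)

lemma cutoff_eq_0: "x \<notin> bx 2 \<Longrightarrow> cutoff x = 0"
proof -
  assume "x \<notin> bx 2"
  then obtain i where "\<bar>x $ i\<bar> > 2" by (auto simp: mem_bx not_le)
  then have "(2::real)\<^sup>2 \<le> \<bar>x $ i\<bar>\<^sup>2" by (intro power_mono) auto
  also have "\<bar>x $ i\<bar>\<^sup>2 \<le> sqn x" unfolding sqn_def power2_abs by (rule member_le_sum) auto
  finally show ?thesis by (simp add: cutoff_def bump_fun_def)
qed

lemma cutoff2_eq_0: "x \<notin> bx 2 \<Longrightarrow> cutoff2 x = 0"
  by (simp add: cutoff2_def cutoff_eq_0)

lemma cutoff2_nonneg: "cutoff2 x \<ge> 0"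
  by (simp add: cutoff2_def)

lemma cutoff2_ge:
  assumes "norm x \<le> 1"
  shows "exp (- 1) \<le> cutoff2 x"
proof -
  have s: "sqn x \<le> 1" using assms by (simp add: sqn_norm power_le_one)
  then have "- 1 / 3 \<le> - 1 / (4 - sqn x)" by (simp add: field_simps)
  then have "exp (- 1 / 3) \<le> cutoff x" using s by (simp add: cutoff_def bump_fun_def)
  then have "exp (- 1 / 3) * exp (- 1 / 3) \<le> cutoff2 x" unfolding cutoff2_def
    by (intro mult_mono) (auto simp: cutoff_def bump_fun_def)
  moreover have "exp (- 1) \<le> exp (- 1 / 3) * exp (- 1 / 3 :: real)" by (simp flip: exp_add)
  ultimately show ?thesis by linarith
qed

lemma pd_cutoff2: "pd k cutoff2 x = 2 * cutoff x * pd k cutoff x"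
  using smooth_pd_mult[OF smooth_cutoff smooth_cutoff, of k] by (simp add: cutoff2_def[abs_def])

lemma cutoff_bounds: "\<exists>N\<ge>0. (\<forall>k x. \<bar>pd k cutoff x\<bar> \<le> N) \<and> (\<forall>j k x. \<bar>pd j (pd k cutoff2) x\<bar> \<le> N)"
proof -
  have s1: "pd k cutoff x = 0" if "x \<notin> bx 2" for k x by (rule pd_eq_0_outside_cbox[OF cutoff_eq_0 that])
  have t1: "pd k cutoff2 x = 0" if "x \<notin> bx 2" for k x by (rule pd_eq_0_outside_cbox[OF cutoff2_eq_0 that])
  have t2: "pd j (pd k cutoff2) x = 0" if "x \<notin> bx 2" for j k x by (rule pd_eq_0_outside_cbox[OF t1 that])
  have "\<exists>C\<ge>0. \<forall>x. \<bar>pd k cutoff x\<bar> \<le> C" for k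
    by (rule compact_support_bounded[OF smooth_continuous[OF smooth_pd[OF smooth_cutoff]] s1])
  then obtain D where D: "\<And>k. D k \<ge> 0" "\<And>k x. \<bar>pd k cutoff x\<bar> \<le> D k" by metis
  have "\<exists>C\<ge>0. \<forall>x. \<bar>pd j (pd k cutoff2) x\<bar> \<le> C" for j k
    by (rule compact_support_bounded[OF smooth_continuous[OF smooth_pd[OF smooth_pd[OF smooth_cutoff2]]] t2])
  then obtain E where E: "\<And>j k. E j k \<ge> 0" "\<And>j k x. \<bar>pd j (pd k cutoff2) x\<bar> \<le> E j k" by metis
  let ?N = "sum D UNIV + (\<Sum>j\<in>UNIV. \<Sum>k\<in>UNIV. E j k)"
  have D': "D k \<le> sum D UNIV" for k by (rule member_le_sum) (auto simp: D)
  have E': "E j k \<le> (\<Sum>j\<in>UNIV. \<Sum>k\<in>UNIV. E j k)" for j k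
  proof -
    have "E j k \<le> (\<Sum>k\<in>UNIV. E j k)" by (rule member_le_sum) (auto simp: E)
    also have "\<dots> \<le> (\<Sum>j\<in>UNIV. \<Sum>k\<in>UNIV. E j k)"
      by (rule member_le_sum[of j UNIV "\<lambda>j. \<Sum>k\<in>UNIV. E j k"]) (auto simp: E intro: sum_nonneg)
    finally show ?thesis .
  qed
  have "0 \<le> sum D UNIV" "0 \<le> (\<Sum>j\<in>UNIV. \<Sum>k\<in>UNIV. E j k)" by (auto intro!: sum_nonneg D E)
  moreover have "\<bar>pd k cutoff x\<bar> \<le> ?N" for k x
    using D(2)[of k x] D'[of k] calculation by linarith
  moreover have "\<bar>pd j (pd k cutoff2) x\<bar> \<le> ?N" for j k x
    using E(2)[of j k x] E'[of j k] calculation by linarith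
  ultimately show ?thesis by (intro exI[of _ ?N]) auto
qed

text \<open>Like \<open>pressure_const\<close>, chosen independently of the solution.\<close>

definition cutoff_const :: real where
  "cutoff_const = (SOME N. N \<ge> 0 \<and> (\<forall>k x. \<bar>pd k cutoff x\<bar> \<le> N) \<and> (\<forall>j k x. \<bar>pd j (pd k cutoff2) x\<bar> \<le> N))"

lemma cutoff_const: "cutoff_const \<ge> 0" "\<bar>pd k cutoff x\<bar> \<le> cutoff_const" "\<bar>pd j (pd k cutoff2) x\<bar> \<le> cutoff_const"
  using someI_ex[OF cutoff_bounds] unfolding cutoff_const_def by auto

text \<open>The growth \<open>H^2 / H' = O(S^3)\<close> with \<open>S^4 = 1 + t^2\<close> is the one that \<open>BMO_pairing\<close> can absorb.\<close>

definition weight :: "real \<Rightarrow> real" where "weight t = 1 + sqrt (t + sqrt (1 + t\<^sup>2))"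

definition weight' :: "real \<Rightarrow> real" where "weight' t = sqrt (t + sqrt (1 + t\<^sup>2)) / (2 * sqrt (1 + t\<^sup>2))"

lemma weight_base_pos: "t + sqrt (1 + t\<^sup>2) > 0"
proof -
  have "\<bar>t\<bar> < sqrt (1 + t\<^sup>2)" by (rule real_less_rsqrt) simp
  then show ?thesis by linarith
qed

lemma weight_ge_1: "weight t \<ge> 1"
  using weight_base_pos[of t] by (simp add: weight_def)

lemma weight_deriv: "(weight has_real_derivative weight' t) (at t)"
proof -
  let ?r = "sqrt (1 + t\<^sup>2)" and ?b = "t + sqrt (1 + t\<^sup>2)"
  have t2: "1 + t\<^sup>2 > 0" by (rule add_pos_nonneg) auto
  then have r: "?r > 0" by simp
  have r1: "((\<lambda>t. sqrt (1 + t\<^sup>2)) has_real_derivative t / ?r) (at t)"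
    using t2 by (auto intro!: derivative_eq_intros simp: field_simps)
  have "((\<lambda>t. t + sqrt (1 + t\<^sup>2)) has_real_derivative ?b / ?r) (at t)"
    using DERIV_add[OF DERIV_ident r1] r by (simp add: field_simps)
  from DERIV_chain2[OF DERIV_real_sqrt[OF weight_base_pos] this]
  have "((\<lambda>t. sqrt (t + sqrt (1 + t\<^sup>2))) has_real_derivative inverse (sqrt ?b) / 2 * (?b / ?r)) (at t)" .
  moreover have "inverse (sqrt ?b) / 2 * (?b / ?r) = weight' t"
  proof -
    have "?b = sqrt ?b * sqrt ?b" using weight_base_pos[of t] by simp
    then have "inverse (sqrt ?b) * ?b = sqrt ?b" using weight_base_pos[of t]
      by (metis divide_inverse_commute real_div_sqrt less_imp_le)
    moreover have "inverse s / 2 * (b / r) = (inverse s * b) / (2 * r)" for s b r :: real by simp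
    ultimately show ?thesis by (simp only: weight'_def)
  qed
  ultimately have "((\<lambda>t. sqrt (t + sqrt (1 + t\<^sup>2))) has_real_derivative weight' t) (at t)" by simp
  from DERIV_add[OF DERIV_const[of 1] this] show ?thesis by (simp add: weight_def[abs_def])
qed

text \<open>With x and y the square roots of b = t + r and r = sqrt(1 + t^2), the claim is (1 + x)^2
  \<le> 5 x y. Here b (r - t) = 1 bounds x y from below, b \<le> 2 r bounds x by a multiple of y,
  and y \<ge> 1; the 3/2 is a rational substitute for the square root of 2. As t tends to minus
  infinity x y stays bounded, so there the estimate has only a constant to spare.\<close>

lemma weight_growth: "(weight t)\<^sup>2 \<le> 10 * weight' t * sqrt (sqrt (1 + t\<^sup>2)) ^ 3"
proof -
  define r where "r = sqrt (1 + t\<^sup>2)"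
  define b where "b = t + r"
  have b: "b > 0" using weight_base_pos[of t] by (simp add: b_def r_def)
  have r: "r \<ge> 1" by (simp add: r_def)
  have tr: "\<bar>t\<bar> \<le> r" by (simp add: r_def real_le_rsqrt)
  have rr: "r * r = 1 + t\<^sup>2" by (simp add: r_def)
  have b2: "b \<le> 2 * r" using tr by (simp add: b_def)
  have "b * (r - t) = 1" using rr by (simp add: b_def algebra_simps power2_eq_square)
  moreover have "b * (r - t) \<le> b * (2 * r)" using tr b by (intro mult_left_mono) auto
  ultimately have br: "1 \<le> b * (2 * r)" by simp
  define x where "x = sqrt b"
  define y where "y = sqrt r"
  have x: "x > 0" "x * x = b" using b by (auto simp: x_def)
  have y: "y \<ge> 1" "y * y = r" using r by (auto simp: y_def)
  have "1 \<le> (3/2 * (x * y))\<^sup>2"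
  proof -
    have "1 \<le> 2 * ((x * x) * (y * y))" using br x y by simp
    also have "\<dots> \<le> (3/2 * (x * y))\<^sup>2"
      using mult_nonneg_nonneg[of "x * x" "y * y"] by (simp add: power2_eq_square algebra_simps)
    finally show ?thesis .
  qed
  then have i1: "1 \<le> 3/2 * (x * y)" using x y by (intro power2_le_imp_le[of 1]) auto
  have "x\<^sup>2 \<le> (3/2 * y)\<^sup>2" using b2 x y r by (simp add: power2_eq_square)
  then have "x \<le> 3/2 * y" using y by (intro power2_le_imp_le[of x]) auto
  then have "x * x \<le> x * (3/2 * y)" using x by (intro mult_left_mono) auto
  then have i2: "x * x \<le> 3/2 * (x * y)" by (simp only: mult.left_commute mult.assoc)
  have i3: "x \<le> x * y" using x y by simp
  have "(1 + x)\<^sup>2 = 1 + 2 * x + x * x" by (simp add: power2_eq_square algebra_simps)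
  also have "\<dots> \<le> 5 * (x * y)" using i1 i2 i3 by linarith
  also have "\<dots> = 10 * (x / (2 * r)) * y ^ 3"
    using y r by (simp add: power3_eq_cube field_simps) 
  finally show ?thesis
    unfolding weight_def weight'_def x_def y_def b_def r_def .
qed

lemma smooth_weight:
  fixes f :: "real^'n::finite \<Rightarrow> real"
  assumes "smooth f"
  shows "smooth (\<lambda>x. weight (f x))"
proof -
  have "smooth (\<lambda>x. sqrt (1 + (f x)\<^sup>2))"
    by (intro smooth_sqrt smooth_intros assms add_pos_nonneg) auto
  from smooth_sqrt[OF smooth_intros(3)[OF assms this] weight_base_pos]
  show ?thesis unfolding weight_def by (rule smooth_intros(3)[OF smooth_intros(1)])
qed

section \<open>The equation of the head pressure\<close>

context stationary_NS
begin

lemma smooth_pdU: "smooth (pd k (U i))" "smooth (pd j (pd k (U i)))" "smooth (pd k P)"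
  by (intro smooth_pd smooth_U smooth_P)+

lemma div_pd: "(\<Sum>a\<in>UNIV. pd j (pd a (U a)) x) = 0" "(\<Sum>a\<in>UNIV. pd k (pd j (pd a (U a))) x) = 0"
proof -
  have e0: "(\<lambda>x. \<Sum>a\<in>UNIV. pd a (U a) x) = (\<lambda>x. 0)" using incompressible by auto
  have e1: "(\<lambda>x. \<Sum>a\<in>UNIV. pd j (pd a (U a)) x) = (\<lambda>x. 0)" for j
    using smooth_pd_sum[of UNIV "\<lambda>a. pd a (U a)" j] smooth_pdU by (simp add: e0 pd_const)
  show "(\<Sum>a\<in>UNIV. pd j (pd a (U a)) x) = 0" using e1 by meson
  have "(\<lambda>x. \<Sum>a\<in>UNIV. pd k (pd j (pd a (U a))) x) = (\<lambda>x. 0)"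
    using smooth_pd_sum[of UNIV "\<lambda>a. pd j (pd a (U a))" k] smooth_pdU by (simp add: e1 pd_const)
  then show "(\<Sum>a\<in>UNIV. pd k (pd j (pd a (U a))) x) = 0" by meson
qed

definition Phi :: "real^3 \<Rightarrow> real" where "Phi x = 1/2 * usq x + P x"

definition grad_sq :: "real^3 \<Rightarrow> real" where "grad_sq x = (\<Sum>k\<in>UNIV. \<Sum>i\<in>UNIV. (pd k (U i) x)\<^sup>2)"

definition grad_cross :: "real^3 \<Rightarrow> real" where "grad_cross x = (\<Sum>a\<in>UNIV. \<Sum>j\<in>UNIV. pd a (U j) x * pd j (U a) x)"

lemma smooth_usq: "smooth usq"
  unfolding usq_def[abs_def] by (intro smooth_sum smooth_intros smooth_U)

lemma smooth_Phi: "smooth Phi"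
  unfolding Phi_def[abs_def] by (intro smooth_intros smooth_usq smooth_P)

text \<open>Both sides are |curl u|^2; the right one shows the sign.\<close>

lemma vorticity_sq:
  "grad_sq x - grad_cross x = 1/2 * (\<Sum>a\<in>UNIV. \<Sum>j\<in>UNIV. (pd a (U j) x - pd j (U a) x)\<^sup>2)"
proof -
  have "(\<Sum>a\<in>UNIV. \<Sum>j\<in>UNIV. (pd a (U j) x - pd j (U a) x)\<^sup>2)
    = (\<Sum>a\<in>UNIV. \<Sum>j\<in>UNIV. (pd a (U j) x)\<^sup>2) + (\<Sum>a\<in>UNIV. \<Sum>j\<in>UNIV. (pd j (U a) x)\<^sup>2) - 2 * grad_cross x"
    unfolding grad_cross_def
    by (simp add: power2_diff sum.distrib sum_subtractf sum_distrib_left mult.assoc)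
  also have "(\<Sum>a\<in>UNIV. \<Sum>j\<in>UNIV. (pd j (U a) x)\<^sup>2) = grad_sq x"
    unfolding grad_sq_def by (rule sum.swap)
  finally show ?thesis by (simp add: grad_sq_def)
qed

lemma pd_Phi: "pd k Phi = (\<lambda>x. (\<Sum>i\<in>UNIV. U i x * pd k (U i) x) + pd k P x)"
proof -
  have "pd k usq = (\<lambda>x. \<Sum>i\<in>UNIV. 2 * (U i x * pd k (U i) x))"
    unfolding usq_def[abs_def] power2_eq_square
    by (subst smooth_pd_sum) (auto simp: smooth_pd_mult smooth_U intro!: smooth_intros sum.cong ext)
  moreover have "smooth (\<lambda>x. 1/2 * usq x)" by (intro smooth_intros smooth_usq)
  then have "pd k Phi = (\<lambda>x. 1/2 * pd k usq x + pd k P x)"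
    unfolding Phi_def[abs_def] by (simp only: smooth_pd_add smooth_P smooth_pd_cmult[OF smooth_usq])
  ultimately show ?thesis by (simp add: sum_distrib_left)
qed

text \<open>The divergence of the momentum equation gives minus \<open>grad_cross\<close> for the
  Laplacian of P. In u \<cdot> \<nabla>\<Phi> the convective term cancels the gradient of |u|^2 / 2,
  and what remains, u times its Laplacian, also occurs in the Laplacian of |u|^2 / 2.\<close>

lemma head_pressure_equation:
  "(\<Sum>k\<in>UNIV. pd k (pd k Phi) x) - (\<Sum>k\<in>UNIV. U k x * pd k Phi x) = grad_sq x - grad_cross x"
proof -
  have pdP: "pd a P = (\<lambda>x. (\<Sum>j\<in>UNIV. pd j (pd j (U a)) x) - (\<Sum>j\<in>UNIV. U j x * pd j (U a) x))" for a
    using momentum by auto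
  have sm: "smooth (\<lambda>x. U j x * pd j (U a) x)" for j a by (intro smooth_intros smooth_U smooth_pdU)
  have pdpdP: "pd a (pd a P) x = (\<Sum>j\<in>UNIV. pd a (pd j (pd j (U a))) x)
      - (\<Sum>j\<in>UNIV. pd a (U j) x * pd j (U a) x + U j x * pd a (pd j (U a)) x)" for a
    unfolding pdP
    by (subst smooth_pd_diff) (auto simp: smooth_pd_sum smooth_pd_mult smooth_U smooth_pdU sm intro!: smooth_sum sm smooth_pdU)
  have third: "(\<Sum>a\<in>UNIV. \<Sum>j\<in>UNIV. pd a (pd j (pd j (U a))) x) = 0"
  proof -
    have "pd a (pd j (pd j (U a))) = pd j (pd j (pd a (U a)))" for a j
      using smooth_pd_commute[OF smooth_U, of a j a] smooth_pd_commute[OF smooth_pdU(1), of a j j a] by simp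
    then have "(\<Sum>a\<in>UNIV. \<Sum>j\<in>UNIV. pd a (pd j (pd j (U a))) x) = (\<Sum>j\<in>UNIV. \<Sum>a\<in>UNIV. pd j (pd j (pd a (U a))) x)"
      by (subst sum.swap) simp
    then show ?thesis by (simp add: div_pd)
  qed
  have second: "(\<Sum>a\<in>UNIV. \<Sum>j\<in>UNIV. U j x * pd a (pd j (U a)) x) = 0"
  proof -
    have "(\<Sum>a\<in>UNIV. \<Sum>j\<in>UNIV. U j x * pd a (pd j (U a)) x) = (\<Sum>j\<in>UNIV. U j x * (\<Sum>a\<in>UNIV. pd j (pd a (U a)) x))"
      by (subst sum.swap) (simp add: sum_distrib_left smooth_pd_commute[OF smooth_U])
    then show ?thesis by (simp add: div_pd)
  qed
  have lapP: "(\<Sum>a\<in>UNIV. pd a (pd a P) x) = - grad_cross x"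
    unfolding pdpdP sum_subtractf third sum.distrib second grad_cross_def by simp
  have sm2: "smooth (\<lambda>x. U i x * pd k (U i) x)" for i k by (intro smooth_intros smooth_U smooth_pdU)
  have pdpdPhi: "pd k (pd k Phi) x = (\<Sum>i\<in>UNIV. pd k (U i) x * pd k (U i) x + U i x * pd k (pd k (U i)) x) + pd k (pd k P) x" for k
    unfolding pd_Phi
    by (subst smooth_pd_add) (auto simp: smooth_pd_sum smooth_pd_mult smooth_U smooth_pdU sm2 intro!: smooth_sum sm2)
  have "(\<Sum>k\<in>UNIV. pd k (pd k Phi) x) = grad_sq x + (\<Sum>k\<in>UNIV. \<Sum>i\<in>UNIV. U i x * pd k (pd k (U i)) x) - grad_cross x"
    unfolding pdpdPhi sum.distrib lapP grad_sq_def power2_eq_square by simp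
  moreover have "(\<Sum>k\<in>UNIV. U k x * pd k Phi x) = (\<Sum>k\<in>UNIV. \<Sum>i\<in>UNIV. U i x * pd k (pd k (U i)) x)"
  proof -
    have "(\<Sum>k\<in>UNIV. U k x * pd k Phi x) = (\<Sum>k\<in>UNIV. \<Sum>i\<in>UNIV. U k x * (U i x * pd k (U i) x))
       + (\<Sum>k\<in>UNIV. \<Sum>j\<in>UNIV. U k x * pd j (pd j (U k)) x) - (\<Sum>k\<in>UNIV. \<Sum>j\<in>UNIV. U k x * (U j x * pd j (U k) x))"
      unfolding pd_Phi momentum by (simp add: distrib_left right_diff_distrib sum.distrib sum_subtractf sum_distrib_left)
    also have "(\<Sum>k\<in>UNIV. \<Sum>j\<in>UNIV. U k x * (U j x * pd j (U k) x)) = (\<Sum>k\<in>UNIV. \<Sum>i\<in>UNIV. U k x * (U i x * pd k (U i) x))"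
      by (subst sum.swap) (simp add: mult.left_commute)
    also have "(\<Sum>k\<in>UNIV. \<Sum>j\<in>UNIV. U k x * pd j (pd j (U k)) x) = (\<Sum>k\<in>UNIV. \<Sum>i\<in>UNIV. U i x * pd k (pd k (U i)) x)"
      by (rule sum.swap)
    finally show ?thesis by simp
  qed
  ultimately show ?thesis by simp
qed

lemma smooth_grads: "smooth grad_sq" "smooth grad_cross"
  unfolding grad_sq_def[abs_def] grad_cross_def[abs_def] by (intro smooth_sum smooth_intros smooth_pdU)+

lemma smooth_integrable_bx: "smooth f \<Longrightarrow> f integrable_on bx r" for f :: "real^3 \<Rightarrow> real"
  by (intro continuous_integrable_cbox smooth_continuous)

lemma smooth_by_parts:
  fixes f g :: "real^3 \<Rightarrow> real"
  assumes "smooth f" "smooth g" "\<And>x. x \<notin> bx r \<Longrightarrow> f x = 0 \<or> g x = 0"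
  shows "integral (bx r) (\<lambda>x. f x * pd j g x) = - integral (bx r) (\<lambda>x. pd j f x * g x)"
  by (intro integral_by_parts_pd smooth_Ck assms)

text \<open>Since grad_cross is the double divergence of u \<otimes> u, the gradient and the vorticity have the same
  localized energy up to a term without derivatives of u.\<close>

lemma integral_grad_cross_le:
  "integral (bx 2) (\<lambda>x. cutoff2 x * grad_cross x) \<le> 9 * cutoff_const * integral (bx 2) usq"
proof -
  note sm = smooth_intros smooth_U smooth_pdU smooth_cutoff2 smooth_pd[OF smooth_cutoff2] smooth_pd[OF smooth_pd[OF smooth_cutoff2]]
  have t1: "pd k cutoff2 x = 0" if "x \<notin> bx 2" for k x by (rule pd_eq_0_outside_cbox[OF cutoff2_eq_0 that])
  let ?I = "integral (bx 2)"
  \<comment> \<open>Integration by parts in direction a, then in direction j. The two terms that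
    contain a divergence of u vanish after summation, see \<open>z1\<close> and
    \<open>z2\<close>.\<close>
  have step: "?I (\<lambda>x. cutoff2 x * (pd a (U j) x * pd j (U a) x)) =
      ?I (\<lambda>x. pd j (pd a cutoff2) x * (U j x * U a x)) + ?I (\<lambda>x. pd a cutoff2 x * U a x * pd j (U j) x)
      - ?I (\<lambda>x. cutoff2 x * U j x * pd j (pd a (U a)) x)" for a j
  proof -
    have "?I (\<lambda>x. cutoff2 x * (pd a (U j) x * pd j (U a) x)) = ?I (\<lambda>x. (cutoff2 x * pd j (U a) x) * pd a (U j) x)"
      by (rule integral_cong) simp
    also have "\<dots> = - ?I (\<lambda>x. pd a (\<lambda>x. cutoff2 x * pd j (U a) x) x * U j x)"
      by (rule smooth_by_parts) (auto intro!: sm simp: cutoff2_eq_0)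
    also have "\<dots> = - ?I (\<lambda>x. (pd a cutoff2 x * U j x) * pd j (U a) x + cutoff2 x * U j x * pd j (pd a (U a)) x)"
      by (simp add: smooth_pd_mult smooth_cutoff2 smooth_pdU smooth_pd_commute[OF smooth_U, of a j] algebra_simps)
    also have "\<dots> = - ?I (\<lambda>x. (pd a cutoff2 x * U j x) * pd j (U a) x) - ?I (\<lambda>x. cutoff2 x * U j x * pd j (pd a (U a)) x)"
      by (subst integral_add) (intro smooth_integrable_bx sm | simp)+
    also have "?I (\<lambda>x. (pd a cutoff2 x * U j x) * pd j (U a) x) = - ?I (\<lambda>x. pd j (\<lambda>x. pd a cutoff2 x * U j x) x * U a x)"
      by (rule smooth_by_parts) (auto intro!: sm simp: t1)
    also have "\<dots> = - ?I (\<lambda>x. pd j (pd a cutoff2) x * (U j x * U a x) + pd a cutoff2 x * U a x * pd j (U j) x)"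
      by (simp add: smooth_pd_mult smooth_pd[OF smooth_cutoff2] smooth_U algebra_simps)
    also have "\<dots> = - ?I (\<lambda>x. pd j (pd a cutoff2) x * (U j x * U a x)) - ?I (\<lambda>x. pd a cutoff2 x * U a x * pd j (U j) x)"
      by (subst integral_add) (intro smooth_integrable_bx sm | simp)+
    finally show ?thesis by simp
  qed
  have z1: "(\<Sum>a\<in>UNIV. \<Sum>j\<in>UNIV. ?I (\<lambda>x. pd a cutoff2 x * U a x * pd j (U j) x)) = 0"
  proof -
    have "(\<Sum>j\<in>UNIV. ?I (\<lambda>x. pd a cutoff2 x * U a x * pd j (U j) x))
       = ?I (\<lambda>x. \<Sum>j\<in>UNIV. pd a cutoff2 x * U a x * pd j (U j) x)" for a
      by (intro integral_sum[symmetric] finite smooth_integrable_bx sm)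
    then show ?thesis by (simp add: sum_distrib_left[symmetric] incompressible)
  qed
  have z2: "(\<Sum>a\<in>UNIV. \<Sum>j\<in>UNIV. ?I (\<lambda>x. cutoff2 x * U j x * pd j (pd a (U a)) x)) = 0"
  proof -
    have "(\<Sum>a\<in>UNIV. ?I (\<lambda>x. cutoff2 x * U j x * pd j (pd a (U a)) x))
       = ?I (\<lambda>x. \<Sum>a\<in>UNIV. cutoff2 x * U j x * pd j (pd a (U a)) x)" for j
      by (intro integral_sum[symmetric] finite smooth_integrable_bx sm)
    then show ?thesis by (subst sum.swap) (simp add: sum_distrib_left[symmetric] div_pd)
  qed
  have "?I (\<lambda>x. cutoff2 x * grad_cross x) = ?I (\<lambda>x. \<Sum>a\<in>UNIV. \<Sum>j\<in>UNIV. cutoff2 x * (pd a (U j) x * pd j (U a) x))"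
    by (simp add: grad_cross_def sum_distrib_left)
  also have "\<dots> = (\<Sum>a\<in>UNIV. ?I (\<lambda>x. \<Sum>j\<in>UNIV. cutoff2 x * (pd a (U j) x * pd j (U a) x)))"
    by (intro integral_sum finite smooth_integrable_bx sm smooth_sum)
  also have "\<dots> = (\<Sum>a\<in>UNIV. \<Sum>j\<in>UNIV. ?I (\<lambda>x. cutoff2 x * (pd a (U j) x * pd j (U a) x)))"
    by (intro sum.cong refl integral_sum finite smooth_integrable_bx sm)
  also have "\<dots> = (\<Sum>a\<in>UNIV. \<Sum>j\<in>UNIV. ?I (\<lambda>x. pd j (pd a cutoff2) x * (U j x * U a x)))"
    unfolding step sum.distrib sum_subtractf z1 z2 by simp
  also have "\<dots> \<le> (\<Sum>a\<in>(UNIV::3 set). \<Sum>j\<in>(UNIV::3 set). cutoff_const * ?I usq)"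
  proof (intro sum_mono)
    fix a j :: 3
    have "?I (\<lambda>x. pd j (pd a cutoff2) x * (U j x * U a x)) \<le> ?I (\<lambda>x. cutoff_const * usq x)"
    proof (intro integral_le smooth_integrable_bx sm smooth_usq)
      fix x
      have "0 \<le> (\<bar>U j x\<bar> - \<bar>U a x\<bar>)\<^sup>2" by simp
      then have "2 * \<bar>U j x * U a x\<bar> \<le> (U j x)\<^sup>2 + (U a x)\<^sup>2" by (simp add: power2_diff abs_mult)
      then have "\<bar>U j x * U a x\<bar> \<le> usq x" using usq_ge[of j x] usq_ge[of a x] by linarith
      then have "\<bar>pd j (pd a cutoff2) x * (U j x * U a x)\<bar> \<le> cutoff_const * usq x"
        unfolding abs_mult[of "pd j (pd a cutoff2) x"] by (intro mult_mono cutoff_const) auto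
      then show "pd j (pd a cutoff2) x * (U j x * U a x) \<le> cutoff_const * usq x" by linarith
    qed
    then show "?I (\<lambda>x. pd j (pd a cutoff2) x * (U j x * U a x)) \<le> cutoff_const * ?I usq" by simp
  qed
  finally show ?thesis by simp
qed

end

text \<open>The situation at unit scale. \<open>d\<close> enters through the conclusion of
  \<open>BMO_pairing\<close> on one box only, with \<open>B\<close> as a parameter, because the
  rescaled solutions share this constant. The numbers \<open>c\<close> are the averages of
  \<open>d\<close> on the box.\<close>

locale NS_BMO = stationary_NS +
  fixes d :: "3 \<Rightarrow> 3 \<Rightarrow> real^3 \<Rightarrow> real" and c :: "3 \<Rightarrow> 3 \<Rightarrow> real" and B :: real
  assumes skew: "\<And>i j x. d i j x = - d j i x" and c_skew: "\<And>i j. c i j = - c j i"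
    and d_int: "\<And>i j. set_integrable lborel (bx 2) (d i j)"
    and pairing: "\<And>i j \<theta> G X S. \<theta> > 0 \<Longrightarrow> continuous_on UNIV G \<Longrightarrow> continuous_on UNIV X \<Longrightarrow>
      continuous_on UNIV S \<Longrightarrow> (\<And>x. x \<in> bx 2 \<Longrightarrow> 0 \<le> X x \<and> 0 \<le> S x \<and> (G x)\<^sup>2 \<le> X x * S x ^ 3) \<Longrightarrow>
      \<bar>LINT x:bx 2|lborel. (d i j x - c i j) * G x\<bar>
        \<le> \<theta> * integral (bx 2) X + (B + integral (bx 2) (\<lambda>x. S x ^ 4)) / \<theta>"
    and weak_div: "\<And>\<phi> i. test_fun \<phi> \<Longrightarrow> integral\<^sup>L lborel (\<lambda>x. U i x * \<phi> x)
      = - (\<Sum>j\<in>UNIV. integral\<^sup>L lborel (\<lambda>x. d i j x * pd j \<phi> x))"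
begin

lemma set_integrable_d_mult: "continuous_on UNIV G \<Longrightarrow> set_integrable lborel (bx 2) (\<lambda>x. d i j x * G x)"
  by (rule set_integrable_mult_continuous[OF d_int order_refl])

lemma set_integrable_dc_mult:
  assumes "continuous_on UNIV G"
  shows "set_integrable lborel (bx 2) (\<lambda>x. (d i j x - c i j) * G x)"
proof -
  have "set_integrable lborel (bx 2) (\<lambda>x. d i j x * G x - c i j * G x)"
    by (intro set_integral_diff set_integrable_d_mult set_integrable_mult_right impI set_integrable_cbox_continuous assms)
  then show ?thesis by (simp add: left_diff_distrib)
qed

text \<open>Constants can be subtracted from \<open>d\<close> because derivatives of compactly
  supported functions have integral zero; this is how mean oscillation replaces the size of
  \<open>d\<close>.\<close>

lemma weak_div_bx:
  assumes \<phi>: "smooth \<phi>" and supp: "\<And>x. x \<notin> bx 2 \<Longrightarrow> \<phi> x = 0"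
  shows "integral (bx 2) (\<lambda>x. U i x * \<phi> x) = - (\<Sum>j\<in>UNIV. LINT x:bx 2|lborel. (d i j x - c i j) * pd j \<phi> x)"
proof -
  have "closure {x. \<phi> x \<noteq> 0} \<subseteq> bx 2"
    by (rule closure_minimal) (use supp in auto)
  then have "compact (closure {x. \<phi> x \<noteq> 0})"
    using bounded_subset[OF bounded_cbox] by (auto simp: compact_eq_bounded_closed)
  then have t: "test_fun \<phi>" using \<phi> by (simp add: test_fun_def)
  have s1: "pd j \<phi> x = 0" if "x \<notin> bx 2" for j x by (rule pd_eq_0_outside_cbox[OF supp that])
  have cpd: "continuous_on UNIV (pd j \<phi>)" for j by (rule smooth_continuous[OF smooth_pd[OF \<phi>]])
  have "integral (bx 2) (\<lambda>x. U i x * \<phi> x) = integral\<^sup>L lborel (\<lambda>x. U i x * \<phi> x)"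
    by (rule lborel_integral_cbox(2)[symmetric])
      (use supp in \<open>auto intro!: continuous_intros continuous_U smooth_continuous[OF \<phi>]\<close>)
  also have "\<dots> = - (\<Sum>j\<in>UNIV. integral\<^sup>L lborel (\<lambda>x. d i j x * pd j \<phi> x))" by (rule weak_div[OF t])
  also have "\<dots> = - (\<Sum>j\<in>UNIV. LINT x:bx 2|lborel. (d i j x - c i j) * pd j \<phi> x)"
  proof -
    have "integral\<^sup>L lborel (\<lambda>x. d i j x * pd j \<phi> x) = (LINT x:bx 2|lborel. (d i j x - c i j) * pd j \<phi> x)" for j
    proof -
      have "integral\<^sup>L lborel (\<lambda>x. d i j x * pd j \<phi> x) = (LINT x:bx 2|lborel. d i j x * pd j \<phi> x)"
        unfolding set_lebesgue_integral_def
        by (rule Bochner_Integration.integral_cong) (use s1 in \<open>auto simp: indicator_def\<close>)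
      moreover have "(LINT x:bx 2|lborel. pd j \<phi> x) = 0"
        using set_borel_integral_eq_integral(2)[OF set_integrable_cbox_continuous[OF cpd]]
          integral_pd_eq_0[OF smooth_Ck[OF \<phi>] supp] by simp
      moreover have "(LINT x:bx 2|lborel. (d i j x - c i j) * pd j \<phi> x)
        = (LINT x:bx 2|lborel. d i j x * pd j \<phi> x) - c i j * (LINT x:bx 2|lborel. pd j \<phi> x)"
        unfolding left_diff_distrib
        by (subst set_integral_diff) (auto intro: set_integrable_d_mult cpd set_integrable_cbox_continuous)
      ultimately show ?thesis by simp
    qed
    then show ?thesis by simp
  qed
  finally show ?thesis .
qed

text \<open>After division by \<delta> the argument t of the weight has a bounded L^2 norm, and
  every term that Young's inequality does not absorb carries one factor \<delta>.\<close>

theorem vorticity_energy_le: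
  assumes \<delta>: "\<delta> > 0" and Phi: "integral (bx 2) (\<lambda>x. (Phi x - c0)\<^sup>2) \<le> \<delta>\<^sup>2"
  shows "integral (bx 2) (\<lambda>x. cutoff2 x * (grad_sq x - grad_cross x))
    \<le> 12 * (40 * cutoff_const\<^sup>2 + 1) * (9 * B + 972) * \<delta>"
proof -
  \<comment> \<open>The 40 is 4 from the gradient of the squared cutoff times 10 from
    \<open>weight_growth\<close>.\<close>
  define C0 where "C0 = 40 * cutoff_const\<^sup>2 + 1"
  have C0: "C0 > 0" by (simp add: C0_def add_nonneg_pos)
  \<comment> \<open>There are 12 terms to absorb, 9 from the drift and 3 from the diffusion, and
    each may use 1/12 of the integral of \<open>X0\<close>. Their remainders give 9 (B + 65) + 3 *
    129 = 9 B + 972.\<close>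
  define \<theta> where "\<theta> = 1 / (12 * C0 * \<delta>)"
  have \<theta>: "\<theta> > 0" "1 / \<theta> = 12 * C0 * \<delta>" "\<theta> * (C0 * \<delta>) = 1/12" using C0 \<delta> by (auto simp: \<theta>_def)
  define t where "t = (\<lambda>x. (1 / \<delta>) * (Phi x - c0))"
  define h where "h = (\<lambda>x. weight (t x))"
  have st: "smooth t" unfolding t_def by (intro smooth_intros smooth_Phi)
  have sh: "smooth h" unfolding h_def by (rule smooth_weight[OF st])
  have sPhi: "smooth (pd k Phi)" "smooth (pd j (pd k Phi))" for j k by (intro smooth_pd smooth_Phi)+
  have scut: "smooth (pd k cutoff2)" for k by (intro smooth_pd smooth_cutoff2)
  note sm = smooth_intros smooth_U smooth_cutoff2 scut sh smooth_pd[OF sh] sPhi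
  have pdt: "pd k t = (\<lambda>x. (1 / \<delta>) * pd k Phi x)" for k
  proof -
    have "pd k (\<lambda>x. Phi x - c0) = pd k Phi"
      using smooth_pd_diff[OF smooth_Phi smooth_intros(1)[of c0], of k] by (simp add: pd_const)
    moreover have "smooth (\<lambda>x. Phi x - c0)" by (intro smooth_intros smooth_Phi)
    ultimately show ?thesis unfolding t_def by (simp only: smooth_pd_cmult)
  qed
  have pdh: "pd k h x = weight' (t x) / \<delta> * pd k Phi x" for k x
    unfolding h_def using pd_compose_real[OF weight_deriv smooth_differentiable[OF st], of k x] by (simp add: pdt)
  have w'0: "weight' s \<ge> 0" for s using weight_base_pos[of s] by (simp add: weight'_def)
  \<comment> \<open>The good term created by the increasing weight.\<close>
  define X0 where "X0 = (\<lambda>x. cutoff2 x * (\<Sum>k\<in>UNIV. pd k h x * pd k Phi x))"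
  have sX0: "smooth X0" unfolding X0_def by (intro smooth_sum sm)
  have X0: "X0 x = cutoff2 x * (weight' (t x) / \<delta>) * (\<Sum>k\<in>UNIV. (pd k Phi x)\<^sup>2)" for x
    by (simp add: X0_def pdh sum_distrib_left power2_eq_square mult_ac)
  have X0_nonneg: "X0 x \<ge> 0" for x
    unfolding X0 using \<delta> w'0 by (intro mult_nonneg_nonneg cutoff2_nonneg sum_nonneg divide_nonneg_pos) auto
  define S where "S = (\<lambda>x. sqrt (sqrt (1 + (t x)\<^sup>2)))"
  have cS: "continuous_on UNIV S" unfolding S_def by (intro continuous_intros smooth_continuous[OF st])
  have S0: "S x \<ge> 0" for x by (simp add: S_def)
  have S4: "S x ^ 4 = 1 + (t x)\<^sup>2" for x
  proof -
    have "S x ^ 4 = ((S x)\<^sup>2)\<^sup>2" by simp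
    also have "\<dots> = 1 + (t x)\<^sup>2" by (simp add: S_def)
    finally show ?thesis .
  qed
  \<comment> \<open>The part of the differentiated test function in which the derivative falls on
    the cutoff.\<close>
  define G where "G = (\<lambda>k j x. pd k cutoff2 x * (h x * pd j Phi x))"
  have sG: "smooth (G k j)" for k j unfolding G_def by (intro sm)
  have G_le: "(G k j x)\<^sup>2 \<le> C0 * \<delta> * X0 x * S x ^ 3" for k j x
  proof -
    have "(pd k cutoff2 x)\<^sup>2 \<le> 4 * cutoff_const\<^sup>2 * cutoff2 x"
    proof -
      have "(pd k cutoff x)\<^sup>2 \<le> cutoff_const\<^sup>2"
        using cutoff_const(2)[of k x] by (simp add: abs_le_square_iff[symmetric] cutoff_const(1))
      then have "4 * cutoff2 x * (pd k cutoff x)\<^sup>2 \<le> 4 * cutoff2 x * cutoff_const\<^sup>2"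
        using cutoff2_nonneg[of x] by (intro mult_left_mono) auto
      then show ?thesis by (simp add: pd_cutoff2 power_mult_distrib cutoff2_def power2_eq_square mult_ac)
    qed
    moreover have "(h x)\<^sup>2 \<le> 10 * weight' (t x) * S x ^ 3"
      unfolding h_def S_def by (rule weight_growth)
    moreover have "(pd j Phi x)\<^sup>2 \<le> (\<Sum>k\<in>UNIV. (pd k Phi x)\<^sup>2)" by (rule member_le_sum) auto
    ultimately have "(pd k cutoff2 x)\<^sup>2 * ((h x)\<^sup>2 * (pd j Phi x)\<^sup>2)
      \<le> (4 * cutoff_const\<^sup>2 * cutoff2 x) * ((10 * weight' (t x) * S x ^ 3) * (\<Sum>k\<in>UNIV. (pd k Phi x)\<^sup>2))"
      using w'0 S0 cutoff2_nonneg by (intro mult_mono) (auto intro!: mult_nonneg_nonneg)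
    also have "\<dots> = (40 * cutoff_const\<^sup>2) * (\<delta> * X0 x * S x ^ 3)"
      unfolding X0 using \<delta> by (simp add: field_simps)
    also have "\<dots> \<le> C0 * (\<delta> * X0 x * S x ^ 3)"
      unfolding C0_def using \<delta> X0_nonneg S0 by (intro mult_right_mono mult_nonneg_nonneg) auto
    finally show ?thesis by (simp add: G_def power_mult_distrib mult_ac)
  qed
  let ?I = "integral (bx 2)"
  \<comment> \<open>The volume 64 of \<open>bx 2\<close>, plus 1 from the normalization by
    \<delta>.\<close>
  have iS4: "?I (\<lambda>x. S x ^ 4) \<le> 65"
  proof -
    have "?I (\<lambda>x. S x ^ 4) = ?I (\<lambda>x. 1 + (1 / \<delta>\<^sup>2) * (Phi x - c0)\<^sup>2)"
      by (rule integral_cong) (simp add: S4 t_def power_mult_distrib power_divide)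
    also have "\<dots> = 64 + (1 / \<delta>\<^sup>2) * ?I (\<lambda>x. (Phi x - c0)\<^sup>2)"
      using \<delta>
      by (subst integral_add) (auto intro!: continuous_integrable_cbox continuous_intros smooth_continuous[OF smooth_Phi] simp: content_bx)
    also have "\<dots> \<le> 64 + (1 / \<delta>\<^sup>2) * \<delta>\<^sup>2" using Phi by (intro add_left_mono mult_left_mono) auto
    finally show ?thesis using \<delta> by simp
  qed
  have cX: "continuous_on UNIV (\<lambda>x. C0 * \<delta> * X0 x)" by (intro continuous_intros smooth_continuous[OF sX0])
  have iX: "\<theta> * ?I (\<lambda>x. C0 * \<delta> * X0 x) = 1/12 * ?I X0"
    using \<theta>(3) by (simp only: integral_mult_right mult.assoc[symmetric])
  have pair: "\<bar>LINT x:bx 2|lborel. (d i j x - c i j) * G k l x\<bar> \<le> 1/12 * ?I X0 + 12 * C0 * \<delta> * (B + 65)" for i j k l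
  proof -
    have "\<bar>LINT x:bx 2|lborel. (d i j x - c i j) * G k l x\<bar>
      \<le> \<theta> * ?I (\<lambda>x. C0 * \<delta> * X0 x) + (B + ?I (\<lambda>x. S x ^ 4)) / \<theta>"
      using C0 \<delta> X0_nonneg S0 G_le
      by (intro pairing \<theta> cX cS smooth_continuous[OF sG]) (auto intro!: mult_nonneg_nonneg)
    also have "\<dots> = 1/12 * ?I X0 + (12 * C0 * \<delta>) * (B + ?I (\<lambda>x. S x ^ 4))"
      unfolding iX using \<theta>(2) by (metis divide_inverse inverse_eq_divide mult.commute mult_1)
    also have "\<dots> \<le> 1/12 * ?I X0 + (12 * C0 * \<delta>) * (B + 65)"
      using iS4 C0 \<delta> by (intro add_left_mono mult_left_mono) auto
    finally show ?thesis .
  qed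
  \<comment> \<open>The diffusion leaves terms of the same kind with 1 in place of d - c, hence
    Young's inequality with D = 1.\<close>
  have diag: "\<bar>?I (G k k)\<bar> \<le> 1/12 * ?I X0 + 12 * C0 * \<delta> * 129" for k
  proof -
    have "\<bar>?I (G k k)\<bar> \<le> ?I (\<lambda>x. \<theta> * (C0 * \<delta> * X0 x) + (12 * C0 * \<delta>) * (1 + S x ^ 4))"
    proof (rule integral_abs_le)
      fix x
      have "\<bar>G k k x\<bar> * \<bar>1\<bar> \<le> \<theta> * (C0 * \<delta> * X0 x) + (\<bar>1\<bar> ^ 8 + S x ^ 4) / \<theta>"
        using G_le[of k k x] C0 \<delta> X0_nonneg[of x] S0[of x] by (intro weighted_Young \<theta>) auto
      also have "(\<bar>1\<bar> ^ 8 + S x ^ 4) / \<theta> = (12 * C0 * \<delta>) * (1 + S x ^ 4)"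
        unfolding \<theta>(2)[symmetric] by simp
      finally show "\<bar>G k k x\<bar> \<le> \<theta> * (C0 * \<delta> * X0 x) + (12 * C0 * \<delta>) * (1 + S x ^ 4)" by simp
    qed (intro continuous_intros smooth_continuous[OF sG] smooth_continuous[OF sX0] cS)+
    also have "\<dots> = \<theta> * ?I (\<lambda>x. C0 * \<delta> * X0 x) + (12 * C0 * \<delta>) * (64 + ?I (\<lambda>x. S x ^ 4))"
    proof -
      have "?I (\<lambda>x. 1 + S x ^ 4) = 64 + ?I (\<lambda>x. S x ^ 4)"
        by (subst integral_add) (auto intro!: continuous_integrable_cbox continuous_intros cS simp: content_bx)
      then show ?thesis
        by (subst integral_add) (auto intro!: continuous_integrable_cbox continuous_intros cS smooth_continuous[OF sX0])
    qed
    also have "\<dots> \<le> 1/12 * ?I X0 + (12 * C0 * \<delta>) * 129"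
      unfolding iX using iS4 C0 \<delta> by (intro add_left_mono mult_left_mono) auto
    finally show ?thesis .
  qed
  have E1: "?I (\<lambda>x. cutoff2 x * h x * (\<Sum>k\<in>UNIV. pd k (pd k Phi) x)) = - (\<Sum>k\<in>UNIV. ?I (G k k)) - ?I X0"
  proof -
    have "?I (\<lambda>x. cutoff2 x * h x * (\<Sum>k\<in>UNIV. pd k (pd k Phi) x))
      = ?I (\<lambda>x. \<Sum>k\<in>UNIV. (cutoff2 x * h x) * pd k (pd k Phi) x)"
      by (simp add: sum_distrib_left)
    also have "\<dots> = (\<Sum>k\<in>UNIV. ?I (\<lambda>x. (cutoff2 x * h x) * pd k (pd k Phi) x))"
      by (intro integral_sum finite smooth_integrable_bx sm)
    also have "\<dots> = (\<Sum>k\<in>UNIV. - ?I (\<lambda>x. pd k (\<lambda>x. cutoff2 x * h x) x * pd k Phi x))"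
      by (intro sum.cong refl smooth_by_parts sm) (simp add: cutoff2_eq_0)
    also have "\<dots> = - (\<Sum>k\<in>UNIV. ?I (\<lambda>x. G k k x + cutoff2 x * (pd k h x * pd k Phi x)))"
      by (simp add: smooth_pd_mult smooth_cutoff2 sh G_def sum_negf algebra_simps)
    also have "\<dots> = - (\<Sum>k\<in>UNIV. ?I (G k k)) - (\<Sum>k\<in>UNIV. ?I (\<lambda>x. cutoff2 x * (pd k h x * pd k Phi x)))"
    proof -
      have "?I (\<lambda>x. G k k x + cutoff2 x * (pd k h x * pd k Phi x))
        = ?I (G k k) + ?I (\<lambda>x. cutoff2 x * (pd k h x * pd k Phi x))" for k
        by (intro integral_add smooth_integrable_bx sm sG)
      then show ?thesis by (simp add: sum.distrib)
    qed
    also have "(\<Sum>k\<in>UNIV. ?I (\<lambda>x. cutoff2 x * (pd k h x * pd k Phi x))) = ?I X0"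
      unfolding X0_def sum_distrib_left by (intro integral_sum[symmetric] finite smooth_integrable_bx sm)
    finally show ?thesis .
  qed
  have E2: "?I (\<lambda>x. cutoff2 x * h x * (\<Sum>j\<in>UNIV. U j x * pd j Phi x))
    = - (\<Sum>j\<in>UNIV. \<Sum>k\<in>UNIV. LINT x:bx 2|lborel. (d j k x - c j k) * G k j x)"
  proof -
    define \<phi> where "\<phi> = (\<lambda>j x. cutoff2 x * (h x * pd j Phi x))"
    define R where "R = (\<lambda>k j x. cutoff2 x * (pd k h x * pd j Phi x + h x * pd k (pd j Phi) x))"
    have s\<phi>: "smooth (\<phi> j)" for j unfolding \<phi>_def by (intro sm)
    have sR: "smooth (R k j)" for k j unfolding R_def by (intro sm)
    have pd\<phi>: "pd k (\<phi> j) = (\<lambda>x. G k j x + R k j x)" for k j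
      unfolding \<phi>_def G_def R_def by (simp add: smooth_pd_mult sm)
    \<comment> \<open>h is a function of \<Phi>, so its gradient is parallel to that of \<Phi>; with
      the symmetric Hessian this makes \<open>R\<close> symmetric, and the skew matrix d - c
      annihilates it. No second derivative of \<Phi> meets d.\<close>
    have R_sym: "R k j x = R j k x" for k j x
      unfolding R_def pdh by (simp add: smooth_pd_commute[OF smooth_Phi, of k j] mult_ac)
    define L where "L j k = (LINT x:bx 2|lborel. (d j k x - c j k) * R k j x)" for j k
    have L_neg: "L j k = - L k j" for j k
    proof -
      have "(d j k x - c j k) * R k j x = - ((d k j x - c k j) * R j k x)" for x
        unfolding skew[of j k x] c_skew[of j k] R_sym[of k j x] by (simp add: algebra_simps)
      then show ?thesis unfolding L_def set_lebesgue_integral_def by simp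
    qed
    have "(\<Sum>j\<in>UNIV. \<Sum>k\<in>UNIV. L j k) = (\<Sum>j\<in>UNIV. \<Sum>k\<in>UNIV. - L k j)"
      by (intro sum.cong refl L_neg)
    also have "\<dots> = - (\<Sum>j\<in>UNIV. \<Sum>k\<in>UNIV. L j k)" unfolding sum_negf by (subst sum.swap) (rule refl)
    finally have L0: "(\<Sum>j\<in>UNIV. \<Sum>k\<in>UNIV. L j k) = 0" by simp
    have "?I (\<lambda>x. cutoff2 x * h x * (\<Sum>j\<in>UNIV. U j x * pd j Phi x)) = ?I (\<lambda>x. \<Sum>j\<in>UNIV. U j x * \<phi> j x)"
      by (simp add: \<phi>_def sum_distrib_left mult_ac)
    also have "\<dots> = (\<Sum>j\<in>UNIV. ?I (\<lambda>x. U j x * \<phi> j x))"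
      by (intro integral_sum finite smooth_integrable_bx sm s\<phi>)
    also have "\<dots> = (\<Sum>j\<in>UNIV. - (\<Sum>k\<in>UNIV. LINT x:bx 2|lborel. (d j k x - c j k) * pd k (\<phi> j) x))"
      by (intro sum.cong refl weak_div_bx s\<phi>) (simp add: \<phi>_def cutoff2_eq_0)
    also have "\<dots> = - (\<Sum>j\<in>UNIV. \<Sum>k\<in>UNIV. (LINT x:bx 2|lborel. (d j k x - c j k) * G k j x) + L j k)"
    proof -
      have "(LINT x:bx 2|lborel. (d j k x - c j k) * pd k (\<phi> j) x)
        = (LINT x:bx 2|lborel. (d j k x - c j k) * G k j x) + L j k" for j k
        unfolding pd\<phi> distrib_left L_def
        by (intro set_integral_add set_integrable_dc_mult smooth_continuous sG sR)
      then show ?thesis by (simp add: sum_negf)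
    qed
    also have "\<dots> = - (\<Sum>j\<in>UNIV. \<Sum>k\<in>UNIV. LINT x:bx 2|lborel. (d j k x - c j k) * G k j x)"
      using L0 by (simp add: sum.distrib)
    finally show ?thesis .
  qed
  have "?I (\<lambda>x. cutoff2 x * (grad_sq x - grad_cross x)) \<le> ?I (\<lambda>x. cutoff2 x * h x * (grad_sq x - grad_cross x))"
  proof (intro integral_le smooth_integrable_bx sm smooth_grads)
    fix x
    have "0 \<le> cutoff2 x * (grad_sq x - grad_cross x)"
      unfolding vorticity_sq by (intro mult_nonneg_nonneg cutoff2_nonneg sum_nonneg) auto
    moreover have "h x \<ge> 1" unfolding h_def by (rule weight_ge_1)
    ultimately have "1 * (cutoff2 x * (grad_sq x - grad_cross x)) \<le> h x * (cutoff2 x * (grad_sq x - grad_cross x))"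
      by (intro mult_right_mono)
    then show "cutoff2 x * (grad_sq x - grad_cross x) \<le> cutoff2 x * h x * (grad_sq x - grad_cross x)"
      by (simp add: mult_ac)
  qed
  also have "\<dots> = ?I (\<lambda>x. cutoff2 x * h x * (\<Sum>k\<in>UNIV. pd k (pd k Phi) x))
      - ?I (\<lambda>x. cutoff2 x * h x * (\<Sum>j\<in>UNIV. U j x * pd j Phi x))"
    unfolding head_pressure_equation[symmetric] right_diff_distrib
    by (intro integral_diff smooth_integrable_bx sm smooth_sum)
  also have "\<dots> = (\<Sum>j\<in>UNIV. \<Sum>k\<in>UNIV. LINT x:bx 2|lborel. (d j k x - c j k) * G k j x)
      + (\<Sum>k\<in>UNIV. - ?I (G k k)) - ?I X0"
    unfolding E1 E2 by (simp add: sum_negf)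
  also have "\<dots> \<le> (\<Sum>j\<in>(UNIV::3 set). \<Sum>k\<in>(UNIV::3 set). 1/12 * ?I X0 + 12 * C0 * \<delta> * (B + 65))
      + (\<Sum>k\<in>(UNIV::3 set). 1/12 * ?I X0 + 12 * C0 * \<delta> * 129) - ?I X0"
    using pair diag by (intro diff_right_mono add_mono sum_mono) (simp_all add: abs_le_iff)
  also have "\<dots> = 12 * C0 * (9 * B + 972) * \<delta>" by (simp add: algebra_simps)
  finally show ?thesis by (simp add: C0_def)
qed

end

section \<open>Rescaling and conclusion\<close>

context NS_BMO
begin

text \<open>The coefficient of k in \<open>unit_gradient_estimate\<close>;
  \<open>unit_const'\<close> is the constant term. Both depend on the locale through
  \<open>B\<close> only, so they serve all rescalings at once.\<close>

definition unit_const :: real where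
  "unit_const = 12 * (40 * cutoff_const\<^sup>2 + 1) * (9 * B + 972) * (5 + 23 * (18 * pressure_const / mu) * 194)
    + 1161 * cutoff_const"

definition unit_const' :: real where
  "unit_const' = 12 * (40 * cutoff_const\<^sup>2 + 1) * (9 * B + 972) * (23 * (18 * pressure_const / mu) * 768 + 1)"

text \<open>The L^4 size of u enters as an arbitrary positive bound k, by which one may divide. The
  pressure and vorticity estimates bound the vorticity energy, and
  \<open>integral_grad_cross_le\<close> passes to the full gradient.\<close>

lemma unit_gradient_estimate:
  assumes k: "k > 0" and A4: "A4 \<le> k\<^sup>2"
  shows "integral (bx 2) (\<lambda>x. cutoff2 x * grad_sq x) \<le> unit_const * k + unit_const'"
proof -
  note ints = continuous_integrable_cbox continuous_intros continuous_usq continuous_U continuous_P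
  \<comment> \<open>The box has volume 512, so k / 4 integrates to 128 k, and the quadratic part
    adds k.\<close>
  have s: "integral (bx 4) usq \<le> 129 * k"
  proof -
    have "integral (bx 4) usq \<le> integral (bx 4) (\<lambda>x. (1 / k) * (usq x)\<^sup>2 + k / 4)"
    proof (intro integral_le ints)
      fix x
      have "0 \<le> (usq x - k / 2)\<^sup>2 / k" using k by simp
      also have "\<dots> = (1 / k) * (usq x)\<^sup>2 + k / 4 - usq x"
        using k by (simp add: power2_diff field_simps power2_eq_square)
      finally show "usq x \<le> (1 / k) * (usq x)\<^sup>2 + k / 4" by simp
    qed
    also have "\<dots> = (1 / k) * A4 + 128 * k"
      unfolding A4_def using k by (subst integral_add) (auto intro!: ints simp: content_bx)
    also have "(1 / k) * A4 \<le> (1 / k) * k\<^sup>2" using A4 k by (intro mult_left_mono) auto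
    finally show ?thesis using k by (simp add: power2_eq_square)
  qed
  have s2: "integral (bx 2) usq \<le> 129 * k"
  proof -
    have "integral (bx 2) usq \<le> integral (bx 4) usq"
      by (intro integral_subset_le bx_mono ints) (auto simp: usq_def intro: sum_nonneg)
    with s show ?thesis by linarith
  qed
  \<comment> \<open>768 is 3/2 of the volume 512, and 194 rounds up 3/2 of 129.\<close>
  have K1: "K1 \<le> 768 + 194 * k"
  proof -
    have "K1 \<le> integral (bx 4) (\<lambda>x. 3/2 + 3/2 * usq x)"
      unfolding K1_def
    proof (intro integral_le ints)
      fix x
      have "(\<Sum>i\<in>UNIV. \<bar>U i x\<bar>) \<le> (\<Sum>i\<in>(UNIV::3 set). 1/2 + 1/2 * (U i x)\<^sup>2)"
      proof (rule sum_mono)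
        fix i :: 3
        have "0 \<le> (\<bar>U i x\<bar> - 1)\<^sup>2" by simp
        then show "\<bar>U i x\<bar> \<le> 1/2 + 1/2 * (U i x)\<^sup>2" by (simp add: power2_diff)
      qed
      also have "\<dots> = 3/2 + 1/2 * usq x" by (simp add: sum.distrib usq_def sum_divide_distrib)
      finally show "(\<Sum>i\<in>UNIV. \<bar>U i x\<bar>) + usq x \<le> 3/2 + 3/2 * usq x" by simp
    qed
    also have "\<dots> = 768 + 3/2 * integral (bx 4) usq"
      by (subst integral_add) (auto intro!: ints simp: content_bx)
    finally show ?thesis using s k by linarith
  qed
  define q where "q = 18 * pressure_const / mu"
  have q: "q \<ge> 0" unfolding q_def using pressure_const(1) mu_pos by simp
  \<comment> \<open>5^2 and 23^2 exceed the coefficients 33/2 and 512 of the bound for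
    \<Phi>.\<close>
  define \<delta> where "\<delta> = 5 * k + 23 * q * (768 + 194 * k) + 1"
  have q1: "0 \<le> 23 * q * (768 + 194 * k)" using q k by simp
  have \<delta>: "\<delta> > 0" unfolding \<delta>_def using k q1 by linarith
  obtain c0 where c0: "integral (bx 2) (\<lambda>x. (P x - c0)\<^sup>2) \<le> 256 * (18 * pressure_const * K1 / mu)\<^sup>2 + 8 * A4"
    using pressure_estimate by blast
  have "integral (bx 2) (\<lambda>x. (Phi x - c0)\<^sup>2) \<le> integral (bx 2) (\<lambda>x. 1/2 * (usq x)\<^sup>2 + 2 * (P x - c0)\<^sup>2)"
  proof (intro integral_le ints)
    show "continuous_on UNIV Phi" by (rule smooth_continuous[OF smooth_Phi])
    fix x
    have "0 \<le> (1/2 * usq x - (P x - c0))\<^sup>2" by simp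
    then show "(Phi x - c0)\<^sup>2 \<le> 1/2 * (usq x)\<^sup>2 + 2 * (P x - c0)\<^sup>2"
      by (simp add: Phi_def power2_eq_square algebra_simps)
  qed
  also have "\<dots> = 1/2 * integral (bx 2) (\<lambda>x. (usq x)\<^sup>2) + 2 * integral (bx 2) (\<lambda>x. (P x - c0)\<^sup>2)"
    by (subst integral_add) (auto intro!: ints)
  also have "\<dots> \<le> 1/2 * A4 + 2 * (256 * (18 * pressure_const * K1 / mu)\<^sup>2 + 8 * A4)"
  proof -
    have "integral (bx 2) (\<lambda>x. (usq x)\<^sup>2) \<le> A4"
      unfolding A4_def by (intro integral_subset_le bx_mono ints) auto
    with c0 show ?thesis by (intro add_mono mult_left_mono) auto
  qed
  also have "\<dots> = 33/2 * A4 + 512 * (q * K1)\<^sup>2" by (simp add: q_def power_mult_distrib power_divide)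
  also have "\<dots> \<le> \<delta>\<^sup>2"
  proof -
    have "(q * K1)\<^sup>2 \<le> (q * (768 + 194 * k))\<^sup>2"
      using K1 K1_nonneg q by (intro power_mono mult_left_mono mult_nonneg_nonneg) auto
    moreover have "(5 * k)\<^sup>2 = 25 * k\<^sup>2" "(23 * q * (768 + 194 * k))\<^sup>2 = 529 * (q * (768 + 194 * k))\<^sup>2"
      by (simp_all add: power_mult_distrib)
    moreover have "0 \<le> (q * (768 + 194 * k))\<^sup>2" "0 \<le> k\<^sup>2" by simp_all
    ultimately have "33/2 * A4 + 512 * (q * K1)\<^sup>2 \<le> (5 * k)\<^sup>2 + (23 * q * (768 + 194 * k))\<^sup>2"
      using A4 by linarith
    also have "\<dots> \<le> \<delta>\<^sup>2"
    proof -
      have *: "a\<^sup>2 + b\<^sup>2 \<le> (a + b + 1)\<^sup>2" if "0 \<le> a" "0 \<le> b" for a b :: real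
        using that mult_nonneg_nonneg[OF that] by (simp add: power2_eq_square algebra_simps)
      show ?thesis unfolding \<delta>_def using k q1 by (intro *) auto
    qed
    finally show ?thesis .
  qed
  finally have "integral (bx 2) (\<lambda>x. cutoff2 x * (grad_sq x - grad_cross x))
      \<le> 12 * (40 * cutoff_const\<^sup>2 + 1) * (9 * B + 972) * \<delta>"
    by (rule vorticity_energy_le[OF \<delta>])
  moreover have "integral (bx 2) (\<lambda>x. cutoff2 x * grad_sq x)
    = integral (bx 2) (\<lambda>x. cutoff2 x * (grad_sq x - grad_cross x)) + integral (bx 2) (\<lambda>x. cutoff2 x * grad_cross x)"
    by (subst integral_add[symmetric])
      (intro smooth_integrable_bx smooth_intros smooth_cutoff2 smooth_grads | simp add: algebra_simps)+
  moreover have "9 * cutoff_const * integral (bx 2) usq \<le> 9 * cutoff_const * (129 * k)"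
    using s2 cutoff_const(1) by (intro mult_left_mono) auto
  ultimately have "integral (bx 2) (\<lambda>x. cutoff2 x * grad_sq x)
     \<le> 12 * (40 * cutoff_const\<^sup>2 + 1) * (9 * B + 972) * \<delta> + 9 * cutoff_const * (129 * k)"
    using integral_grad_cross_le by linarith
  also have "\<dots> = unit_const * k + unit_const'"
    unfolding unit_const_def unit_const'_def \<delta>_def q_def[symmetric] by (simp add: algebra_simps)
  finally show ?thesis .
qed

end

section \<open>Dilations and exhaustion by boxes\<close>

lemma integral_scale:
  fixes f :: "real^3 \<Rightarrow> real"
  assumes "continuous_on UNIV f" "L > 0"
  shows "integral (bx r) (\<lambda>x. f (L *\<^sub>R x)) = integral (bx (L * r)) f / L ^ 3"
proof -
  have "(f has_integral integral (bx (L * r)) f) (bx (L * r))"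
    by (intro integrable_integral continuous_integrable_cbox assms)
  from has_integral_affinity'[OF this assms(2), of 0]
  have "((\<lambda>x. f (L *\<^sub>R x)) has_integral integral (bx (L * r)) f / L ^ 3)
      (cbox ((- (\<chi> i. L * r)) /\<^sub>R L) ((\<chi> i. L * r) /\<^sub>R L))"
    by (simp add: divide_inverse mult.commute)
  moreover have "(- (\<chi> i. L * r)) /\<^sub>R L = (- (\<chi> i. r) :: real^3)" "(\<chi> i. L * r) /\<^sub>R L = ((\<chi> i. r) :: real^3)"
    using assms(2) by (auto simp: vec_eq_iff)
  ultimately show ?thesis by (simp only: integral_unique)
qed

lemma lborel_scale:
  fixes f :: "real^3 \<Rightarrow> real"
  assumes f [measurable]: "f \<in> borel_measurable borel" and L: "L > 0"
  shows "integrable lborel f \<Longrightarrow> integrable lborel (\<lambda>x. f (L *\<^sub>R x))"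
    and "integral\<^sup>L lborel (\<lambda>x. f (L *\<^sub>R x)) = integral\<^sup>L lborel f / L ^ 3"
proof -
  have eq: "(lborel :: (real^3) measure) = density (distr lborel borel (\<lambda>x. L *\<^sub>R x)) (\<lambda>_. ennreal (L ^ 3))"
    using lborel_affine[of L "0::real^3"] L by (simp add: ennreal_power)
  have "integrable lborel f \<longleftrightarrow> integrable lborel (\<lambda>x. L ^ 3 *\<^sub>R f (L *\<^sub>R x))"
  proof -
    have "integrable lborel f \<longleftrightarrow> integrable (density (distr lborel borel (\<lambda>x. L *\<^sub>R x)) (\<lambda>_. ennreal (L ^ 3))) f"
      using eq by (rule arg_cong)
    also have "\<dots> \<longleftrightarrow> integrable (distr lborel borel (\<lambda>x. L *\<^sub>R x)) (\<lambda>x. L ^ 3 *\<^sub>R f x)"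
      using L by (intro integrable_density) auto
    also have "\<dots> \<longleftrightarrow> integrable lborel (\<lambda>x. L ^ 3 *\<^sub>R f (L *\<^sub>R x))"
      by (intro integrable_distr_eq) auto
    finally show ?thesis .
  qed
  moreover have "integrable lborel (\<lambda>x. L ^ 3 *\<^sub>R f (L *\<^sub>R x)) \<longleftrightarrow> integrable lborel (\<lambda>x. f (L *\<^sub>R x))"
    using L by simp
  ultimately show "integrable lborel f \<Longrightarrow> integrable lborel (\<lambda>x. f (L *\<^sub>R x))" by simp
  have "integral\<^sup>L lborel f = integral\<^sup>L lborel (\<lambda>x. L ^ 3 *\<^sub>R f (L *\<^sub>R x))"
  proof -
    have "integral\<^sup>L lborel f = integral\<^sup>L (density (distr lborel borel (\<lambda>x. L *\<^sub>R x)) (\<lambda>_. ennreal (L ^ 3))) f"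
      using eq by (rule arg_cong)
    also have "\<dots> = integral\<^sup>L (distr lborel borel (\<lambda>x. L *\<^sub>R x)) (\<lambda>x. L ^ 3 *\<^sub>R f x)"
      using L by (intro integral_density) auto
    also have "\<dots> = integral\<^sup>L lborel (\<lambda>x. L ^ 3 *\<^sub>R f (L *\<^sub>R x))"
      by (intro integral_distr) auto
    finally show ?thesis .
  qed
  then show "integral\<^sup>L lborel (\<lambda>x. f (L *\<^sub>R x)) = integral\<^sup>L lborel f / L ^ 3"
    using L by simp
qed

lemma scale_mem_bx: "L > 0 \<Longrightarrow> L *\<^sub>R x \<in> bx (L * r) \<longleftrightarrow> x \<in> bx r"
  by (simp add: mem_bx abs_mult)

lemma ccube_eq_bx: "ccube (- (\<chi> i. r)) (2 * r) = bx r"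
proof -
  have "- (\<chi> i. r) + (\<chi> i. 2 * r) = ((\<chi> i. r) :: real^3)" by (simp add: vec_eq_iff)
  then show ?thesis by (simp add: ccube_def)
qed

lemma smooth_affine: "smooth f \<Longrightarrow> smooth (\<lambda>x. f (a *\<^sub>R x))"
  unfolding smooth_def using Ck_affine[where b=0] by fastforce

lemma test_fun_scale:
  fixes \<phi> :: "real^3 \<Rightarrow> real"
  assumes "test_fun \<phi>" "L > 0"
  shows "test_fun (\<lambda>x. \<phi> ((1 / L) *\<^sub>R x))"
proof -
  let ?K = "(\<lambda>x. L *\<^sub>R x) ` closure {x. \<phi> x \<noteq> 0}"
  have K: "compact ?K"
    using assms by (intro compact_continuous_image continuous_intros) (auto simp: test_fun_def)
  have "{x. \<phi> ((1 / L) *\<^sub>R x) \<noteq> 0} \<subseteq> ?K"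
  proof
    fix x assume "x \<in> {x. \<phi> ((1 / L) *\<^sub>R x) \<noteq> 0}"
    then have "(1 / L) *\<^sub>R x \<in> {x. \<phi> x \<noteq> 0}" by simp
    then have "(1 / L) *\<^sub>R x \<in> closure {x. \<phi> x \<noteq> 0}" by (rule subsetD[OF closure_subset])
    moreover have "x = L *\<^sub>R ((1 / L) *\<^sub>R x)" using assms(2) by simp
    ultimately show "x \<in> ?K" by (rule rev_image_eqI)
  qed
  then have "closure {x. \<phi> ((1 / L) *\<^sub>R x) \<noteq> 0} \<subseteq> ?K"
    by (rule closure_minimal) (rule compact_imp_closed[OF K])
  then have "compact (closure {x. \<phi> ((1 / L) *\<^sub>R x) \<noteq> 0})"
    using bounded_subset[OF compact_imp_bounded[OF K]] by (auto simp: compact_eq_bounded_closed)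
  then show ?thesis using assms(1) smooth_affine by (auto simp: test_fun_def)
qed

lemma set_lebesgue_scale:
  fixes f :: "real^3 \<Rightarrow> real"
  assumes f: "f \<in> borel_measurable borel" and L: "L > 0"
  shows "set_integrable lborel (bx (L * r)) f \<Longrightarrow> set_integrable lborel (bx r) (\<lambda>x. f (L *\<^sub>R x))"
    and "(LINT x:bx r|lborel. f (L *\<^sub>R x)) = (LINT x:bx (L * r)|lborel. f x) / L ^ 3"
proof -
  have m: "(\<lambda>x. indicator (bx (L * r)) x *\<^sub>R f x) \<in> borel_measurable borel"
    using f by (intro borel_measurable_scaleR borel_measurable_indicator) auto
  have i: "indicator (bx (L * r)) (L *\<^sub>R x) = (indicator (bx r) x :: real)" for x
    using scale_mem_bx[OF L] by (simp add: indicator_def del: mem_box_cart)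
  show "set_integrable lborel (bx (L * r)) f \<Longrightarrow> set_integrable lborel (bx r) (\<lambda>x. f (L *\<^sub>R x))"
    using lborel_scale(1)[OF m L] unfolding set_integrable_def i .
  show "(LINT x:bx r|lborel. f (L *\<^sub>R x)) = (LINT x:bx (L * r)|lborel. f x) / L ^ 3"
    using lborel_scale(2)[OF m L] unfolding set_lebesgue_integral_def i .
qed

lemma integral_bx_tendsto:
  fixes f :: "real^3 \<Rightarrow> real"
  assumes c: "continuous_on UNIV f" and f: "integrable lborel f"
  shows "(\<lambda>n. integral (bx (real n)) f) \<longlonglongrightarrow> integral\<^sup>L lborel f"
proof -
  have UN: "(\<Union>n. bx (real n)) = UNIV"
  proof -
    have "x \<in> (\<Union>n. bx (real n))" for x
    proof -
      obtain n where "norm x \<le> real n" using real_arch_simple by blast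
      then show ?thesis using mem_bx_norm[of x "real n"] by blast
    qed
    then show ?thesis by blast
  qed
  have "(\<lambda>n. LINT x:bx (real n)|lborel. f x) \<longlonglongrightarrow> (LINT x:(\<Union>n. bx (real n))|lborel. f x)"
  proof (rule set_integral_cont_up)
    show "incseq (\<lambda>n. bx (real n))" by (intro incseq_SucI bx_mono) simp
    show "set_integrable lborel (\<Union>n. bx (real n)) f" unfolding UN using f by (simp add: set_integrable_def)
  qed simp
  moreover have "(LINT x:bx (real n)|lborel. f x) = integral (bx (real n)) f" for n
    by (rule set_borel_integral_eq_integral(2)[OF set_integrable_cbox_continuous[OF c]])
  ultimately show ?thesis unfolding UN by (simp add: set_lebesgue_integral_def)
qed

lemma integral_bx_le_lborel:
  fixes f :: "real^3 \<Rightarrow> real"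
  assumes c: "continuous_on UNIV f" and f: "integrable lborel f" and "\<And>x. f x \<ge> 0"
  shows "integral (bx r) f \<le> integral\<^sup>L lborel f"
proof -
  have "integral (bx r) f = (LINT x:bx r|lborel. f x)"
    by (rule set_borel_integral_eq_integral(2)[OF set_integrable_cbox_continuous[OF c], symmetric])
  also have "\<dots> \<le> integral\<^sup>L lborel f"
    unfolding set_lebesgue_integral_def
    by (rule integral_mono)
      (use set_integrable_cbox_continuous[OF c] f assms(3) in \<open>auto simp: set_integrable_def indicator_def\<close>)
  finally show ?thesis .
qed

text \<open>Far out one uses \<open>q^2 \<le> \<beta> q^3 + 1 / \<beta>^2\<close> with \<open>\<beta>\<close> proportional to L.\<close>

lemma square_integral_sublinear:
  fixes q :: "real^3 \<Rightarrow> real"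
  assumes c: "continuous_on UNIV q" and q0: "\<And>x. q x \<ge> 0" and int: "integrable lborel (\<lambda>x. q x ^ 3)"
    and e: "e > 0"
  shows "\<exists>L0>0. \<forall>L\<ge>L0. integral (bx (4 * L)) (\<lambda>x. (q x)\<^sup>2) \<le> e * L"
proof -
  have c3: "continuous_on UNIV (\<lambda>x. q x ^ 3)" by (intro continuous_intros c)
  define T where "T = integral\<^sup>L lborel (\<lambda>x. q x ^ 3)"
  \<comment> \<open>1536 is 3 * 8^3: the volume (8 L)^3 divided by \<beta>^2 must not exceed e L /
    3.\<close>
  define \<alpha> where "\<alpha> = 1536 / e + 1"
  have \<alpha>: "\<alpha> \<ge> 1" "\<alpha> * e \<ge> 1536" using e by (auto simp: \<alpha>_def field_simps)
  have "(\<lambda>n. integral (bx (real n)) (\<lambda>x. q x ^ 3)) \<longlonglongrightarrow> T"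
    unfolding T_def by (rule integral_bx_tendsto[OF c3 int])
  then have "eventually (\<lambda>n. integral (bx (real n)) (\<lambda>x. q x ^ 3) > T - e / (3 * \<alpha>)) sequentially"
    using e \<alpha> by (intro order_tendstoD) auto
  then obtain n where n: "integral (bx (real n)) (\<lambda>x. q x ^ 3) > T - e / (3 * \<alpha>)"
    by (auto simp: eventually_sequentially)
  define K where "K = integral (bx (real n)) (\<lambda>x. (q x)\<^sup>2)"
  define L0 where "L0 = max 1 (max (real n) (3 * K / e))"
  have "integral (bx (4 * L)) (\<lambda>x. (q x)\<^sup>2) \<le> e * L" if L: "L \<ge> L0" for L
  proof -
    have L': "L \<ge> 1" "L \<ge> real n" "L \<ge> 3 * K / e" using L by (auto simp: L0_def)
    define \<beta> where "\<beta> = \<alpha> * L"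
    have \<beta>: "\<beta> > 0" using \<alpha> L' by (simp add: \<beta>_def)
    \<comment> \<open>As F is nonnegative, its integral over the fixed box is at most that over the
      large one. So the large factor \<beta> meets only the tail of the integral of q^3, at most e /
      (3 \<alpha>).\<close>
    define F where "F = (\<lambda>x. \<beta> * q x ^ 3 + 1 / \<beta>\<^sup>2 - (q x)\<^sup>2)"
    have cF: "continuous_on UNIV F" unfolding F_def by (intro continuous_intros c)
    have F0: "F x \<ge> 0" for x
    proof (cases "\<beta> * q x \<ge> 1")
      case True
      then have "1 * (q x)\<^sup>2 \<le> (\<beta> * q x) * (q x)\<^sup>2" by (intro mult_right_mono) auto
      then have "(q x)\<^sup>2 \<le> \<beta> * q x ^ 3" by (simp add: power2_eq_square power3_eq_cube mult.assoc)
      moreover have "0 \<le> 1 / \<beta>\<^sup>2" by simp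
      ultimately show ?thesis unfolding F_def by linarith
    next
      case False
      then have "q x \<le> 1 / \<beta>" using \<beta> by (simp add: field_simps)
      then have "(q x)\<^sup>2 \<le> (1 / \<beta>)\<^sup>2" by (intro power_mono q0)
      moreover have "0 \<le> \<beta> * q x ^ 3" using \<beta> q0[of x] by simp
      ultimately show ?thesis by (simp add: F_def power_divide)
    qed
    have split: "integral (bx r) F = \<beta> * integral (bx r) (\<lambda>x. q x ^ 3) + 1 / \<beta>\<^sup>2 * (2 * r) ^ 3
        - integral (bx r) (\<lambda>x. (q x)\<^sup>2)" if "r \<ge> 0" for r
    proof -
      have "integral (bx r) F = integral (bx r) (\<lambda>x. \<beta> * q x ^ 3 + 1 / \<beta>\<^sup>2) - integral (bx r) (\<lambda>x. (q x)\<^sup>2)"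
        unfolding F_def by (intro integral_diff continuous_integrable_cbox continuous_intros c)
      also have "integral (bx r) (\<lambda>x. \<beta> * q x ^ 3 + 1 / \<beta>\<^sup>2)
        = \<beta> * integral (bx r) (\<lambda>x. q x ^ 3) + 1 / \<beta>\<^sup>2 * (2 * r) ^ 3"
        using that by (subst integral_add) (auto intro!: continuous_integrable_cbox continuous_intros c simp: content_bx)
      finally show ?thesis .
    qed
    have "integral (bx (real n)) F \<le> integral (bx (4 * L)) F"
      using L' by (intro integral_subset_le bx_mono continuous_integrable_cbox cF) (auto simp: F0)
    then have "integral (bx (4 * L)) (\<lambda>x. (q x)\<^sup>2) \<le> \<beta> * integral (bx (4 * L)) (\<lambda>x. q x ^ 3) + 1 / \<beta>\<^sup>2 * (8 * L) ^ 3
        - (\<beta> * integral (bx (real n)) (\<lambda>x. q x ^ 3) + 1 / \<beta>\<^sup>2 * (2 * real n) ^ 3) + K"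
      using split[of "4 * L"] split[of "real n"] L' by (simp add: K_def)
    also have "\<dots> \<le> \<beta> * integral (bx (4 * L)) (\<lambda>x. q x ^ 3) - \<beta> * integral (bx (real n)) (\<lambda>x. q x ^ 3)
        + 1 / \<beta>\<^sup>2 * (8 * L) ^ 3 + K"
      by simp
    also have "\<beta> * integral (bx (4 * L)) (\<lambda>x. q x ^ 3) - \<beta> * integral (bx (real n)) (\<lambda>x. q x ^ 3) \<le> e / 3 * L"
    proof -
      have "integral (bx (4 * L)) (\<lambda>x. q x ^ 3) - integral (bx (real n)) (\<lambda>x. q x ^ 3) \<le> e / (3 * \<alpha>)"
        using integral_bx_le_lborel[OF c3 int, of "4 * L"] q0 n unfolding T_def by simp
      then have "\<beta> * (integral (bx (4 * L)) (\<lambda>x. q x ^ 3) - integral (bx (real n)) (\<lambda>x. q x ^ 3)) \<le> \<beta> * (e / (3 * \<alpha>))"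
        using \<beta> by (intro mult_left_mono) auto
      also have "\<dots> = e / 3 * L" using \<alpha> by (simp add: \<beta>_def)
      finally show ?thesis by (simp add: right_diff_distrib)
    qed
    also have "1 / \<beta>\<^sup>2 * (8 * L) ^ 3 \<le> e / 3 * L"
    proof -
      have "1536 \<le> \<alpha> * e" by (rule \<alpha>)
      also have "\<dots> \<le> \<alpha> * (\<alpha> * e)" using \<alpha> by (intro mult_left_mono[of 1 \<alpha>, simplified] mult_le_cancel_right1[THEN iffD2]) auto
      finally have "512 \<le> \<alpha>\<^sup>2 * (e / 3)" by (simp add: power2_eq_square)
      then have "512 * L ^ 3 \<le> (\<alpha>\<^sup>2 * (e / 3)) * L ^ 3" using L' by (intro mult_right_mono) auto
      also have "\<dots> = \<beta>\<^sup>2 * (e / 3 * L)" by (simp add: \<beta>_def power2_eq_square power3_eq_cube)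
      finally show ?thesis using \<beta> by (simp add: divide_le_eq power_mult_distrib mult.commute)
    qed
    also have "K \<le> e / 3 * L" using L'(3) e by (simp add: field_simps)
    finally show ?thesis by linarith
  qed
  moreover have "L0 > 0" by (simp add: L0_def)
  ultimately show ?thesis by blast
qed

section \<open>The Liouville argument\<close>

lemma pd_scaled_smooth:
  fixes f :: "real^3 \<Rightarrow> real"
  shows "smooth f \<Longrightarrow> pd j (\<lambda>x. c * f (a *\<^sub>R x)) = (\<lambda>x. (c * a) * pd j f (a *\<^sub>R x))"
  by (rule pd_scaled[OF smooth_Ck])

lemma (in stationary_NS) rescale:
  "stationary_NS (\<lambda>i x. L * U i (L *\<^sub>R x)) (\<lambda>x. L\<^sup>2 * P (L *\<^sub>R x))"
proof
  show "smooth (\<lambda>x. L * U i (L *\<^sub>R x))" for i by (intro smooth_intros smooth_affine smooth_U)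
  show "smooth (\<lambda>x. L\<^sup>2 * P (L *\<^sub>R x))" by (intro smooth_intros smooth_affine smooth_P)
  show "(\<Sum>j\<in>UNIV. pd j (\<lambda>x. L * U j (L *\<^sub>R x)) x) = 0" for x
    using incompressible[of "L *\<^sub>R x"] by (simp add: pd_scaled_smooth smooth_U sum_distrib_left[symmetric])
  show "pd i (\<lambda>x. L\<^sup>2 * P (L *\<^sub>R x)) x = (\<Sum>j\<in>UNIV. pd j (pd j (\<lambda>x. L * U i (L *\<^sub>R x))) x)
      - (\<Sum>j\<in>UNIV. L * U j (L *\<^sub>R x) * pd j (\<lambda>x. L * U i (L *\<^sub>R x)) x)" for i x
    unfolding pd_scaled_smooth[OF smooth_U] pd_scaled_smooth[OF smooth_P]
      pd_scaled_smooth[OF smooth_pd[OF smooth_U]] momentum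
    by (simp add: right_diff_distrib sum_distrib_left power2_eq_square mult_ac)
qed

locale global_NS_BMO = stationary_NS +
  fixes d :: "3 \<Rightarrow> 3 \<Rightarrow> real^3 \<Rightarrow> real"
  assumes skew: "\<And>i j x. d i j x = - d j i x" and BMO_d: "\<And>i j. BMO (d i j)"
    and weak_div: "\<And>\<phi> i. test_fun \<phi> \<Longrightarrow> integral\<^sup>L lborel (\<lambda>x. U i x * \<phi> x)
      = - (\<Sum>j\<in>UNIV. integral\<^sup>L lborel (\<lambda>x. d i j x * pd j \<phi> x))"
begin

text \<open>L u(L x) is the divergence of d(L x), so the potential scales with degree 0, and
  \<open>BMO_pairing\<close> holds on all cubes with the same constant. Dividing by L^3 brings it
  back to unit scale, uniformly in L.\<close>

lemma rescaled_NS_BMO: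
  "\<exists>B. \<forall>L>0. NS_BMO (\<lambda>i x. L * U i (L *\<^sub>R x)) (\<lambda>x. L\<^sup>2 * P (L *\<^sub>R x))
    (\<lambda>i j x. d i j (L *\<^sub>R x)) (\<lambda>i j. cube_avg (d i j) (- (\<chi> i. 2 * L)) (4 * L)) B"
proof -
  define Q where "Q i j B \<longleftrightarrow> 0 \<le> B \<and> (\<forall>a l \<theta> G X S. l > 0 \<longrightarrow> \<theta> > 0 \<longrightarrow>
    continuous_on UNIV G \<longrightarrow> continuous_on UNIV X \<longrightarrow> continuous_on UNIV S \<longrightarrow>
    (\<forall>x\<in>ccube a l. 0 \<le> X x \<and> 0 \<le> S x \<and> (G x)\<^sup>2 \<le> X x * S x ^ 3) \<longrightarrow>
    \<bar>LINT x:ccube a l|lborel. (d i j x - cube_avg (d i j) a l) * G x\<bar>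
      \<le> \<theta> * integral (ccube a l) X + (B * l ^ 3 + integral (ccube a l) (\<lambda>x. S x ^ 4)) / \<theta>)" for i j B
  have "\<exists>B. Q i j B" for i j
    using BMO_pairing[OF BMO_d[of i j]] unfolding Q_def by simp
  then obtain b where b: "\<And>i j. Q i j (b i j)" by metis
  have b0: "b i j \<ge> 0" for i j using b[of i j] by (simp add: Q_def)
  \<comment> \<open>64 = 4^3, the volume of the cube of side 4 at unit scale; the sum dominates all
    nine entries.\<close>
  define B where "B = 64 * (\<Sum>i\<in>UNIV. \<Sum>j\<in>UNIV. b i j)"
  have bB: "64 * b i j \<le> B" for i j
  proof -
    have "b i j \<le> (\<Sum>j\<in>UNIV. b i j)" by (rule member_le_sum) (auto simp: b0)
    also have "\<dots> \<le> (\<Sum>i\<in>UNIV. \<Sum>j\<in>UNIV. b i j)"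
      by (rule member_le_sum[of i UNIV "\<lambda>i. \<Sum>j\<in>UNIV. b i j"]) (auto simp: b0 intro: sum_nonneg)
    finally show ?thesis by (simp add: B_def)
  qed
  have "NS_BMO (\<lambda>i x. L * U i (L *\<^sub>R x)) (\<lambda>x. L\<^sup>2 * P (L *\<^sub>R x))
    (\<lambda>i j x. d i j (L *\<^sub>R x)) (\<lambda>i j. cube_avg (d i j) (- (\<chi> i. 2 * L)) (4 * L)) B" if L: "L > 0" for L
  proof -
    interpret s: stationary_NS "\<lambda>i x. L * U i (L *\<^sub>R x)" "\<lambda>x. L\<^sup>2 * P (L *\<^sub>R x)" by (rule rescale)
    have dm [measurable]: "d i j \<in> borel_measurable borel" for i j using BMO_d[of i j] by (simp add: BMO_def)
    have cube: "ccube (- (\<chi> i. 2 * L)) (4 * L) = bx (L * 2)"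
      using ccube_eq_bx[of "2 * L"] by (simp add: mult.commute)
    show ?thesis
    proof
      show "d i j (L *\<^sub>R x) = - d j i (L *\<^sub>R x)" for i j x by (rule skew)
      show "cube_avg (d i j) (- (\<chi> i. 2 * L)) (4 * L) = - cube_avg (d j i) (- (\<chi> i. 2 * L)) (4 * L)" for i j
      proof -
        have "(LINT x:A|lborel. d i j x) = - (LINT x:A|lborel. d j i x)" for A
          unfolding set_lebesgue_integral_def skew[of i j] by simp
        then show ?thesis by (simp only: cube_avg_def minus_divide_left)
      qed
      show "set_integrable lborel (bx 2) (\<lambda>x. d i j (L *\<^sub>R x))" for i j
      proof (rule set_lebesgue_scale(1)[OF dm L])
        have "set_integrable lborel (ball 0 (10 * L)) (d i j)" using BMO_d[of i j] L by (simp add: BMO_def)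
        moreover have "bx (L * 2) \<in> sets lborel" by simp
        moreover have "bx (L * 2) \<subseteq> ball 0 (10 * L)"
        proof
          fix x assume "x \<in> bx (L * 2)"
          then have "(\<Sum>i\<in>UNIV. \<bar>x $ i\<bar>) \<le> (\<Sum>i\<in>(UNIV::3 set). L * 2)"
            unfolding mem_bx by (intro sum_mono) auto
          then have "norm x \<le> 6 * L" using norm_le_l1_cart[of x] by simp
          then show "x \<in> ball 0 (10 * L)" using L by simp
        qed
        ultimately show "set_integrable lborel (bx (L * 2)) (d i j)" by (rule set_integrable_subset)
      qed
    next
      fix \<phi> :: "real^3 \<Rightarrow> real" and i
      assume \<phi>: "test_fun \<phi>"
      define \<psi> where "\<psi> = (\<lambda>x. \<phi> ((1 / L) *\<^sub>R x))"
      have \<psi>: "test_fun \<psi>" unfolding \<psi>_def by (rule test_fun_scale[OF \<phi> L])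
      have s\<phi>: "smooth \<phi>" and s\<psi>: "smooth \<psi>" using \<phi> \<psi> by (auto simp: test_fun_def)
      have pd\<psi>: "pd j \<psi> (L *\<^sub>R x) = (1 / L) * pd j \<phi> x" for j x
        using pd_scaled_smooth[OF s\<phi>, of j 1 "1 / L"] L by (simp add: \<psi>_def)
      have m: "(\<lambda>x. U i x * \<psi> x) \<in> borel_measurable borel" "(\<lambda>x. d i j x * pd j \<psi> x) \<in> borel_measurable borel" for j
        by (intro borel_measurable_times dm borel_measurable_continuous_onI continuous_U smooth_continuous smooth_pd s\<psi>)+
      have "integral\<^sup>L lborel (\<lambda>x. L * U i (L *\<^sub>R x) * \<phi> x) = L * integral\<^sup>L lborel (\<lambda>x. U i (L *\<^sub>R x) * \<psi> (L *\<^sub>R x))"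
        using L by (simp add: \<psi>_def mult.assoc)
      also have "\<dots> = L * (integral\<^sup>L lborel (\<lambda>x. U i x * \<psi> x) / L ^ 3)"
        using lborel_scale(2)[OF m(1) L] by simp
      also have "\<dots> = - (\<Sum>j\<in>UNIV. L * (integral\<^sup>L lborel (\<lambda>x. d i j x * pd j \<psi> x) / L ^ 3))"
        unfolding weak_div[OF \<psi>] by (simp add: sum_divide_distrib sum_distrib_left)
      also have "\<dots> = - (\<Sum>j\<in>UNIV. L * integral\<^sup>L lborel (\<lambda>x. d i j (L *\<^sub>R x) * pd j \<psi> (L *\<^sub>R x)))"
        using lborel_scale(2)[OF m(2) L] by simp
      also have "\<dots> = - (\<Sum>j\<in>UNIV. integral\<^sup>L lborel (\<lambda>x. d i j (L *\<^sub>R x) * pd j \<phi> x))"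
        unfolding pd\<psi> mult.left_commute[of _ "1 / L"] integral_mult_right_zero using L by simp
      finally show "integral\<^sup>L lborel (\<lambda>x. L * U i (L *\<^sub>R x) * \<phi> x)
        = - (\<Sum>j\<in>UNIV. integral\<^sup>L lborel (\<lambda>x. d i j (L *\<^sub>R x) * pd j \<phi> x))" .
    next
      fix i j and \<theta> :: real and G X S :: "real^3 \<Rightarrow> real"
      assume \<theta>: "\<theta> > 0" and G: "continuous_on UNIV G" and X: "continuous_on UNIV X" and S: "continuous_on UNIV S"
        and GXS: "\<And>x. x \<in> bx 2 \<Longrightarrow> 0 \<le> X x \<and> 0 \<le> S x \<and> (G x)\<^sup>2 \<le> X x * S x ^ 3"
      let ?c = "cube_avg (d i j) (- (\<chi> i. 2 * L)) (4 * L)"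
      define s where "s f = (\<lambda>x. f ((1 / L) *\<^sub>R x))" for f :: "real^3 \<Rightarrow> real"
      have cs: "continuous_on UNIV (s f)" if "continuous_on UNIV f" for f
        unfolding s_def by (intro continuous_on_compose2[OF that] continuous_intros) auto
      have sL: "s f (L *\<^sub>R x) = f x" for f x using L by (simp add: s_def)
      have mem: "(1 / L) *\<^sub>R x \<in> bx 2" if "x \<in> bx (L * 2)" for x
        using scale_mem_bx[OF L, of "(1 / L) *\<^sub>R x" 2] that L by simp
      have m: "(\<lambda>x. (d i j x - ?c) * s G x) \<in> borel_measurable borel"
        by (intro borel_measurable_times borel_measurable_diff dm borel_measurable_const
            borel_measurable_continuous_onI cs G)
      have "\<bar>LINT x:bx (L * 2)|lborel. (d i j x - ?c) * s G x\<bar>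
        \<le> \<theta> * integral (bx (L * 2)) (s X) + (b i j * (4 * L) ^ 3 + integral (bx (L * 2)) (\<lambda>x. s S x ^ 4)) / \<theta>"
        using b[of i j, unfolded Q_def, THEN conjunct2, rule_format, of "4 * L" \<theta> "s G" "s X" "s S" "- (\<chi> i. 2 * L)"]
          L \<theta> cs G X S GXS mem unfolding cube by (simp add: s_def)
      then have "\<bar>LINT x:bx (L * 2)|lborel. (d i j x - ?c) * s G x\<bar> / L ^ 3
        \<le> (\<theta> * integral (bx (L * 2)) (s X) + (b i j * (4 * L) ^ 3 + integral (bx (L * 2)) (\<lambda>x. s S x ^ 4)) / \<theta>) / L ^ 3"
        using L by (intro divide_right_mono) auto
      also have "\<dots> = \<theta> * (integral (bx (L * 2)) (s X) / L ^ 3) + (64 * b i j + integral (bx (L * 2)) (\<lambda>x. s S x ^ 4) / L ^ 3) / \<theta>"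
        using L \<theta> by (simp add: field_simps power_mult_distrib)
      also have "integral (bx (L * 2)) (s X) / L ^ 3 = integral (bx 2) X"
        using integral_scale[OF cs[OF X] L, of 2] by (simp add: sL)
      also have "integral (bx (L * 2)) (\<lambda>x. s S x ^ 4) / L ^ 3 = integral (bx 2) (\<lambda>x. S x ^ 4)"
        using integral_scale[of "\<lambda>x. s S x ^ 4" L 2] cs[OF S] L by (simp add: sL continuous_on_power)
      also have "\<bar>LINT x:bx (L * 2)|lborel. (d i j x - ?c) * s G x\<bar> / L ^ 3 = \<bar>LINT x:bx 2|lborel. (d i j (L *\<^sub>R x) - ?c) * G x\<bar>"
        using set_lebesgue_scale(2)[OF m L, of 2] L by (simp add: sL)
      also have "\<theta> * integral (bx 2) X + (64 * b i j + integral (bx 2) (\<lambda>x. S x ^ 4)) / \<theta>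
        \<le> \<theta> * integral (bx 2) X + (B + integral (bx 2) (\<lambda>x. S x ^ 4)) / \<theta>"
        using bB[of i j] \<theta> by (intro add_left_mono divide_right_mono) auto
      finally show "\<bar>LINT x:bx 2|lborel. (d i j (L *\<^sub>R x) - ?c) * G x\<bar>
        \<le> \<theta> * integral (bx 2) X + (B + integral (bx 2) (\<lambda>x. S x ^ 4)) / \<theta>" .
    qed
  qed
  then show ?thesis by blast
qed

text \<open>For the rescaled solution \<open>A4\<close> is L times a local integral of |u|^4, hence
  at most (e L)^2 for large L, and the gradient energy is L times that of u. The unit estimate reads
  C e L + C', and division by L leaves a multiple of e.\<close>

lemma gradient_vanishes:
  assumes int: "integrable lborel (\<lambda>x. usq x ^ 3)"
  shows "grad_sq x = 0"
proof -
  have cg: "continuous_on UNIV grad_sq" by (rule smooth_continuous[OF smooth_grads(1)])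
  have g0: "grad_sq y \<ge> 0" for y unfolding grad_sq_def by (intro sum_nonneg) auto
  have u0: "usq y \<ge> 0" for y unfolding usq_def by (intro sum_nonneg) auto
  obtain B where B: "\<And>L. L > 0 \<Longrightarrow> NS_BMO (\<lambda>i x. L * U i (L *\<^sub>R x)) (\<lambda>x. L\<^sup>2 * P (L *\<^sub>R x))
    (\<lambda>i j x. d i j (L *\<^sub>R x)) (\<lambda>i j. cube_avg (d i j) (- (\<chi> i. 2 * L)) (4 * L)) B"
    using rescaled_NS_BMO by blast
  define C where "C = NS_BMO.unit_const B"
  define C' where "C' = NS_BMO.unit_const' B"
  define r where "r = norm x + 1"
  have r: "r > 0" by (simp add: r_def add_nonneg_pos)
  have small: "integral (bx r) grad_sq \<le> exp 1 * ((C + \<bar>C'\<bar>) * e)" if e: "e > 0" for e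
  proof -
    obtain L0 where L0: "L0 > 0" "\<And>L. L \<ge> L0 \<Longrightarrow> integral (bx (4 * L)) (\<lambda>x. (usq x)\<^sup>2) \<le> e\<^sup>2 * L"
      using square_integral_sublinear[OF continuous_usq u0 int, of "e\<^sup>2"] e by auto
    \<comment> \<open>3 r puts the rescaled box into the unit ball, where the cutoff is bounded
      below, and 1 / e makes C' at most |C'| e L.\<close>
    define L where "L = max L0 (max (3 * r) (1 / e))"
    have L: "L > 0" "L \<ge> L0" "L \<ge> 3 * r" "L \<ge> 1 / e" using L0 by (auto simp: L_def)
    interpret s: NS_BMO "\<lambda>i x. L * U i (L *\<^sub>R x)" "\<lambda>x. L\<^sup>2 * P (L *\<^sub>R x)"
      "\<lambda>i j x. d i j (L *\<^sub>R x)" "\<lambda>i j. cube_avg (d i j) (- (\<chi> i. 2 * L)) (4 * L)" B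
      by (rule B[OF L(1)])
    have susq: "s.usq y = L\<^sup>2 * usq (L *\<^sub>R y)" for y
      by (simp add: s.usq_def usq_def power_mult_distrib sum_distrib_left)
    have sgrad: "s.grad_sq y = L ^ 4 * grad_sq (L *\<^sub>R y)" for y
    proof -
      have "(L * L * z)\<^sup>2 = L ^ 4 * z\<^sup>2" for z :: real by (simp add: eval_nat_numeral)
      then show ?thesis
        by (simp add: s.grad_sq_def grad_sq_def pd_scaled_smooth smooth_U sum_distrib_left)
    qed
    have "s.A4 = integral (bx 4) (\<lambda>y. L ^ 4 * (usq (L *\<^sub>R y))\<^sup>2)"
      unfolding s.A4_def susq by (simp add: power_mult_distrib)
    also have "\<dots> = L ^ 4 * (integral (bx (L * 4)) (\<lambda>y. (usq y)\<^sup>2) / L ^ 3)"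
      using integral_scale[of "\<lambda>y. (usq y)\<^sup>2" L 4] continuous_usq L(1) by (simp add: continuous_on_power)
    also have "\<dots> = L * integral (bx (4 * L)) (\<lambda>y. (usq y)\<^sup>2)"
      using L(1) by (simp add: eval_nat_numeral mult.commute)
    also have "\<dots> \<le> L * (e\<^sup>2 * L)" using L0(2)[OF L(2)] L(1) by (intro mult_left_mono) auto
    finally have "s.A4 \<le> (e * L)\<^sup>2" by (simp add: power2_eq_square mult_ac)
    then have up: "integral (bx 2) (\<lambda>y. cutoff2 y * s.grad_sq y) \<le> C * (e * L) + C'"
      unfolding C_def C'_def using e L(1) by (intro s.unit_gradient_estimate) auto
    have csg: "continuous_on UNIV s.grad_sq" by (rule smooth_continuous[OF s.smooth_grads(1)])
    have ccut: "continuous_on UNIV cutoff2" by (rule smooth_continuous[OF smooth_cutoff2])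
    have sg0: "s.grad_sq y \<ge> 0" for y unfolding sgrad using g0 by simp
    have "exp (-1) * (L * integral (bx r) grad_sq) = integral (bx (r / L)) (\<lambda>y. exp (-1) * s.grad_sq y)"
    proof -
      have "integral (bx (r / L)) (\<lambda>y. grad_sq (L *\<^sub>R y)) = integral (bx r) grad_sq / L ^ 3"
        using integral_scale[OF cg L(1), of "r / L"] L(1) by simp
      then show ?thesis unfolding sgrad using L(1) by (simp add: eval_nat_numeral)
    qed
    also have "\<dots> \<le> integral (bx (r / L)) (\<lambda>y. cutoff2 y * s.grad_sq y)"
    proof (intro integral_le continuous_integrable_cbox continuous_intros csg ccut)
      fix y assume y: "y \<in> bx (r / L)"
      have "norm y \<le> (\<Sum>i\<in>UNIV. \<bar>y $ i\<bar>)" by (rule norm_le_l1_cart)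
      also have "\<dots> \<le> (\<Sum>i\<in>(UNIV::3 set). r / L)" using y unfolding mem_bx by (intro sum_mono) auto
      also have "\<dots> \<le> 1" using L by simp
      finally show "exp (-1) * s.grad_sq y \<le> cutoff2 y * s.grad_sq y"
        by (intro mult_right_mono cutoff2_ge sg0)
    qed
    also have "\<dots> \<le> integral (bx 2) (\<lambda>y. cutoff2 y * s.grad_sq y)"
    proof (intro integral_subset_le continuous_integrable_cbox continuous_intros csg ccut ballI mult_nonneg_nonneg cutoff2_nonneg sg0)
      have "r / L \<le> 2" using L r by (simp add: field_simps)
      then show "bx (r / L) \<subseteq> bx 2" by (rule bx_mono)
    qed
    finally have "exp (-1) * (L * integral (bx r) grad_sq) \<le> C * (e * L) + C'" using up by linarith
    also have "\<dots> \<le> L * ((C + \<bar>C'\<bar>) * e)"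
    proof -
      have "1 \<le> L * e" using L(4) e by (simp add: field_simps)
      then have "1 * \<bar>C'\<bar> \<le> (L * e) * \<bar>C'\<bar>" by (intro mult_right_mono) auto
      then show ?thesis by (simp add: algebra_simps)
    qed
    finally have "L * (exp (-1) * integral (bx r) grad_sq) \<le> L * ((C + \<bar>C'\<bar>) * e)" by (simp add: mult_ac)
    then have "exp (-1) * integral (bx r) grad_sq \<le> (C + \<bar>C'\<bar>) * e" using L(1) by simp
    then have "exp 1 * (exp (-1) * integral (bx r) grad_sq) \<le> exp 1 * ((C + \<bar>C'\<bar>) * e)"
      by (intro mult_left_mono) auto
    then show ?thesis by (simp add: mult.assoc[symmetric] exp_add[symmetric])
  qed
  have "integral (bx r) grad_sq \<le> 0"
  proof (rule field_le_epsilon)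
    fix e :: real assume e: "e > 0"
    define M where "M = exp 1 * (\<bar>C\<bar> + \<bar>C'\<bar> + 1)"
    have M: "M > 0" by (simp add: M_def add_nonneg_pos)
    have "integral (bx r) grad_sq \<le> exp 1 * ((C + \<bar>C'\<bar>) * (e / M))" using e M by (intro small) simp
    also have "\<dots> \<le> exp 1 * ((\<bar>C\<bar> + \<bar>C'\<bar> + 1) * (e / M))"
      using e M by (intro mult_left_mono mult_right_mono) auto
    also have "\<dots> = M * (e / M)" by (simp only: M_def mult.assoc)
    also have "\<dots> = e" using M by simp
    finally show "integral (bx r) grad_sq \<le> 0 + e" by simp
  qed
  moreover have "integral (bx r) grad_sq \<ge> 0"
    by (intro integral_nonneg continuous_integrable_cbox cg g0)
  ultimately have "(grad_sq has_integral 0) (bx r)"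
    using integrable_integral[OF continuous_integrable_cbox[OF cg]] by (metis order_antisym)
  then show ?thesis
  proof (rule has_integral_0_cbox_imp_0[rotated 2])
    show "continuous_on (bx r) grad_sq" using cg continuous_on_subset by blast
    show "x \<in> bx r" by (rule mem_bx_norm) (simp add: r_def)
    show "box (- (\<chi> i. r)) (\<chi> i. r) \<noteq> ({} :: (real^3) set)"
      using r by (simp add: interval_ne_empty_cart)
  qed (rule g0)
qed

text \<open>A vanishing gradient makes u constant. The integral of |u|^4 over
  \<open>bx (4 * L)\<close> would then grow like L^3, against
  \<open>square_integral_sublinear\<close>, unless u = 0.\<close>

theorem vanishes:
  assumes int: "integrable lborel (\<lambda>x. usq x ^ 3)"
  shows "U i x = 0"
proof -
  have pd0: "pd k (U i) y = 0" for k i y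
  proof -
    have "(pd k (U i) y)\<^sup>2 \<le> (\<Sum>i\<in>UNIV. (pd k (U i) y)\<^sup>2)" by (rule member_le_sum) auto
    also have "\<dots> \<le> grad_sq y" unfolding grad_sq_def
      by (rule member_le_sum[of k UNIV "\<lambda>k. \<Sum>i\<in>UNIV. (pd k (U i) y)\<^sup>2"]) (auto intro: sum_nonneg)
    finally show ?thesis using gradient_vanishes[OF int, of y] by simp
  qed
  have const: "U i y = U i 0" for i y
  proof -
    have "(U i has_derivative (\<lambda>h. 0)) (at y within UNIV)" for y
    proof -
      have d: "U i differentiable at y" by (rule smooth_differentiable[OF smooth_U])
      have "frechet_derivative (U i) (at y) = (\<lambda>h. 0)"
        by (rule ext) (simp add: frechet_derivative_pd_sum[OF d] pd0)
      then show ?thesis using iffD1[OF frechet_derivative_works d] by simp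
    qed
    from has_derivative_zero_unique[OF convex_UNIV this] show ?thesis by auto
  qed
  have usq: "usq y = usq 0" for y unfolding usq_def using const by (metis (no_types, lifting) sum.cong)
  have u0: "usq y \<ge> 0" for y unfolding usq_def by (intro sum_nonneg) auto
  have "512 * (usq 0)\<^sup>2 \<le> 0 + e" if e: "e > 0" for e
  proof -
    obtain L0 where L0: "L0 > 0" "\<And>L. L \<ge> L0 \<Longrightarrow> integral (bx (4 * L)) (\<lambda>x. (usq x)\<^sup>2) \<le> e * L"
      using square_integral_sublinear[OF continuous_usq u0 int e] by auto
    define L where "L = max L0 1"
    have L: "L \<ge> 1" "L \<ge> L0" by (auto simp: L_def)
    have "integral (bx (4 * L)) (\<lambda>x. (usq x)\<^sup>2) = (8 * L) ^ 3 * (usq 0)\<^sup>2"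
      using L by (subst usq) (simp add: content_bx)
    then have "L * (512 * L\<^sup>2 * (usq 0)\<^sup>2) \<le> L * e"
      using L0(2)[OF L(2)] by (simp add: power_mult_distrib eval_nat_numeral mult_ac)
    then have "512 * L\<^sup>2 * (usq 0)\<^sup>2 \<le> e" using L by simp
    moreover have "512 * 1 * (usq 0)\<^sup>2 \<le> 512 * L\<^sup>2 * (usq 0)\<^sup>2"
      using L by (intro mult_right_mono mult_left_mono one_le_power) auto
    ultimately show ?thesis by simp
  qed
  then have "512 * (usq 0)\<^sup>2 \<le> 0" by (rule field_le_epsilon)
  then have "usq 0 = 0" by simp
  then show ?thesis using usq_ge[of i x] usq[of x] by simp
qed

end

theorem theorem1p1:
  fixes u :: "real^3 \<Rightarrow> real^3" and p :: "real^3 \<Rightarrow> real"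
  assumes "smooth u" and "smooth p"
    and NS: "\<And>x. (\<Sum>j\<in>UNIV. (u x $ j) *\<^sub>R pd j u x) - (\<Sum>j\<in>UNIV. pd j (pd j u) x)
                 = (\<chi> i. pd i p x)"
    and div: "\<And>x. (\<Sum>j\<in>UNIV. pd j u x $ j) = 0"
    and "BMO_minus1 u"
    and "L6 u"
  shows "\<forall>x. u x = 0"
proof -
  obtain d :: "3 \<Rightarrow> 3 \<Rightarrow> real^3 \<Rightarrow> real" where d: "\<And>i j x. d i j x = - d j i x" "\<And>i j. BMO (d i j)"
    "\<And>\<phi> i. test_fun \<phi> \<Longrightarrow> integral\<^sup>L lborel (\<lambda>x. u x $ i * \<phi> x)
            = - (\<Sum>j\<in>UNIV. integral\<^sup>L lborel (\<lambda>x. d i j x * pd j \<phi> x))"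
    using \<open>BMO_minus1 u\<close> unfolding BMO_minus1_def by blast
  have pd_nth: "pd j (\<lambda>x. f x $ i) = (\<lambda>x. pd j f x $ i)" if "smooth f" for f :: "real^3 \<Rightarrow> real^3" and i j
    by (rule ext, rule pd_linear[OF bounded_linear_vec_nth smooth_differentiable[OF that]])
  have s2: "smooth (pd j u)" for j by (rule smooth_pd[OF \<open>smooth u\<close>])
  interpret global_NS_BMO "\<lambda>i x. u x $ i" "\<lambda>x. - p x" d
  proof
    show "smooth (\<lambda>x. u x $ i)" for i by (rule smooth_nth[OF \<open>smooth u\<close>])
    show "smooth (\<lambda>x. - p x)" by (intro smooth_intros \<open>smooth p\<close>)
    show "(\<Sum>j\<in>UNIV. pd j (\<lambda>x. u x $ j) x) = 0" for x
      using div[of x] by (simp add: pd_nth \<open>smooth u\<close>)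
    show "pd i (\<lambda>x. - p x) x = (\<Sum>j\<in>UNIV. pd j (pd j (\<lambda>x. u x $ i)) x) - (\<Sum>j\<in>UNIV. u x $ j * pd j (\<lambda>x. u x $ i) x)" for i x
    proof -
      have "pd i p x = ((\<Sum>j\<in>UNIV. (u x $ j) *\<^sub>R pd j u x) - (\<Sum>j\<in>UNIV. pd j (pd j u) x)) $ i"
        unfolding NS by simp
      moreover have "pd i (\<lambda>x. - p x) x = - pd i p x"
        by (rule pd_linear[OF bounded_linear_minus[OF bounded_linear_ident] smooth_differentiable[OF \<open>smooth p\<close>]])
      ultimately show ?thesis by (simp add: pd_nth \<open>smooth u\<close> s2)
    qed
    show "d i j x = - d j i x" for i j x by (rule d(1))
    show "BMO (d i j)" for i j by (rule d(2))
    show "integral\<^sup>L lborel (\<lambda>x. u x $ i * \<phi> x) = - (\<Sum>j\<in>UNIV. integral\<^sup>L lborel (\<lambda>x. d i j x * pd j \<phi> x))"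
      if "test_fun \<phi>" for \<phi> i using that by (rule d(3))
  qed
  have "usq x ^ 3 = norm (u x) ^ 6" for x
  proof -
    have "usq x = (norm (u x))\<^sup>2" by (simp add: usq_def norm_vec_def L2_set_def sum_nonneg)
    then show ?thesis by (simp flip: power_mult)
  qed
  then have "integrable lborel (\<lambda>x. usq x ^ 3)" using \<open>L6 u\<close> by (simp add: L6_def)
  from vanishes[OF this] show ?thesis by (simp add: vec_eq_iff)
qed

end
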